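(* Let $n\ge 3$. For each compact convex set $K$ in $\mathbb{R}^n$ with $\dim K\ge 1$, define $$F(K)=\frac{V_1(K)}{\sum_{i=1}^n V_1(K|e_i^\perp)}.$$ Then $F(K)$ is minimal (i.e. $F(K)\le F(L)$ for every compact convex set $L\subset\mathbb{R}^n$ with $\dim L\ge 1$) if and only if $K$ is a regular coordinate cross-polytope.
   Context: $e_1,\dots,e_n$ is the standard orthonormal basis of $\mathbb{R}^n$, $e_i^\perp$ is the $i$th coordinate hyperplane (the subspace orthogonal to $e_i$), and $K|e_i^\perp$ is the orthogonal projection of $K$ on $e_i^\perp$. $\dim K$ is the dimension of the affine hull of $K$. $V_m$ denotes the $m$th intrinsic volume: for nonempty compact convex $K\subset\mathbb{R}^n$, the numbers $V_0(K),\dots,V_n(K)$ are defined by the Steiner formula $\mathcal{H}^n(K+tB^n)=\sum_{i=0}^n\kappa_{n-i}V_i(K)t^{n-i}$, $t\ge0$, where $B^n$ is the unit ball, $\kappa_k$ is the volume of the unit ball in $\mathbb{R}^k$, and $\mathcal{H}^n$ is $n$-dimensional volume; $V_i(K)$ does not depend on the ambient space. In particular, $V_1(K)=\frac{1}{\kappa_{n-1}}\int_{S^{n-1}}h_K(u)\,du$, where $h_K(x)=\sup\{x\cdot y:y\in K\}$ is the support function. A cross-polytope is the convex hull of mutually orthogonal line segments with a point in common; it is a coordinate cross-polytope if these segments are parallel to the coordinate axes. "Regular" has its traditional meaning for polytopes, so a regular coordinate cross-polytope in $\mathbb{R}^n$ is a set $x+rC^n$ with $x\in\mathbb{R}^n$,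 $r>0$, $C^n=\mathrm{conv}\{\pm e_1,\dots,\pm e_n\}$. *)

theory Defs
  imports "HOL-Analysis.Analysis" "HOL-Library.Set_Algebras"
begin

text \<open>
  The numbers \<open>V\<^sub>0(K), \<dots>, V\<^sub>n(K)\<close> with \<open>n = DIM('a)\<close>, for nonempty compact convex \<open>K\<close>: the
  coefficients in the Steiner formula
  \<open>vol (K + t B) = (\<Sum>i\<le>n. \<kappa>\<^sub>n\<^sub>-\<^sub>i V\<^sub>i(K) t\<^sup>n\<^sup>-\<^sup>i)\<close> for \<open>t \<ge> 0\<close>, where \<open>+\<close> is the Minkowski sum.
  That such numbers exist is Steiner's theorem; they are unique because the right-hand side is
  a polynomial in \<open>t\<close> and \<open>unit_ball_vol\<close> is positive here. The indices above \<open>n\<close> are set to 0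
  only to make the whole sequence unique.
\<close>
definition intrinsic_volume :: "nat \<Rightarrow> 'a::euclidean_space set \<Rightarrow> real" where
  "intrinsic_volume m K =
     (THE V :: nat \<Rightarrow> real.
        (\<forall>t\<ge>0. measure lebesgue (K + (*\<^sub>R) t ` cball 0 1) =
           (\<Sum>i\<le>DIM('a). unit_ball_vol (real (DIM('a) - i)) * V i * t ^ (DIM('a) - i))) \<and>
        (\<forall>i>DIM('a). V i = 0)) m"

definition coord_projection :: "'n \<Rightarrow> (real ^ 'n::finite) set \<Rightarrow> (real ^ 'n) set" where
  "coord_projection i K = (\<lambda>x. x - (x \<bullet> axis i 1) *\<^sub>R axis i 1) ` K"

text \<open>
  The projections stay in \<open>real ^ 'n\<close>, so their \<open>V\<^sub>1\<close> is taken there; intrinsic volumes do not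
  depend on the ambient space.
\<close>
definition width_ratio :: "(real ^ 'n::finite) set \<Rightarrow> real" where
  "width_ratio K =
     intrinsic_volume 1 K / (\<Sum>i\<in>UNIV. intrinsic_volume 1 (coord_projection i K))"

definition standard_cross_polytope :: "(real ^ 'n::finite) set" where
  "standard_cross_polytope = convex hull (\<Union>i. {axis i 1, - axis i 1})"

definition regular_coordinate_cross_polytope :: "(real ^ 'n::finite) set \<Rightarrow> bool" where
  "regular_coordinate_cross_polytope K \<longleftrightarrow>
     (\<exists>x r. r > 0 \<and> K = (\<lambda>y. x + r *\<^sub>R y) ` standard_cross_polytope)"

end

theory Submission
  imports Defs "HOL-Probability.Probability" "HOL-Real_Asymp.Real_Asymp"
    "HOL-Computational_Algebra.Polynomial"
begin

text \<open>
  Integrating the Steiner polynomials of the dilates \<open>t K\<close> against a Gaussian and differentiating at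
  \<open>t = 0\<close> shows that \<open>V\<^sub>1(K)\<close> is, up to a constant depending only on \<open>n\<close>, the Gaussian mean of the
  support function \<open>h\<close> of \<open>K\<close>, and similarly \<open>V\<^sub>1(K|e\<^sub>i\<^sup>\<perp>)\<close> is the Gaussian mean of
  \<open>h(x - x\<^sub>i e\<^sub>i)\<close>. Averaging \<open>h\<close> over all reflections in coordinate hyperplanes changes none of
  these means and yields a function \<open>f\<close> that is increasing in each coordinate on the positive orthant.
  The absolute coordinates of a Gaussian vector are \<open>Q(v\<^sub>i)\<close> with \<open>v\<close> uniform in the unit cube and
  \<open>Q\<close> the half-normal quantile function. Since \<open>f\<close> only decreases when the smallest coordinate is
  replaced by 0, conditioning on the smallest and on the largest coordinate bounds the numerator from
  below by \<open>\<integral>p\<^sup>n\<^sup>-\<^sup>2 T(p) X(p) dp\<close>, while the denominator equals \<open>\<integral>p\<^sup>n\<^sup>-\<^sup>2 Q(p) X(p) dp\<close>;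
  here \<open>X\<close> is decreasing, \<open>T\<close> does not depend on \<open>f\<close>, and \<open>T/Q\<close> is strictly decreasing.
  Chebyshev's integral inequality compares the ratio with that of the maximum norm, for which
  \<open>X\<close> is constant. Equality forces \<open>X\<close> to be constant, hence \<open>f\<close> to be a multiple of the maximum norm;
  then \<open>h\<close> is additive wherever the maximum norm is, so \<open>h\<close> is a linear function plus a multiple
  of the maximum norm, and \<open>K\<close> is a translate of a multiple of \<open>C\<^sup>n\<close>.
\<close>

text \<open>The Gaussian weight turns the first intrinsic volume into a mean over independent
  coordinates. Its constant depends on the ambient space only, and the projections are measured in
  the same space, so it cancels in the ratio. Steiner's formula comes first because
  \<open>intrinsic_volume\<close> is a definite description, of which nothing is known before
  existence and uniqueness. Both monotone quotients have one source, the monotone likelihood ratio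
  of the half-normal law under scaling: masses of lower intervals make X decrease, upper tails make
  T/Q decrease. The maximum norm is the benchmark because discarding the smallest coordinate costs
  it nothing, so each estimate in the chain is an equality for it. The condition n >= 3 acts in the
  equality case, which twice calls for a coordinate different from two given ones: to compare the
  averaged function on different basis vectors, and to compare the original one on sums of two
  signed basis vectors.\<close>

text \<open>
  The library computes the volume of a linear image (\<open>measure_linear_image\<close>) only for well-ordered
  index types; \<open>'n wo\<close> is a well-ordered copy of \<open>'n\<close>.
\<close>
typedef 'n wo = "UNIV :: 'n set" ..

instance wo :: (finite) finite
proof
  have "(UNIV :: 'a wo set) = range Abs_wo"
    by (metis Rep_wo_inverse surjI)
  then show "finite (UNIV :: 'a wo set)"
    by (metis finite_imageI finite)
qed

definition wo_rank :: "'n::finite wo \<Rightarrow> nat" where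
  "wo_rank = (SOME f. inj f)"

lemma inj_wo_rank: "inj (wo_rank :: 'n::finite wo \<Rightarrow> nat)"
proof -
  have "\<exists>f :: 'n wo \<Rightarrow> nat. inj f"
    using finite_imp_inj_to_nat_seg[of "UNIV :: 'n wo set"] by auto
  then show ?thesis unfolding wo_rank_def by (rule someI_ex)
qed

instantiation wo :: (finite) wellorder
begin
definition "a \<le> b \<longleftrightarrow> wo_rank a \<le> wo_rank b" for a b :: "'a wo"
definition "a < b \<longleftrightarrow> wo_rank a < wo_rank b" for a b :: "'a wo"
instance
proof
  fix a b :: "'a wo"
  show "a \<le> b \<Longrightarrow> b \<le> a \<Longrightarrow> a = b"
    unfolding less_eq_wo_def using inj_wo_rank by (metis antisym injD)
next
  fix P :: "'a wo \<Rightarrow> bool" and a :: "'a wo"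
  assume "\<And>x. (\<And>y. y < x \<Longrightarrow> P y) \<Longrightarrow> P x"
  then show "P a"
    unfolding less_wo_def by (induction a rule: measure_induct_rule[of wo_rank]) blast
qed (auto simp: less_eq_wo_def less_wo_def)
end

definition wo_vec :: "real ^ 'n::finite \<Rightarrow> real ^ 'n wo" where
  "wo_vec x = (\<chi> i. x $ Rep_wo i)"

lemma bij_Rep_wo: "bij Rep_wo"
  by (rule bijI') (metis Rep_wo_inverse Abs_wo_inverse UNIV_I)+

lemma linear_wo_vec: "linear wo_vec"
  by (rule linearI) (auto simp: wo_vec_def vec_eq_iff)

lemma wo_vec_inner: "wo_vec x \<bullet> wo_vec y = x \<bullet> y"
  unfolding inner_vec_def wo_vec_def vec_lambda_beta
  by (rule sum.reindex_bij_betw[OF bij_Rep_wo])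

lemma norm_wo_vec: "norm (wo_vec x) = norm x"
  by (simp add: norm_eq_sqrt_inner wo_vec_inner)

lemma dist_wo_vec: "dist (wo_vec x) (wo_vec y) = dist x y"
  by (metis dist_norm linear_diff linear_wo_vec norm_wo_vec)

lemma bij_wo_vec: "bij wo_vec"
proof (rule bijI')
  show "(wo_vec x = wo_vec y) = (x = y)" for x y :: "real ^ 'n::finite"
    by (metis dist_wo_vec dist_eq_0_iff)
  show "\<exists>x. y = wo_vec x" for y :: "real ^ 'n::finite wo"
    by (rule exI[of _ "\<chi> i. y $ Abs_wo i"]) (simp add: wo_vec_def vec_eq_iff Rep_wo_inverse)
qed

lemma borel_wo_vec [measurable]: "wo_vec \<in> borel_measurable borel"
  using linear_wo_vec linear_continuous_on borel_measurable_continuous_onI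
  by (metis linear_conv_bounded_linear)

text \<open>Lebesgue measure is determined by the volumes of open boxes, and reindexing the
  coordinates only permutes the factors of such a volume.\<close>

lemma lborel_wo_vec: "lborel = distr lborel borel (wo_vec :: real ^ 'n::finite \<Rightarrow> _)"
proof (rule lborel_eqI)
  fix l u :: "real ^ 'n wo"
  define l' u' :: "real ^ 'n" where "l' = (\<chi> i. l $ Abs_wo i)" and "u' = (\<chi> i. u $ Abs_wo i)"
  have l: "l = wo_vec l'" and u: "u = wo_vec u'"
    by (simp_all add: wo_vec_def l'_def u'_def vec_eq_iff Rep_wo_inverse)
  assume le: "\<And>b. b \<in> Basis \<Longrightarrow> l \<bullet> b \<le> u \<bullet> b"
  have "l $ i \<le> u $ i" for i
    using le[of "axis i 1"] by (simp add: inner_axis axis_in_Basis_iff)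
  then have le': "l' $ i \<le> u' $ i" for i by (simp add: l'_def u'_def)
  then have le'': "l' \<bullet> b \<le> u' \<bullet> b" if "b \<in> Basis" for b
    using that by (auto simp: Basis_vec_def inner_axis)
  have eq: "wo_vec -` box l u = box l' u'"
    using bij_Rep_wo by (auto simp: mem_box_cart l u wo_vec_def bij_iff) (metis bij_Rep_wo bij_pointE)+
  have "(\<Prod>b\<in>Basis. (u - l) \<bullet> b) = (\<Prod>i\<in>UNIV. (u - l) $ i)"
    unfolding Basis_vec_def
    by (simp add: UNION_singleton_eq_range prod.reindex inj_on_def axis_eq_axis inner_axis)
  also have "\<dots> = (\<Prod>i\<in>UNIV. (u' - l') $ i)"
    unfolding l u wo_vec_def vec_lambda_beta vector_minus_component
    by (rule prod.reindex_bij_betw[OF bij_Rep_wo, of "\<lambda>i. u' $ i - l' $ i"])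
  also have "\<dots> = (\<Prod>b\<in>Basis. (u' - l') \<bullet> b)"
    unfolding Basis_vec_def
    by (simp add: UNION_singleton_eq_range prod.reindex inj_on_def axis_eq_axis inner_axis)
  finally have *: "(\<Prod>b\<in>Basis. (u - l) \<bullet> b) = (\<Prod>b\<in>Basis. (u' - l') \<bullet> b)" .
  show "emeasure (distr lborel borel wo_vec) (box l u) = (\<Prod>b\<in>Basis. (u - l) \<bullet> b)"
    using le'' by (subst emeasure_distr) (simp_all add: eq * emeasure_lborel_box)
qed simp

lemma measure_wo_vec_image:
  fixes S :: "(real ^ 'n::finite) set"
  assumes "S \<in> sets borel"
  shows "measure lebesgue (wo_vec ` S) = measure lebesgue S"
proof -
  have inv: "wo_vec -` (wo_vec ` S) = S"
    using bij_wo_vec bij_is_inj inj_vimage_image_eq by blast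
  have "wo_vec ` S = inv wo_vec -` S"
    using bij_image_Collect_eq[OF bij_wo_vec, of "\<lambda>x. x \<in> S"] by (simp add: vimage_def)
  moreover have "linear (inv (wo_vec :: real ^ 'n \<Rightarrow> _))"
  proof (rule linearI)
    have i: "inv wo_vec (wo_vec a) = a" for a :: "real ^ 'n"
      by (simp add: bij_is_inj bij_wo_vec)
    fix x y :: "real ^ 'n wo" and c :: real
    obtain a b where "x = wo_vec a" "y = wo_vec b"
      by (metis bij_wo_vec bij_pointE)
    then show "inv wo_vec (x + y) = inv wo_vec x + inv wo_vec y"
      "inv wo_vec (c *\<^sub>R x) = c *\<^sub>R inv wo_vec x"
      using i by (simp_all flip: linear_add[OF linear_wo_vec] linear_cmul[OF linear_wo_vec])
  qed
  then have "inv (wo_vec :: real ^ 'n \<Rightarrow> _) \<in> borel_measurable borel"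
    by (intro borel_measurable_continuous_onI linear_continuous_on)
      (simp add: linear_conv_bounded_linear)
  ultimately have b: "wo_vec ` S \<in> sets borel"
    using assms measurable_sets_borel by metis
  have "measure lborel (wo_vec ` S) = measure lborel S"
    using b assms inv by (subst lborel_wo_vec) (simp add: measure_distr)
  then show ?thesis using assms b by simp
qed

subsection \<open>Steiner's formula\<close>

text \<open>In the Leibniz expansion every term is a product of n factors affine in
  \<open>s\<close>. This is the origin of the degree bound in Steiner's formula.\<close>

lemma det_affine_poly:
  fixes a b :: "'n::finite \<Rightarrow> 'n \<Rightarrow> real"
  shows "\<exists>p. degree p \<le> CARD('n) \<and> (\<forall>s. det (\<chi> i j. a i j + s * b i j) = poly p s)"
proof -
  define p where "p = (\<Sum>\<pi>\<in>{\<pi>. \<pi> permutes (UNIV :: 'n set)}.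
    smult (of_int (sign \<pi>)) (\<Prod>i\<in>UNIV. [:a i (\<pi> i), b i (\<pi> i):]))"
  have "degree (\<Prod>i\<in>UNIV. [:a i (\<pi> i), b i (\<pi> i):]) \<le> CARD('n)" for \<pi>
  proof -
    have "degree (\<Prod>i\<in>UNIV. [:a i (\<pi> i), b i (\<pi> i):])
        \<le> (\<Sum>i\<in>UNIV. degree [:a i (\<pi> i), b i (\<pi> i):])"
      using degree_prod_sum_le[of UNIV "\<lambda>i. [:a i (\<pi> i), b i (\<pi> i):]"] by (simp add: comp_def)
    also have "\<dots> \<le> (\<Sum>i\<in>(UNIV :: 'n set). 1)" by (rule sum_mono) simp
    finally show ?thesis by simp
  qed
  then have "degree p \<le> CARD('n)"
    unfolding p_def by (intro degree_sum_le) (auto intro: order_trans[OF degree_smult_le])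
  moreover have "det (\<chi> i j. a i j + s * b i j) = poly p s" for s
    unfolding det_def p_def by (simp add: poly_sum poly_prod)
  ultimately show ?thesis by blast
qed

lemma closest_point_eqI:
  fixes p :: "'a::euclidean_space"
  assumes "convex S" "closed S" "p \<in> S" "\<And>z. z \<in> S \<Longrightarrow> (x - p) \<bullet> (z - p) \<le> 0"
  shows "closest_point S x = p"
proof -
  have "dist x p \<le> dist x z" if "z \<in> S" for z
  proof -
    have "(norm (x - z))\<^sup>2 = (norm (x - p))\<^sup>2 - 2 * ((x - p) \<bullet> (z - p)) + (norm (z - p))\<^sup>2"
      by (simp add: power2_norm_eq_inner algebra_simps inner_commute)
    then have "(norm (x - p))\<^sup>2 \<le> (norm (x - z))\<^sup>2"
      using assms(4)[OF that] by (smt (verit) zero_le_power2)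
    then show ?thesis by (simp add: dist_norm)
  qed
  then show ?thesis using closest_point_unique[of S p x] assms by simp
qed

text \<open>The obtuse-angle condition that characterizes the nearest point \<open>p\<close> is
  homogeneous in \<open>x - p\<close>, so it holds along the whole ray from \<open>p\<close> through
  \<open>x\<close>.\<close>

lemma closest_point_ray:
  fixes S :: "'a::euclidean_space set" and x :: 'a
  assumes "convex S" "closed S" "S \<noteq> {}" "0 \<le> s"
  defines "p \<equiv> closest_point S x"
  shows "closest_point S (p + s *\<^sub>R (x - p)) = p"
proof (rule closest_point_eqI)
  fix z assume "z \<in> S"
  then have "(x - p) \<bullet> (z - p) \<le> 0"
    unfolding p_def using closest_point_dot assms by blast
  then show "(p + s *\<^sub>R (x - p) - p) \<bullet> (z - p) \<le> 0"
    using \<open>0 \<le> s\<close> by (simp add: mult_nonneg_nonpos)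
qed (use assms closest_point_in_set in auto)

lemma infdist_closest_point:
  fixes S :: "'a::euclidean_space set"
  shows "closed S \<Longrightarrow> S \<noteq> {} \<Longrightarrow> infdist x S = dist x (closest_point S x)"
  by (simp add: infdist_eq_setdist setdist_closest_point)

lemma compact_parallel_body:
  fixes K :: "'a::euclidean_space set"
  assumes "compact K" "K \<noteq> {}"
  shows "compact {x. infdist x K \<le> t}"
proof (cases "t \<ge> 0")
  case True
  have "closed {x. infdist x K \<le> t}"
    by (intro closed_Collect_le continuous_intros)
  moreover have "bounded {x. infdist x K \<le> t}"
  proof -
    obtain r where r: "\<And>y. y \<in> K \<Longrightarrow> norm y \<le> r"
      using compact_imp_bounded[OF assms(1)] by (auto simp: bounded_iff)
    have "norm x \<le> r + t" if "infdist x K \<le> t" for x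
    proof -
      have "closest_point K x \<in> K" "dist x (closest_point K x) \<le> t"
        using that assms infdist_closest_point[of K x] closest_point_in_set[of K x]
        by (auto simp: compact_imp_closed)
      with r[of "closest_point K x"] show ?thesis
        by (smt (verit) dist_norm norm_triangle_ineq2)
    qed
    then show ?thesis by (auto simp: bounded_iff)
  qed
  ultimately show ?thesis by (simp add: compact_eq_bounded_closed)
next
  case False
  then have "{x. infdist x K \<le> t} = {}"
    by (smt (verit) Collect_empty_eq infdist_nonneg)
  then show ?thesis by simp
qed

text \<open>\<open>P\<close> is the orthogonal projection onto \<open>S\<close>, so the map fixes
  \<open>S\<close> and multiplies its orthogonal complement by \<open>s\<close>. That its
  determinant is a polynomial is read off from matrix entries affine in \<open>s\<close>.\<close>

lemma linear_stretch_measure: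
  fixes S :: "(real ^ 'n::{finite,wellorder}) set"
  assumes "subspace S"
  obtains P where "linear P" "\<And>y. y \<in> S \<Longrightarrow> P y = y"
    "\<And>y. (\<forall>z\<in>S. y \<bullet> z = 0) \<Longrightarrow> P y = 0"
    "\<exists>p. degree p \<le> CARD('n) \<and> (\<forall>s\<ge>0. \<forall>M\<in>lmeasurable.
       measure lebesgue ((\<lambda>x. s *\<^sub>R x + (1 - s) *\<^sub>R P x) ` M) = poly p s * measure lebesgue M)"
proof -
  obtain B where B: "B \<subseteq> S" "pairwise orthogonal B" "\<And>x. x \<in> B \<Longrightarrow> norm x = 1"
    "independent B" "span B = S"
    using orthonormal_basis_subspace[OF assms] by metis
  have fin: "finite B" using B(4) by (simp add: independent_imp_finite)
  define P where "P y = (\<Sum>b\<in>B. (y \<bullet> b) *\<^sub>R b)" for y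
  have lin: "linear P"
    unfolding P_def
    by (rule linearI) (simp_all add: inner_add_left scaleR_add_left sum.distrib scaleR_sum_right)
  have id: "P y = y" if "y \<in> S" for y
    unfolding P_def using orthonormal_basis_expand[OF B(2,3)] that B(5) fin by auto
  have P_in: "P y \<in> S" for y
    unfolding P_def B(5)[symmetric] by (intro span_sum span_scale span_base)
  have zero: "P y = 0" if "\<forall>z\<in>S. y \<bullet> z = 0" for y
    unfolding P_def using that B(1) by (intro sum.neutral) auto
  define D where "D s x = s *\<^sub>R x + (1 - s) *\<^sub>R P x" for s x
  have linD: "linear (D s)" for s
    unfolding D_def
    by (rule linearI) (simp_all add: linear_add[OF lin] linear_cmul[OF lin] algebra_simps)
  have DD: "D r \<circ> D s = D (r * s)" for r s
    unfolding D_def comp_def fun_eq_iff linear_add[OF lin] linear_cmul[OF lin] id[OF P_in]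
    by (simp add: algebra_simps)
  have "matrix (D s) = (\<chi> i j. P (axis j 1) $ i + s * ((axis j 1 - P (axis j 1)) $ i))" for s
    unfolding matrix_def D_def by (simp add: vec_eq_iff algebra_simps)
  then obtain p where p: "degree p \<le> CARD('n)" "\<And>s. det (matrix (D s)) = poly p s"
    using det_affine_poly[of "\<lambda>i j. P (axis j 1) $ i" "\<lambda>i j. (axis j 1 - P (axis j 1)) $ i"]
    by auto
  \<comment> \<open>The change of variables yields the absolute value of the determinant. The map
    for \<open>s\<close> is the square of the map for \<open>sqrt s\<close>, so its determinant is
    nonnegative.\<close>
  have pos: "poly p s \<ge> 0" if "s \<ge> 0" for s
  proof -
    have "matrix (D s) = matrix (D (sqrt s)) ** matrix (D (sqrt s))"
      using that by (simp add: matrix_compose[OF linD linD, symmetric] DD)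
    then show ?thesis by (metis p(2) det_mul zero_le_square)
  qed
  have "measure lebesgue (D s ` M) = poly p s * measure lebesgue M"
    if "s \<ge> 0" "M \<in> lmeasurable" for s M
    using measure_linear_image[OF linD that(2), of s] p(2) pos[OF that(1)] by simp
  with p(1) lin id zero show thesis
    by (intro that[of P]) (auto simp: D_def)
qed

text \<open>
  The parallel body is cut into the sets of points \<open>x\<close> for which the vertices in the face of the
  polytope exposed by \<open>x\<close> minus its nearest point form a given set \<open>W\<close>. The piece of radius \<open>t\<close>
  is the image of the piece of radius 1 under the map which is the identity along the direction space
  of \<open>W\<close> and multiplies by \<open>t\<close> orthogonally to it; its determinant is a polynomial in \<open>t\<close>.
\<close>
lemma steiner_polytope:
  fixes V :: "(real ^ 'n::{finite,wellorder}) set"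
  assumes "finite V" "V \<noteq> {}"
  shows "\<exists>p. degree p \<le> CARD('n) \<and>
    (\<forall>t>0. measure lebesgue {x. infdist x (convex hull V) \<le> t} = poly p t)"
proof -
  define P where "P = convex hull V"
  have P: "convex P" "closed P" "P \<noteq> {}" "compact P"
    using assms by (auto simp: P_def finite_imp_compact_convex_hull compact_imp_closed)
  define \<pi> where "\<pi> = closest_point P"
  have \<pi>P: "\<pi> x \<in> P" for x
    unfolding \<pi>_def using P closest_point_in_set by blast
  have cont: "continuous_on UNIV \<pi>"
    unfolding \<pi>_def using P continuous_on_closest_point by blast
  then have [measurable]: "\<pi> \<in> borel_measurable borel"
    by (rule borel_measurable_continuous_onI)
  \<comment> \<open>These inner products are nonpositive for every vertex, because
    \<open>\<pi> x\<close> is nearest to \<open>x\<close>; equality selects the exposed face. For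
    \<open>x\<close> in the polytope itself, all of \<open>V\<close> is selected.\<close>
  define act where "act x = {v \<in> V. (v - \<pi> x) \<bullet> (x - \<pi> x) = 0}" for x
  define M where "M W t = {x. act x = W \<and> dist x (\<pi> x) \<le> t}" for W t
  have ray: "\<pi> (\<pi> x + s *\<^sub>R (x - \<pi> x)) = \<pi> x" if "s \<ge> 0" for x s
    unfolding \<pi>_def using closest_point_ray[OF P(1-3) that] .
  have act_ray: "act (\<pi> x + s *\<^sub>R (x - \<pi> x)) = act x" if "s > 0" for x s
    unfolding act_def using ray[of s x] that by auto
  \<comment> \<open>Weighting the inner products by a convex representation of
    \<open>\<pi> x\<close> gives nonpositive terms with sum 0. So no weight falls on a vertex
    outside \<open>act x\<close>.\<close>
  have in_hull: "\<exists>u. (\<forall>v\<in>act x. 0 \<le> u v) \<and> sum u (act x) = 1 \<and> (\<Sum>v\<in>act x. u v *\<^sub>R v) = \<pi> x" for x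
  proof -
    obtain u where u: "\<And>v. v \<in> V \<Longrightarrow> 0 \<le> u v" "sum u V = 1" "(\<Sum>v\<in>V. u v *\<^sub>R v) = \<pi> x"
      using \<pi>P[of x] unfolding P_def convex_hull_finite[OF assms(1)] by auto
    have le: "u v * ((v - \<pi> x) \<bullet> (x - \<pi> x)) \<le> 0" if "v \<in> V" for v
    proof -
      have "(x - \<pi> x) \<bullet> (v - \<pi> x) \<le> 0"
        unfolding \<pi>_def using P that by (intro closest_point_dot) (auto simp: P_def hull_inc)
      then show ?thesis using u(1)[OF that] by (simp add: inner_commute mult_nonneg_nonpos)
    qed
    have "(\<Sum>v\<in>V. u v * ((v - \<pi> x) \<bullet> (x - \<pi> x))) = ((\<Sum>v\<in>V. u v *\<^sub>R v) - (sum u V) *\<^sub>R \<pi> x) \<bullet> (x - \<pi> x)"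
      by (simp add: inner_sum_left inner_diff_left right_diff_distrib sum_subtractf sum_distrib_right
          flip: sum_distrib_right)
    also have "\<dots> = 0" by (simp add: u)
    finally have "u v * ((v - \<pi> x) \<bullet> (x - \<pi> x)) = 0" if "v \<in> V" for v
      using sum_nonneg_eq_0_iff[OF assms(1), of "\<lambda>v. - (u v * ((v - \<pi> x) \<bullet> (x - \<pi> x)))"] le that
      by (simp add: sum_negf)
    then have z: "u v = 0" if "v \<in> V - act x" for v
      using that by (auto simp: act_def)
    have "act x \<subseteq> V" by (auto simp: act_def)
    then have "sum u (act x) = sum u V" "(\<Sum>v\<in>act x. u v *\<^sub>R v) = (\<Sum>v\<in>V. u v *\<^sub>R v)"
      using z by (auto intro!: sum.mono_neutral_left[OF assms(1)])
    then have "sum u (act x) = 1" "(\<Sum>v\<in>act x. u v *\<^sub>R v) = \<pi> x"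
      by (simp_all add: u)
    with u(1) show ?thesis by (auto simp: act_def)
  qed
  have act_ne: "act x \<noteq> {}" for x
    using in_hull[of x] by auto
  have act_V: "act x \<subseteq> V" for x
    by (auto simp: act_def)
  have bor: "M W t \<in> sets borel" for W t
  proof (cases "W \<subseteq> V")
    case True
    then have "M W t = {x. (\<forall>v\<in>V. (v \<in> W) = ((v - \<pi> x) \<bullet> (x - \<pi> x) = 0)) \<and> dist x (\<pi> x) \<le> t}"
      by (auto simp: M_def act_def)
    also have "\<dots> \<in> sets borel"
      using assms(1) by measurable
    finally show ?thesis .
  next
    case False
    then have "M W t = {}" using act_V by (auto simp: M_def)
    then show ?thesis by simp
  qed
  have sub: "M W t \<subseteq> {x. infdist x P \<le> t}" for W t
    using infdist_closest_point[OF P(2,3)] by (auto simp: M_def \<pi>_def)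
  have lme: "M W t \<in> lmeasurable" for W t
    using bor[of W t] bounded_subset[OF compact_imp_bounded[OF compact_parallel_body[OF P(4,3)]] sub]
    by (intro bounded_set_imp_lmeasurable) auto
  have poly: "\<exists>p. degree p \<le> CARD('n) \<and> (\<forall>t>0. measure lebesgue (M W t) = poly p t)" for W
  proof (cases "W = {}")
    case True
    then have "M W t = {}" for t using act_ne by (auto simp: M_def)
    then show ?thesis by (intro exI[of _ 0]) simp
  next
    case False
    then obtain w0 where w0: "w0 \<in> W" by auto
    define S where "S = span ((\<lambda>w. w - w0) ` W)"
    have "subspace S" by (simp add: S_def)
    then obtain Q where Q: "linear Q" "\<And>y. y \<in> S \<Longrightarrow> Q y = y"
        "\<And>y. (\<forall>z\<in>S. y \<bullet> z = 0) \<Longrightarrow> Q y = 0"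
      and "\<exists>p. degree p \<le> CARD('n) \<and> (\<forall>s\<ge>0. \<forall>M\<in>lmeasurable.
         measure lebesgue ((\<lambda>x. s *\<^sub>R x + (1 - s) *\<^sub>R Q x) ` M) = poly p s * measure lebesgue M)"
      by (rule linear_stretch_measure) (rule that)
    then obtain p where p: "degree p \<le> CARD('n)" "\<And>s M. s \<ge> 0 \<Longrightarrow> M \<in> lmeasurable \<Longrightarrow>
         measure lebesgue ((\<lambda>x. s *\<^sub>R x + (1 - s) *\<^sub>R Q x) ` M) = poly p s * measure lebesgue M"
      by blast
    \<comment> \<open>This is the stretch centred at \<open>w0\<close>, namely w0 + s (x - w0) + (1
      - s) Q (x - w0). On the piece of \<open>W\<close>, the offset \<open>\<pi> x - w0\<close> lies
      in \<open>S\<close> and \<open>x - \<pi> x\<close> is orthogonal to \<open>S\<close>, so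
      \<open>T s\<close> multiplies exactly \<open>x - \<pi> x\<close> by \<open>s\<close>.\<close>
    define T where "T s x = (w0 - s *\<^sub>R w0 - (1 - s) *\<^sub>R Q w0) + (s *\<^sub>R x + (1 - s) *\<^sub>R Q x)" for s x
    have T: "T s x = \<pi> x + s *\<^sub>R (x - \<pi> x)" if "act x = W" for s x
    proof -
      obtain u where u: "sum u W = 1" "(\<Sum>v\<in>W. u v *\<^sub>R v) = \<pi> x"
        using in_hull[of x] unfolding \<open>act x = W\<close> by blast
      have "\<pi> x - w0 = (\<Sum>v\<in>W. u v *\<^sub>R v) - sum u W *\<^sub>R w0" using u by simp
      also have "\<dots> = (\<Sum>v\<in>W. u v *\<^sub>R (v - w0))"
        by (simp add: scaleR_sum_left sum_subtractf algebra_simps)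
      also have "\<dots> \<in> S" unfolding S_def by (intro span_sum span_scale span_base) auto
      finally have 1: "Q (\<pi> x - w0) = \<pi> x - w0" by (rule Q(2))
      have "(x - \<pi> x) \<bullet> z = 0" if "z \<in> S" for z
        using that unfolding S_def
      proof (induction rule: span_induct)
        case base
        show ?case by (auto intro: subspaceI simp: inner_add_right)
      next
        case (step z)
        then obtain w where w: "w \<in> W" "z = w - w0" by auto
        have "w \<in> act x" "w0 \<in> act x" using \<open>act x = W\<close> w w0 by auto
        then have "(w - \<pi> x) \<bullet> (x - \<pi> x) = 0" "(w0 - \<pi> x) \<bullet> (x - \<pi> x) = 0"
          by (auto simp: act_def)
        then show ?case by (simp add: w algebra_simps inner_commute)
      qed
      then have 2: "Q (x - \<pi> x) = 0" by (intro Q(3)) auto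
      have "Q x = Q w0 + Q (\<pi> x - w0) + Q (x - \<pi> x)"
        by (simp flip: linear_add[OF Q(1)])
      then have Qx: "Q x = Q w0 + \<pi> x - w0" using 1 2 by simp
      show ?thesis unfolding T_def Qx by (simp add: algebra_simps)
    qed
    have TM: "T s ` M W 1 = M W s" if "s > 0" for s
    proof (intro equalityI subsetI)
      fix y assume "y \<in> T s ` M W 1"
      then obtain x where x: "y = T s x" "act x = W" "dist x (\<pi> x) \<le> 1" by (auto simp: M_def)
      then have y: "y = \<pi> x + s *\<^sub>R (x - \<pi> x)" using T by simp
      have "act y = W" "\<pi> y = \<pi> x" unfolding y using act_ray ray that x by auto
      moreover have "dist y (\<pi> y) = s * dist x (\<pi> x)"
        using that by (simp add: dist_norm \<open>\<pi> y = \<pi> x\<close>) (simp add: y)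
      ultimately show "y \<in> M W s" using x(3) that by (simp add: M_def mult_left_le)
    next
      fix y assume "y \<in> M W s"
      then have y: "act y = W" "dist y (\<pi> y) \<le> s" by (auto simp: M_def)
      define x where "x = \<pi> y + (1/s) *\<^sub>R (y - \<pi> y)"
      have x: "act x = W" "\<pi> x = \<pi> y" unfolding x_def using act_ray ray that y by auto
      have "dist x (\<pi> x) = dist y (\<pi> y) / s"
        using that by (simp add: dist_norm x(2)) (simp add: x_def)
      then have "x \<in> M W 1" using x y that by (simp add: M_def)
      moreover have "T s x = y" using T[OF x(1), of s] that by (simp add: x(2)) (simp add: x_def)
      ultimately show "y \<in> T s ` M W 1" by blast
    qed
    have mT: "measure lebesgue (T s ` M W 1) = poly p s * measure lebesgue (M W 1)" if "s > 0" for s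
    proof -
      have "T s ` M W 1 = (+) (w0 - s *\<^sub>R w0 - (1 - s) *\<^sub>R Q w0) ` (\<lambda>x. s *\<^sub>R x + (1 - s) *\<^sub>R Q x) ` M W 1"
        by (simp add: image_image T_def)
      then show ?thesis using p(2)[OF _ lme, of s] that by (simp only: measure_translation)
    qed
    have "measure lebesgue (M W s) = poly (smult (measure lebesgue (M W 1)) p) s" if "s > 0" for s
      using mT[OF that] unfolding TM[OF that] by (simp add: mult.commute)
    moreover have "degree (smult (measure lebesgue (M W 1)) p) \<le> CARD('n)"
      using p(1) degree_smult_le[of _ p] le_trans by blast
    ultimately show ?thesis by blast
  qed
  then obtain p where p: "\<And>W. degree (p W) \<le> CARD('n)"
    "\<And>W t. t > 0 \<Longrightarrow> measure lebesgue (M W t) = poly (p W) t" by metis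
  have "measure lebesgue {x. infdist x P \<le> t} = poly (\<Sum>W\<in>Pow V. p W) t" if "t > 0" for t
  proof -
    have "{x. infdist x P \<le> t} = (\<Union>W\<in>Pow V. M W t)"
      using infdist_closest_point[OF P(2,3)] act_V by (auto simp: M_def \<pi>_def)
    also have "measure lebesgue \<dots> = (\<Sum>W\<in>Pow V. measure lebesgue (M W t))"
    proof (rule measure_finite_Union)
      show "disjoint_family_on (\<lambda>W. M W t) (Pow V)" by (auto simp: disjoint_family_on_def M_def)
      show "emeasure lebesgue (M W t) \<noteq> \<infinity>" for W using fmeasurableD2[OF lme] by simp
    qed (use assms(1) lme in auto)
    finally show ?thesis using p(2)[OF that] by (simp add: poly_sum)
  qed
  moreover have "degree (\<Sum>W\<in>Pow V. p W) \<le> CARD('n)"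
    using p(1) assms(1) by (intro degree_sum_le) auto
  ultimately show ?thesis unfolding P_def by blast
qed

section \<open>From polytopes to compact convex sets\<close>

lemma poly_pointwise_limit:
  fixes f :: "real \<Rightarrow> real"
  assumes deg: "\<And>k. degree (p k) \<le> n"
    and lim: "\<And>t. t > 0 \<Longrightarrow> (\<lambda>k. poly (p k) t) \<longlonglongrightarrow> f t"
  shows "\<exists>q. degree q \<le> n \<and> (\<forall>t>0. f t = poly q t)"
proof -
  \<comment> \<open>Lagrange interpolation at n + 1 nodes recovers a polynomial of degree at most n
    from finitely many values, and those values converge. The nodes start at 1 because convergence
    is assumed for positive arguments.\<close>
  define x where "x j = real (Suc j)" for j
  have x_inj: "x j = x k \<longleftrightarrow> j = k" and x_pos: "x j > 0" for j k by (auto simp: x_def)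
  define L where "L j = (\<Prod>k\<in>{..n} - {j}. smult (1 / (x j - x k)) [:- x k, 1:])" for j
  have L: "poly (L j) (x i) = (if i = j then 1 else 0)" if "i \<le> n" "j \<le> n" for i j
  proof (cases "i = j")
    case True
    have "poly (smult (1 / (x j - x k)) [:- x k, 1:]) (x j) = 1" if "k \<noteq> j" for k
    proof -
      have "x j - x k \<noteq> 0" using x_inj[of j k] that by auto
      then show ?thesis by (simp add: divide_simps)
    qed
    then show ?thesis using True by (auto simp: L_def poly_prod simp del: poly_smult intro!: prod.neutral)
  next
    case False
    then show ?thesis using that by (auto simp: L_def poly_prod intro!: prod_zero bexI[of _ i])
  qed
  have degL: "degree (L j) \<le> n" if "j \<le> n" for j
  proof -
    have "degree (L j) \<le> (\<Sum>k\<in>{..n} - {j}. degree (smult (1 / (x j - x k)) [:- x k, 1:]))"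
      unfolding L_def
      using degree_prod_sum_le[of "{..n} - {j}" "\<lambda>k. smult (1 / (x j - x k)) [:- x k, 1:]"]
      by (simp add: comp_def)
    also have "\<dots> \<le> (\<Sum>k\<in>{..n} - {j}. 1)"
      by (intro sum_mono order_trans[OF degree_smult_le]) simp
    finally show ?thesis using that by simp
  qed
  have interp: "r = (\<Sum>j\<le>n. smult (poly r (x j)) (L j))" if "degree r \<le> n" for r
  proof (rule poly_eqI_degree)
    show "poly r a = poly (\<Sum>j\<le>n. smult (poly r (x j)) (L j)) a" if "a \<in> x ` {..n}" for a
      using that L by (auto simp: poly_sum if_distrib[of "(*) _"] cong: if_cong)
    have "card (x ` {..n}) = Suc n" using x_inj by (subst card_image) (auto simp: inj_on_def)
    then show "card (x ` {..n}) > degree r" "card (x ` {..n}) > degree (\<Sum>j\<le>n. smult (poly r (x j)) (L j))"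
      using that degL by (auto simp: less_Suc_eq_le intro!: degree_sum_le order_trans[OF degree_smult_le])
  qed
  define q where "q = (\<Sum>j\<le>n. smult (f (x j)) (L j))"
  have "f t = poly q t" if "t > 0" for t
  proof (rule LIMSEQ_unique[OF lim[OF that]])
    have "(\<lambda>k. poly (\<Sum>j\<le>n. smult (poly (p k) (x j)) (L j)) t) \<longlonglongrightarrow> poly q t"
      unfolding q_def poly_sum poly_smult by (intro tendsto_intros lim x_pos)
    then show "(\<lambda>k. poly (p k) t) \<longlonglongrightarrow> poly q t" using interp[OF deg] by simp
  qed
  moreover have "degree q \<le> n"
    unfolding q_def using degL by (intro degree_sum_le order_trans[OF degree_smult_le]) auto
  ultimately show ?thesis by blast
qed

lemma parallel_body_eq:
  fixes K :: "'a::euclidean_space set"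
  assumes "closed K" "K \<noteq> {}" "t \<ge> 0"
  shows "K + (*\<^sub>R) t ` cball 0 1 = {x. infdist x K \<le> t}"
proof (intro equalityI subsetI)
  fix x assume "x \<in> K + (*\<^sub>R) t ` cball 0 1"
  then obtain k b where kb: "k \<in> K" "norm b \<le> 1" "x = k + t *\<^sub>R b"
    by (auto simp: set_plus_def)
  then have "dist x k \<le> t" using assms by (simp add: dist_norm mult_left_le)
  with infdist_le[OF kb(1), of x] show "x \<in> {x. infdist x K \<le> t}" by simp
next
  fix x assume "x \<in> {x. infdist x K \<le> t}"
  then have d: "dist x (closest_point K x) \<le> t"
    using infdist_closest_point[OF assms(1,2)] by simp
  have "\<exists>b. norm b \<le> 1 \<and> x - closest_point K x = t *\<^sub>R b"
  proof (cases "t = 0")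
    case True
    then show ?thesis using d by (intro exI[of _ 0]) simp
  next
    case False
    then show ?thesis using d assms(3)
      by (intro exI[of _ "(1/t) *\<^sub>R (x - closest_point K x)"]) (simp add: dist_norm)
  qed
  then obtain b where "norm b \<le> 1" "x = closest_point K x + t *\<^sub>R b"
    by (metis add.commute diff_add_cancel)
  moreover from this have "closest_point K x + t *\<^sub>R b \<in> K + (*\<^sub>R) t ` cball 0 1"
    by (intro set_plus_intro closest_point_in_set assms imageI) simp
  ultimately show "x \<in> K + (*\<^sub>R) t ` cball 0 1" by simp
qed

lemma convex_parallel_body:
  fixes K :: "'a::euclidean_space set"
  assumes "convex K" "closed K" "K \<noteq> {}"
  shows "convex {x. infdist x K \<le> t}"
proof (cases "t \<ge> 0")
  case True
  then show ?thesis
    using assms by (simp flip: parallel_body_eq add: convex_set_plus convex_scaling)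
next
  case False
  then have "{x. infdist x K \<le> t} = {}" by (smt (verit) Collect_empty_eq infdist_nonneg)
  then show ?thesis by simp
qed

text \<open>The smaller bodies exhaust the open parallel body, and what remains lies in the frontier
  of a convex set, which is negligible. Continuity from the left is the right notion because the
  approximating polytopes lie inside \<open>K\<close>.\<close>

lemma measure_parallel_body_continuity:
  fixes K :: "'a::euclidean_space set"
  assumes "convex K" "compact K" "K \<noteq> {}" "t > 0"
  shows "(\<lambda>k. measure lebesgue {x. infdist x K \<le> t - 1 / Suc k}) \<longlonglongrightarrow>
    measure lebesgue {x. infdist x K \<le> t}"
proof -
  have cl: "closed K" using assms compact_imp_closed by blast
  define N where "N s = {x. infdist x K \<le> s}" for s
  have lme: "N s \<in> lmeasurable" for s
    unfolding N_def using assms compact_parallel_body lmeasurable_compact by blast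
  define A where "A k = N (t - 1 / Suc k)" for k
  have U: "(\<Union>k. A k) = {x. infdist x K < t}"
  proof (intro equalityI subsetI)
    fix x assume "x \<in> (\<Union>k. A k)"
    then obtain k where "infdist x K \<le> t - 1 / Suc k" by (auto simp: A_def N_def)
    moreover have "1 / real (Suc k) > 0" by simp
    ultimately have "infdist x K < t" by linarith
    then show "x \<in> {x. infdist x K < t}" by simp
  next
    fix x assume "x \<in> {x. infdist x K < t}"
    then have "t - infdist x K > 0" by simp
    then obtain k where "1 / real (Suc k) < t - infdist x K" using nat_approx_posE by blast
    then have "x \<in> A k" by (simp add: A_def N_def)
    then show "x \<in> (\<Union>k. A k)" by blast
  qed
  have inc: "incseq A"
  proof (intro incseq_SucI subsetI)
    fix k x assume "x \<in> A k"
    moreover have "1 / real (Suc (Suc k)) \<le> 1 / real (Suc k)" by (simp add: field_simps)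
    ultimately show "x \<in> A (Suc k)" by (simp add: A_def N_def)
  qed
  have sub: "(\<Union>k. A k) \<subseteq> N t" unfolding U by (auto simp: N_def)
  have Ulme: "(\<Union>k. A k) \<in> sets lebesgue" using lme by (auto simp: A_def)
  have "emeasure lebesgue (\<Union>k. A k) \<le> emeasure lebesgue (N t)"
    using sub lme by (intro emeasure_mono) auto
  then have fin: "emeasure lebesgue (\<Union>k. A k) \<noteq> \<infinity>"
    using lme[of t] by (auto simp: fmeasurable_def top_unique)
  have "range A \<subseteq> sets lebesgue" using lme by (auto simp: A_def)
  then have 1: "(\<lambda>k. measure lebesgue (A k)) \<longlonglongrightarrow> measure lebesgue (\<Union>k. A k)"
    using inc fin by (rule Lim_measure_incseq)
  have "N t - (\<Union>k. A k) \<subseteq> frontier (N t)"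
  proof
    fix x assume "x \<in> N t - (\<Union>k. A k)"
    then have x: "infdist x K = t" unfolding U N_def by auto
    define p where "p = closest_point K x"
    have "x \<notin> interior (N t)"
    proof
      assume "x \<in> interior (N t)"
      then obtain e where e: "e > 0" "ball x e \<subseteq> N t" by (auto simp: mem_interior)
      \<comment> \<open>Stretching the normal ray through \<open>x\<close> by the factor 1 + s moves
        \<open>x\<close> by s t = e / 2, within the ball, but lifts the distance from
        \<open>K\<close> above \<open>t\<close>.\<close>
      define s where "s = e / (2 * t)"
      define y where "y = p + (1 + s) *\<^sub>R (x - p)"
      have s: "s > 0" using e assms by (simp add: s_def)
      have xp: "norm (x - p) = t"
        using x infdist_closest_point[OF cl assms(3)] by (simp add: p_def dist_norm)
      have "closest_point K y = p"
        unfolding y_def p_def using s by (intro closest_point_ray) (use assms cl in auto)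
      then have "infdist y K = norm (y - p)"
        using infdist_closest_point[OF cl assms(3), of y] by (simp add: dist_norm)
      also have "\<dots> = (1 + s) * t" unfolding y_def using s xp by simp
      finally have "infdist y K > t" using s assms(4) by simp
      moreover have "y - x = s *\<^sub>R (x - p)" by (simp add: y_def algebra_simps)
      then have "dist x y = s * t" using s by (simp add: dist_norm norm_minus_commute[of x y] xp)
      then have "y \<in> ball x e" using e assms(4) by (simp add: s_def)
      ultimately show False using e by (auto simp: N_def)
    qed
    moreover have "x \<in> closure (N t)" using x closure_subset by (fastforce simp: N_def)
    ultimately show "x \<in> frontier (N t)" by (simp add: frontier_def)
  qed
  then have "negligible (N t - (\<Union>k. A k))"
    using negligible_convex_frontier convex_parallel_body[OF assms(1) cl assms(3)] negligible_subset
    unfolding N_def by blast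
  then have "measure lebesgue (\<Union>k. A k) = measure lebesgue (N t)"
    using sub by (intro measure_negligible_symdiff) (auto simp: lme Ulme)
  with 1 show ?thesis unfolding A_def N_def by simp
qed

text \<open>At t = 0 there are no smaller parallel bodies, so the continuity is taken from the
  right, by a decreasing intersection.\<close>

lemma measure_parallel_body_continuity_0:
  fixes K :: "'a::euclidean_space set"
  assumes "compact K" "K \<noteq> {}"
  shows "(\<lambda>k. measure lebesgue {x. infdist x K \<le> 1 / Suc k}) \<longlonglongrightarrow>
    measure lebesgue {x. infdist x K \<le> 0}"
proof -
  define A where "A k = {x. infdist x K \<le> 1 / real (Suc k)}" for k
  have lme: "A k \<in> lmeasurable" for k
    unfolding A_def using assms compact_parallel_body lmeasurable_compact by blast
  have "decseq A"
  proof (intro decseq_SucI subsetI)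
    fix k x assume "x \<in> A (Suc k)"
    moreover have "1 / real (Suc (Suc k)) \<le> 1 / real (Suc k)" by (simp add: field_simps)
    ultimately show "x \<in> A k" by (simp add: A_def)
  qed
  moreover have "(\<Inter>k. A k) = {x. infdist x K \<le> 0}"
  proof (intro equalityI subsetI)
    fix x assume x: "x \<in> (\<Inter>k. A k)"
    show "x \<in> {x. infdist x K \<le> 0}"
    proof (rule ccontr)
      assume "x \<notin> {x. infdist x K \<le> 0}"
      then have "infdist x K > 0" by simp
      then obtain k where "1 / real (Suc k) < infdist x K" using nat_approx_posE by blast
      moreover have "infdist x K \<le> 1 / real (Suc k)" using x unfolding A_def by blast
      ultimately show False by simp
    qed
  next
    fix x assume "x \<in> {x. infdist x K \<le> 0}"
    moreover have "0 \<le> 1 / real (Suc k)" for k by simp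
    ultimately show "x \<in> (\<Inter>k. A k)" unfolding A_def by (auto intro: order_trans)
  qed
  ultimately show ?thesis
    using Lim_measure_decseq[of A lebesgue] lme fmeasurableD2[OF lme]
    by (simp add: image_subset_iff fmeasurableD) (simp add: A_def)
qed

text \<open>Any finite \<open>e\<close>-net of \<open>K\<close> inside \<open>K\<close> serves as
  \<open>V\<close>: the point of \<open>K\<close> nearest to \<open>x\<close> is within
  \<open>e\<close> of one of its points.\<close>

lemma polytope_approximation:
  fixes K :: "'a::euclidean_space set"
  assumes "compact K" "convex K" "K \<noteq> {}" "e > 0"
  shows "\<exists>V. finite V \<and> V \<noteq> {} \<and> convex hull V \<subseteq> K \<and>
    (\<forall>x. infdist x (convex hull V) \<le> infdist x K + e)"
proof -
  have "\<exists>V. finite V \<and> V \<subseteq> K \<and> K \<subseteq> (\<Union>v\<in>V. ball v e)"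
    using seq_compact_imp_totally_bounded[OF compact_imp_seq_compact[OF assms(1)]] assms(4) by blast
  then obtain V where V: "finite V" "V \<subseteq> K" "K \<subseteq> (\<Union>v\<in>V. ball v e)"
    by blast
  have ne: "V \<noteq> {}" using V assms(3) by auto
  have "infdist x (convex hull V) \<le> infdist x K + e" for x
  proof -
    define p where "p = closest_point K x"
    have cl: "closed K" using assms(1) by (rule compact_imp_closed)
    have p: "p \<in> K" unfolding p_def using cl assms(3) by (rule closest_point_in_set)
    then obtain v where v: "v \<in> V" "dist v p < e" using V by auto
    have "infdist x (convex hull V) \<le> dist x v" using v by (simp add: infdist_le hull_inc)
    also have "\<dots> \<le> dist x p + dist p v" by (rule dist_triangle)
    also have "dist x p = infdist x K"
      unfolding p_def using infdist_closest_point[OF cl assms(3)] by simp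
    finally show ?thesis using v by (simp add: dist_commute)
  qed
  moreover have "convex hull V \<subseteq> K" using V(2) assms(2) by (rule hull_minimal)
  ultimately show ?thesis using V(1) ne by blast
qed

lemma steiner_wellorder:
  fixes K :: "(real ^ 'n::{finite,wellorder}) set"
  assumes "compact K" "convex K" "K \<noteq> {}"
  shows "\<exists>p. degree p \<le> CARD('n) \<and> (\<forall>t\<ge>0. measure lebesgue {x. infdist x K \<le> t} = poly p t)"
proof -
  define g where "g t = measure lebesgue {x. infdist x K \<le> t}" for t
  have lme: "{x. infdist x L \<le> t} \<in> lmeasurable" if "compact L" "L \<noteq> {}" for t and L :: "(real ^ 'n::{finite,wellorder}) set"
    using that compact_parallel_body lmeasurable_compact by blast
  have "\<exists>V. finite V \<and> V \<noteq> {} \<and> convex hull V \<subseteq> K \<and>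
      (\<forall>x. infdist x (convex hull V) \<le> infdist x K + 1 / Suc k)" for k
    by (rule polytope_approximation[OF assms]) simp
  then have "\<forall>k. \<exists>V. finite V \<and> V \<noteq> {} \<and> convex hull V \<subseteq> K \<and>
      (\<forall>x. infdist x (convex hull V) \<le> infdist x K + 1 / Suc k)" ..
  from choice[OF this] obtain V where V: "\<And>k. finite (V k)" "\<And>k. V k \<noteq> {}"
    "\<And>k. convex hull V k \<subseteq> K"
    "\<And>k x. infdist x (convex hull V k) \<le> infdist x K + 1 / Suc k"
    by blast
  have "\<exists>p. degree p \<le> CARD('n) \<and>
    (\<forall>t>0. measure lebesgue {x. infdist x (convex hull V k) \<le> t} = poly p t)" for k
    using steiner_polytope[OF V(1,2)] .
  then have "\<forall>k. \<exists>p. degree p \<le> CARD('n) \<and>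
    (\<forall>t>0. measure lebesgue {x. infdist x (convex hull V k) \<le> t} = poly p t)" ..
  from choice[OF this] obtain p where p: "\<And>k. degree (p k) \<le> CARD('n)"
    "\<And>k t. t > 0 \<Longrightarrow> measure lebesgue {x. infdist x (convex hull V k) \<le> t} = poly (p k) t"
    by blast
  \<comment> \<open>Inclusions in both directions: the polytope lies in \<open>K\<close>, and a
    point within t - 1 / (k + 1) of \<open>K\<close> is within \<open>t\<close> of the
    polytope.\<close>
  have lim: "(\<lambda>k. poly (p k) t) \<longlonglongrightarrow> g t" if "t > 0" for t
  proof (rule tendsto_sandwich)
    show "(\<lambda>k. g (t - 1 / Suc k)) \<longlonglongrightarrow> g t"
      unfolding g_def using measure_parallel_body_continuity assms that by blast
    have V': "compact (convex hull V k)" "convex hull V k \<noteq> {}" for k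
      using V by (auto simp: finite_imp_compact_convex_hull)
    have "g (t - 1 / Suc k) \<le> poly (p k) t" for k
    proof -
      have "infdist x (convex hull V k) \<le> t" if "infdist x K \<le> t - 1 / Suc k" for x
        using V(4)[of x k] that by simp
      then show ?thesis
        unfolding p(2)[OF that, symmetric] g_def using lme[OF assms(1,3)] lme[OF V']
        by (intro measure_mono_fmeasurable) auto
    qed
    then show "\<forall>\<^sub>F k in sequentially. g (t - 1 / Suc k) \<le> poly (p k) t" by simp
    have "poly (p k) t \<le> g t" for k
    proof -
      have "infdist x K \<le> infdist x (convex hull V k)" for x
        using infdist_mono[OF V(3), of k x] V' by simp
      then show ?thesis
        unfolding p(2)[OF that, symmetric] g_def using lme[OF assms(1,3)] lme[OF V']
        by (intro measure_mono_fmeasurable) (auto intro: order_trans)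
    qed
    then show "\<forall>\<^sub>F k in sequentially. poly (p k) t \<le> g t" by simp
  qed simp
  have "\<exists>q. degree q \<le> CARD('n) \<and> (\<forall>t>0. g t = poly q t)"
    by (rule poly_pointwise_limit[OF p(1) lim])
  then obtain q where q: "degree q \<le> CARD('n)" "\<And>t. t > 0 \<Longrightarrow> g t = poly q t"
    by blast
  \<comment> \<open>The polytope formula is for positive \<open>t\<close>, so the volume of
    \<open>K\<close> itself enters as a limit from the right.\<close>
  have "g 0 = poly q 0"
  proof (rule LIMSEQ_unique)
    show "(\<lambda>k. g (1 / Suc k)) \<longlonglongrightarrow> g 0"
      unfolding g_def using measure_parallel_body_continuity_0[OF assms(1,3)] .
    have "(\<lambda>k. poly q (1 / Suc k)) \<longlonglongrightarrow> poly q 0"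
      using LIMSEQ_inverse_real_of_nat by (intro tendsto_poly) (simp add: field_simps)
    then show "(\<lambda>k. g (1 / Suc k)) \<longlonglongrightarrow> poly q 0" by (simp add: q(2))
  qed
  then have "g t = poly q t" if "t \<ge> 0" for t using q(2)[of t] that by (cases "t = 0") auto
  with q(1) show ?thesis unfolding g_def by blast
qed

text \<open>\<open>wo_vec\<close> is a volume-preserving isometry, so it carries parallel bodies to
  parallel bodies of the same volume.\<close>

lemma steiner:
  fixes K :: "(real ^ 'n::finite) set"
  assumes "compact K" "convex K" "K \<noteq> {}"
  obtains p where "degree p \<le> CARD('n)"
    "\<And>t. t \<ge> 0 \<Longrightarrow> measure lebesgue {x. infdist x K \<le> t} = poly p t"
proof -
  let ?L = "wo_vec ` K"
  have "continuous_on K wo_vec"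
    using linear_wo_vec linear_continuous_on linear_conv_bounded_linear by blast
  then have L: "compact ?L" "convex ?L" "?L \<noteq> {}"
    using assms linear_wo_vec by (auto intro: compact_continuous_image convex_linear_image)
  have card: "CARD('n wo) = CARD('n)"
    using bij_Rep_wo bij_betw_same_card by blast
  obtain p where p: "degree p \<le> CARD('n)"
    "\<And>t. t \<ge> 0 \<Longrightarrow> measure lebesgue {x. infdist x ?L \<le> t} = poly p t"
    using steiner_wellorder[OF L] card by auto
  have id: "infdist (wo_vec x) ?L = infdist x K" for x
    using assms(3) by (simp add: infdist_notempty image_image dist_wo_vec)
  have "measure lebesgue {x. infdist x K \<le> t} = poly p t" if "t \<ge> 0" for t
  proof -
    have "{y. infdist y ?L \<le> t} = wo_vec ` {x. infdist x K \<le> t}"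
    proof (intro equalityI subsetI)
      fix y assume "y \<in> {y. infdist y ?L \<le> t}"
      moreover obtain x where "y = wo_vec x" using bij_wo_vec by (metis bij_pointE)
      ultimately show "y \<in> wo_vec ` {x. infdist x K \<le> t}" using id by auto
    qed (use id in auto)
    moreover have "{x. infdist x K \<le> t} \<in> sets borel"
      using compact_parallel_body[OF assms(1,3)] by (simp add: borel_compact)
    ultimately show ?thesis using p(2)[OF that] measure_wo_vec_image by metis
  qed
  with p(1) that show thesis by blast
qed

subsection \<open>The first intrinsic volume as a Gaussian mean\<close>

text \<open>A polynomial is determined by its values on [0,1] and the ball volumes are nonzero, so
  the definite description has exactly one witness. The index \<open>m\<close> belongs to the power
  n - m of the radius.\<close>

lemma intrinsic_volume_eq_coeff:
  fixes K :: "(real ^ 'n::finite) set"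
  assumes "compact K" "K \<noteq> {}"
    and deg: "degree p \<le> CARD('n)"
    and p: "\<And>t. t \<ge> 0 \<Longrightarrow> measure lebesgue {x. infdist x K \<le> t} = poly p t"
    and m: "m \<le> CARD('n)"
  shows "intrinsic_volume m K = coeff p (CARD('n) - m) / unit_ball_vol (real (CARD('n) - m))"
proof -
  let ?n = "CARD('n)"
  define V where "V i = (if i \<le> ?n then coeff p (?n - i) / unit_ball_vol (real (?n - i)) else 0)" for i
  define Q where "Q W = (\<Sum>i\<le>?n. monom (unit_ball_vol (real (?n - i)) * W i) (?n - i))" for W :: "nat \<Rightarrow> real"
  have pQ: "poly (Q W) t = (\<Sum>i\<le>?n. unit_ball_vol (real (?n - i)) * W i * t ^ (?n - i))" for W t
    by (simp add: Q_def poly_sum poly_monom)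
  have cQ: "coeff (Q W) (?n - i) = unit_ball_vol (real (?n - i)) * W i" if "i \<le> ?n" for W i
  proof -
    have "coeff (Q W) (?n - i) = (\<Sum>j\<le>?n. if j = i then unit_ball_vol (real (?n - j)) * W j else 0)"
      unfolding Q_def coeff_sum coeff_monom using that by (intro sum.cong) auto
    then show ?thesis using that by simp
  qed
  have ub: "unit_ball_vol (real k) \<noteq> 0" for k
    by (metis less_irrefl unit_ball_vol_pos of_nat_0_le_iff)
  have meas: "measure lebesgue (K + (*\<^sub>R) t ` cball 0 1) = poly p t" if "t \<ge> 0" for t
    using p that parallel_body_eq[OF compact_imp_closed[OF assms(1)] assms(2)] by simp
  have "Q V = p"
  proof (rule poly_eqI)
    fix j
    show "coeff (Q V) j = coeff p j"
    proof (cases "j \<le> ?n")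
      case True
      then show ?thesis using cQ[of "?n - j" V] ub by (simp add: V_def)
    next
      case False
      moreover have "degree (Q V) \<le> ?n"
        unfolding Q_def by (intro degree_sum_le) (auto intro: order_trans[OF degree_monom_le])
      ultimately show ?thesis using deg by (simp add: coeff_eq_0)
    qed
  qed
  have "(THE V. (\<forall>t\<ge>0. measure lebesgue (K + (*\<^sub>R) t ` cball 0 1) =
      (\<Sum>i\<le>DIM(real ^ 'n). unit_ball_vol (real (DIM(real ^ 'n) - i)) * V i * t ^ (DIM(real ^ 'n) - i))) \<and>
      (\<forall>i>DIM(real ^ 'n). V i = 0)) = V"
  proof (rule the_equality)
    show "(\<forall>t\<ge>0. measure lebesgue (K + (*\<^sub>R) t ` cball 0 1) =
      (\<Sum>i\<le>DIM(real ^ 'n). unit_ball_vol (real (DIM(real ^ 'n) - i)) * V i * t ^ (DIM(real ^ 'n) - i))) \<and>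
      (\<forall>i>DIM(real ^ 'n). V i = 0)"
      using meas \<open>Q V = p\<close> pQ[of V] by (auto simp: V_def)
    fix W assume W: "(\<forall>t\<ge>0. measure lebesgue (K + (*\<^sub>R) t ` cball 0 1) =
      (\<Sum>i\<le>DIM(real ^ 'n). unit_ball_vol (real (DIM(real ^ 'n) - i)) * W i * t ^ (DIM(real ^ 'n) - i))) \<and>
      (\<forall>i>DIM(real ^ 'n). W i = 0)"
    have eq: "poly (Q W) t = poly p t" if "t \<ge> 0" for t
      using W meas that by (simp add: pQ)
    have "Q W = p"
    proof (rule ccontr)
      assume "Q W \<noteq> p"
      then have "finite {t. poly (Q W - p) t = 0}" by (intro poly_roots_finite) simp
      moreover have "{0..1} \<subseteq> {t. poly (Q W - p) t = 0}" using eq by auto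
      ultimately have "finite {0..1::real}" by (rule rev_finite_subset)
      then show False using infinite_Icc[of 0 "1::real"] by simp
    qed
    show "W = V"
    proof
      fix i
      show "W i = V i"
      proof (cases "i \<le> ?n")
        case True
        then show ?thesis using cQ[of i W] \<open>Q W = p\<close> ub[of "?n - i"] by (simp add: V_def)
      next
        case False
        then show ?thesis using W by (simp add: V_def)
      qed
    qed
  qed
  then show ?thesis unfolding intrinsic_volume_def using m by (simp add: V_def)
qed

section \<open>Support functions of compact sets\<close>

definition support_fun :: "'a::real_inner set \<Rightarrow> 'a \<Rightarrow> real" where
  "support_fun K x = (SUP y\<in>K. x \<bullet> y)"

lemma support_fun_attained:
  fixes K :: "'a::euclidean_space set"
  assumes "compact K" "K \<noteq> {}"
  obtains y where "y \<in> K" "support_fun K x = x \<bullet> y" "\<And>z. z \<in> K \<Longrightarrow> x \<bullet> z \<le> x \<bullet> y"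
proof -
  have "continuous_on K (\<lambda>z. x \<bullet> z)" by (intro continuous_intros)
  then obtain y where y: "y \<in> K" "\<forall>z\<in>K. x \<bullet> z \<le> x \<bullet> y"
    using continuous_attains_sup[OF assms] by blast
  then have "support_fun K x = x \<bullet> y"
    unfolding support_fun_def by (intro cSup_eq_maximum) auto
  with y that show thesis by blast
qed

lemma support_fun_upper:
  fixes K :: "'a::euclidean_space set"
  assumes "compact K" "y \<in> K"
  shows "x \<bullet> y \<le> support_fun K x"
proof -
  have "K \<noteq> {}" using assms(2) by auto
  then obtain z where "z \<in> K" "support_fun K x = x \<bullet> z" "\<And>y. y \<in> K \<Longrightarrow> x \<bullet> y \<le> x \<bullet> z"
    by (rule support_fun_attained[OF assms(1), of x]) (rule that)
  then show ?thesis using assms(2) by simp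
qed

lemma support_fun_add_le:
  fixes K :: "'a::euclidean_space set"
  assumes "compact K" "K \<noteq> {}"
  shows "support_fun K (x + y) \<le> support_fun K x + support_fun K y"
proof -
  obtain z where "z \<in> K" "support_fun K (x + y) = (x + y) \<bullet> z"
    by (rule support_fun_attained[OF assms, of "x + y"])
  then show ?thesis
    using support_fun_upper[OF assms(1), of z x] support_fun_upper[OF assms(1), of z y]
    by (simp add: inner_add_left)
qed

lemma support_fun_scale:
  fixes K :: "'a::euclidean_space set"
  assumes "compact K" "K \<noteq> {}" "c \<ge> 0"
  shows "support_fun K (c *\<^sub>R x) = c * support_fun K x"
proof -
  obtain z where z: "z \<in> K" "support_fun K x = x \<bullet> z"
    by (rule support_fun_attained[OF assms(1,2), of x])
  obtain w where w: "w \<in> K" "support_fun K (c *\<^sub>R x) = (c *\<^sub>R x) \<bullet> w"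
    by (rule support_fun_attained[OF assms(1,2), of "c *\<^sub>R x"])
  have "c * (x \<bullet> w) \<le> c * support_fun K x"
    using assms(3) support_fun_upper[OF assms(1) w(1)] by (rule mult_left_mono[rotated])
  then show ?thesis
    using z w support_fun_upper[OF assms(1) z(1), of "c *\<^sub>R x"] by (intro antisym) simp_all
qed

lemma support_fun_bound:
  fixes K :: "'a::euclidean_space set"
  assumes "compact K" "0 \<in> K" "\<And>y. y \<in> K \<Longrightarrow> norm y \<le> R"
  shows "0 \<le> support_fun K x" "support_fun K x \<le> R * norm x"
proof -
  show "0 \<le> support_fun K x" using support_fun_upper[OF assms(1,2), of x] by simp
  have "K \<noteq> {}" using assms(2) by auto
  then obtain z where z: "z \<in> K" "support_fun K x = x \<bullet> z"
    by (rule support_fun_attained[OF assms(1), of x])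
  then have "x \<bullet> z \<le> norm x * R"
    using norm_cauchy_schwarz[of x z] assms(3) by (meson mult_left_mono norm_ge_zero order_trans)
  then show "support_fun K x \<le> R * norm x" using z by (simp add: mult.commute)
qed

lemma continuous_support_fun:
  fixes K :: "'a::euclidean_space set"
  assumes "compact K" "K \<noteq> {}"
  shows "continuous_on UNIV (support_fun K)"
proof (rule convex_on_continuous)
  show "convex_on UNIV (support_fun K)"
  proof (rule convex_onI)
    fix t :: real and x y :: 'a assume t: "0 < t" "t < 1"
    have "support_fun K ((1 - t) *\<^sub>R x + t *\<^sub>R y)
        \<le> support_fun K ((1 - t) *\<^sub>R x) + support_fun K (t *\<^sub>R y)"
      by (rule support_fun_add_le[OF assms])
    then show "support_fun K ((1 - t) *\<^sub>R x + t *\<^sub>R y)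
        \<le> (1 - t) * support_fun K x + t * support_fun K y"
      using t by (simp add: support_fun_scale[OF assms])
  qed simp
qed simp

section \<open>Gaussian integrals and the layer-cake formula\<close>

definition gauss_mean :: "('a::euclidean_space \<Rightarrow> real) \<Rightarrow> real" where
  "gauss_mean f = (\<integral>x. f x * exp (- (norm x)\<^sup>2 / 2) \<partial>lborel)"

text \<open>With a quarter in place of a half, the other factor exp(-r^2/4) of the Gaussian is free
  to absorb growth of order exp(c r). This function dominates in the integrability and limit
  arguments below.\<close>

lemma integrable_gauss_quarter:
  "integrable lborel (\<lambda>x :: 'a::euclidean_space. exp (- (norm x)\<^sup>2 / 4))"
proof (rule integrableI_bounded)
  have 1: "(\<integral>\<^sup>+x. ennreal (exp (- x\<^sup>2 / 4)) \<partial>lborel) < \<infinity>"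
  proof -
    have "integrable lborel (\<lambda>x. sqrt (2 * pi * (sqrt 2)\<^sup>2) * normal_density 0 (sqrt 2) x)"
      by (intro integrable_mult_right integrable_normal_density) simp
    also have "(\<lambda>x. sqrt (2 * pi * (sqrt 2)\<^sup>2) * normal_density 0 (sqrt 2) x) = (\<lambda>x. exp (- x\<^sup>2 / 4))"
      by (simp add: normal_density_def)
    finally show ?thesis by (simp add: integrable_iff_bounded)
  qed
  have "exp (- (norm x)\<^sup>2 / 4) = (\<Prod>b\<in>Basis. exp (- (x \<bullet> b)\<^sup>2 / 4))" for x :: 'a
    unfolding norm_eq_sqrt_inner
    by (subst euclidean_inner)
      (simp add: exp_sum[symmetric] power2_eq_square sum_nonneg sum_negf sum_divide_distrib)
  then have "(\<integral>\<^sup>+x. ennreal (norm (exp (- (norm x)\<^sup>2 / 4))) \<partial>(lborel :: 'a measure))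
      = (\<integral>\<^sup>+x. (\<Prod>b\<in>Basis. ennreal (exp (- (x \<bullet> b)\<^sup>2 / 4))) \<partial>(lborel :: 'a measure))"
    by (simp add: prod_ennreal prod_nonneg)
  also have "\<dots> = (\<Prod>b\<in>(Basis :: 'a set). (\<integral>\<^sup>+x. ennreal (exp (- x\<^sup>2 / 4)) \<partial>lborel))"
    by (rule nn_integral_lborel_prod) auto
  also have "\<dots> < \<infinity>" using 1 by (simp add: power_less_top_ennreal)
  finally show "(\<integral>\<^sup>+x. ennreal (norm (exp (- (norm x)\<^sup>2 / 4))) \<partial>(lborel :: 'a measure)) < \<infinity>" .
qed simp

text \<open>Completing the square: the exponents differ by (2 R - r/2)^2.\<close>

lemma exp_linear_gauss_le:
  fixes r R :: real
  shows "exp (2 * R * r) * exp (- r\<^sup>2 / 2) \<le> exp (4 * R\<^sup>2) * exp (- r\<^sup>2 / 4)"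
proof -
  have "0 \<le> (2 * R - r / 2)\<^sup>2" by simp
  then have "2 * R * r - r\<^sup>2 / 2 \<le> 4 * R\<^sup>2 - r\<^sup>2 / 4"
    by (simp add: power2_eq_square algebra_simps)
  then show ?thesis by (simp flip: exp_add)
qed

lemma le_exp_self: "a \<le> exp (a :: real)"
  using exp_ge_add_one_self[of a] by linarith

lemma integrable_gauss_linear_growth:
  fixes f :: "'a::euclidean_space \<Rightarrow> real"
  assumes [measurable]: "f \<in> borel_measurable borel" and f: "\<And>x. \<bar>f x\<bar> \<le> R * norm x"
  shows "integrable lborel (\<lambda>x. f x * exp (- (norm x)\<^sup>2 / 2))"
proof (rule Bochner_Integration.integrable_bound)
  show "integrable lborel (\<lambda>x :: 'a. exp (4 * (R/2)\<^sup>2) * exp (- (norm x)\<^sup>2 / 4))"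
    by (intro integrable_mult_right integrable_gauss_quarter)
  have "\<bar>f x * exp (- (norm x)\<^sup>2 / 2)\<bar> \<le> exp (4 * (R/2)\<^sup>2) * exp (- (norm x)\<^sup>2 / 4)" for x
  proof -
    have "\<bar>f x\<bar> \<le> exp (2 * (R/2) * norm x)"
      using order_trans[OF f[of x] le_exp_self] by simp
    then have "\<bar>f x * exp (- (norm x)\<^sup>2 / 2)\<bar> \<le> exp (2 * (R/2) * norm x) * exp (- (norm x)\<^sup>2 / 2)"
      by (simp add: abs_mult)
    then show ?thesis using exp_linear_gauss_le[of "R/2" "norm x"] by linarith
  qed
  then show "AE x in lborel. norm (f x * exp (- (norm x)\<^sup>2 / 2))
      \<le> norm (exp (4 * (R/2)\<^sup>2) * exp (- (norm x)\<^sup>2 / 4))"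
    by simp
qed simp

text \<open>The coefficient of r^i in a Steiner polynomial picks up
  \<open>half_moment (Suc i)\<close>; the additional power comes from the derivative of
  exp(-r^2/2).\<close>

definition half_moment :: "nat \<Rightarrow> real" where
  "half_moment k = (\<integral>r. indicator {0..} r * (r ^ k * exp (- r\<^sup>2 / 2)) \<partial>lborel)"

lemma integrable_half_moment:
  "integrable lborel (\<lambda>r :: real. indicator {0..} r * (r ^ k * exp (- r\<^sup>2 / 2)))"
proof (rule Bochner_Integration.integrable_bound)
  show "integrable lborel (\<lambda>r. sqrt (2 * pi) * (std_normal_density r * \<bar>r\<bar> ^ k))"
    by (intro integrable_mult_right integrable_std_normal_moment_abs)
  show "AE r in lborel. norm (indicator {0..} r * (r ^ k * exp (- r\<^sup>2 / 2)))
      \<le> norm (sqrt (2 * pi) * (std_normal_density r * \<bar>r\<bar> ^ k))"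
    by (auto simp: std_normal_density_def indicator_def abs_mult power_abs)
qed simp

lemma half_moment_pos: "half_moment k > 0"
proof (rule ccontr)
  let ?f = "\<lambda>r :: real. indicator {0..} r * (r ^ k * exp (- r\<^sup>2 / 2))"
  have nn: "0 \<le> ?f r" for r by (simp add: indicator_def)
  assume "\<not> half_moment k > 0"
  moreover have "half_moment k \<ge> 0" unfolding half_moment_def using nn by simp
  ultimately have "half_moment k = 0" by simp
  then have "AE r in lborel. ?f r = 0"
    unfolding half_moment_def
    using integral_nonneg_eq_0_iff_AE[OF integrable_half_moment[of k]] nn by simp
  then have "AE r in lborel. r \<notin> {0<..<1::real}"
    by eventually_elim (auto simp: indicator_def)
  then have "emeasure lborel {r \<in> space lborel. \<not> r \<notin> {0<..<1::real}} = 0"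
    by (subst (asm) AE_iff_measurable[OF _ refl]) auto
  moreover have "{r \<in> space lborel. \<not> r \<notin> {0<..<1::real}} = {0<..<1}" by auto
  ultimately show False by simp
qed

lemma nn_integral_gauss_tail:
  fixes d :: real
  assumes "d \<ge> 0"
  shows "(\<integral>\<^sup>+r. ennreal (if d \<le> r then r * exp (- r\<^sup>2 / 2) else 0) \<partial>lborel) = ennreal (exp (- d\<^sup>2 / 2))"
proof -
  have "((\<lambda>r :: real. - exp (- r\<^sup>2 / 2)) \<longlongrightarrow> 0) at_top" by real_asymp
  then have "(\<integral>\<^sup>+r. ennreal (r * exp (- r\<^sup>2 / 2)) * indicator {d..} r \<partial>lborel)
      = ennreal (0 - (- exp (- d\<^sup>2 / 2)))"
    using assms
    by (intro nn_integral_FTC_atLeast) (auto intro!: derivative_eq_intros)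
  moreover have "(\<integral>\<^sup>+r. ennreal (if d \<le> r then r * exp (- r\<^sup>2 / 2) else 0) \<partial>lborel)
      = (\<integral>\<^sup>+r. ennreal (r * exp (- r\<^sup>2 / 2)) * indicator {d..} r \<partial>lborel)"
    by (intro nn_integral_cong) (simp add: indicator_def)
  ultimately show ?thesis by simp
qed

text \<open>Layer cake: exp(-d^2/2) is the integral of r exp(-r^2/2) over r >= d. Exchanging the
  integrals replaces the distance by the volumes of the parallel bodies, which are polynomial in
  \<open>r\<close>.\<close>

lemma gauss_integral_infdist:
  fixes K :: "'a::euclidean_space set"
  assumes "compact K" "K \<noteq> {}" and deg: "degree p \<le> n"
    and p: "\<And>r. r \<ge> 0 \<Longrightarrow> measure lebesgue {x. infdist x K \<le> r} = poly p r"
  shows "integrable lborel (\<lambda>x. exp (- (infdist x K)\<^sup>2 / 2))"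
    and "(\<integral>x. exp (- (infdist x K)\<^sup>2 / 2) \<partial>lborel) = (\<Sum>i\<le>n. coeff p i * half_moment (Suc i))"
proof -
  have [measurable]: "(\<lambda>x. infdist x K) \<in> borel_measurable borel"
    by (intro borel_measurable_continuous_onI continuous_intros)
  let ?g = "\<lambda>r :: real. r * exp (- r\<^sup>2 / 2)"
  let ?h = "\<lambda>r. \<Sum>i\<le>n. coeff p i * (indicator {0..} r * (r ^ Suc i * exp (- r\<^sup>2 / 2)))"
  have pp: "poly p r = (\<Sum>i\<le>n. coeff p i * r ^ i)" for r
    unfolding poly_altdef using deg by (intro sum.mono_neutral_left) (auto simp: coeff_eq_0)
  have em: "emeasure lborel {x. infdist x K \<le> r} = ennreal (poly p r)" if "r \<ge> 0" for r
  proof -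
    have "{x. infdist x K \<le> r} \<in> lmeasurable"
      using compact_parallel_body[OF assms(1,2)] by (rule lmeasurable_compact)
    then have "emeasure lebesgue {x. infdist x K \<le> r} = ennreal (poly p r)"
      using p[OF that] by (simp add: emeasure_eq_measure2)
    moreover have "{x. infdist x K \<le> r} \<in> sets borel" by measurable
    ultimately show ?thesis by simp
  qed
  have h: "?h r = (if 0 \<le> r then ?g r * poly p r else 0)" for r
    by (simp add: pp sum_distrib_left sum_distrib_right mult_ac)
  have h0: "0 \<le> ?h r" for r
  proof (cases "0 \<le> r")
    case True
    then have "0 \<le> poly p r" by (subst p[symmetric]) simp_all
    with True show ?thesis unfolding h by simp
  qed (simp add: h)
  have int: "integrable lborel ?h"
    by (intro Bochner_Integration.integrable_sum integrable_mult_right integrable_half_moment)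
  have "(\<integral>\<^sup>+x. ennreal (exp (- (infdist x K)\<^sup>2 / 2)) \<partial>lborel)
      = (\<integral>\<^sup>+x. (\<integral>\<^sup>+r. ennreal (if infdist x K \<le> r then ?g r else 0) \<partial>lborel) \<partial>lborel)"
    by (simp add: nn_integral_gauss_tail infdist_nonneg)
  also have "\<dots> = (\<integral>\<^sup>+r. (\<integral>\<^sup>+x. ennreal (if infdist x K \<le> r then ?g r else 0) \<partial>lborel) \<partial>lborel)"
    by (rule lborel_pair.Fubini') measurable
  also have "\<dots> = (\<integral>\<^sup>+r. ennreal (?h r) \<partial>lborel)"
  proof (rule nn_integral_cong)
    fix r :: real
    show "(\<integral>\<^sup>+x. ennreal (if infdist x K \<le> r then ?g r else 0) \<partial>lborel) = ennreal (?h r)"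
    proof (cases "0 \<le> r")
      case True
      have "(\<integral>\<^sup>+x. ennreal (if infdist x K \<le> r then ?g r else 0) \<partial>lborel)
          = (\<integral>\<^sup>+x. ennreal (?g r) * indicator {x. infdist x K \<le> r} x \<partial>lborel)"
        by (intro nn_integral_cong) (simp add: indicator_def)
      also have "\<dots> = ennreal (?g r) * emeasure lborel {x. infdist x K \<le> r}"
        by (rule nn_integral_cmult_indicator) measurable
      also have "\<dots> = ennreal (?g r * poly p r)"
        using True unfolding em[OF True] by (intro ennreal_mult'[symmetric]) simp
      finally show ?thesis using True unfolding h by simp
    next
      case False
      then have "\<not> infdist x K \<le> r" for x by (smt (verit) infdist_nonneg)
      then show ?thesis using False unfolding h by simp
    qed
  qed
  also have "\<dots> = ennreal (\<integral>r. ?h r \<partial>lborel)"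
    using int h0 by (intro nn_integral_eq_integral) auto
  also have int_h: "(\<integral>r. ?h r \<partial>lborel) = (\<Sum>i\<le>n. coeff p i * half_moment (Suc i))"
    unfolding half_moment_def
    by (subst Bochner_Integration.integral_sum)
      (intro integrable_mult_right integrable_half_moment, simp)
  finally have *: "(\<integral>\<^sup>+x. ennreal (exp (- (infdist x K)\<^sup>2 / 2)) \<partial>lborel)
      = ennreal (\<Sum>i\<le>n. coeff p i * half_moment (Suc i))" .
  have "0 \<le> (\<integral>r. ?h r \<partial>lborel)" using h0 by (rule Bochner_Integration.integral_nonneg)
  then have "0 \<le> (\<Sum>i\<le>n. coeff p i * half_moment (Suc i))"
    by (simp only: int_h)
  then have "has_bochner_integral lborel (\<lambda>x. exp (- (infdist x K)\<^sup>2 / 2))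
      (\<Sum>i\<le>n. coeff p i * half_moment (Suc i))"
    by (intro has_bochner_integral_nn_integral *) auto
  then show "integrable lborel (\<lambda>x. exp (- (infdist x K)\<^sup>2 / 2))"
    and "(\<integral>x. exp (- (infdist x K)\<^sup>2 / 2) \<partial>lborel) = (\<Sum>i\<le>n. coeff p i * half_moment (Suc i))"
    by (simp_all add: has_bochner_integral_iff)
qed

section \<open>First-order expansion at small dilates\<close>

lemma infdist_scaleR:
  fixes K :: "'a::euclidean_space set"
  assumes "compact K" "K \<noteq> {}" "t > 0"
  shows "infdist (t *\<^sub>R x) ((*\<^sub>R) t ` K) = t * infdist x K"
proof -
  have le: "infdist (s *\<^sub>R x) ((*\<^sub>R) s ` L) \<le> s * infdist x L"
    if "compact L" "L \<noteq> {}" "s > 0" for s x and L :: "'a set"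
  proof -
    define y where "y = closest_point L x"
    have y: "y \<in> L" "infdist x L = dist x y"
      unfolding y_def
      using closest_point_in_set[OF compact_imp_closed[OF that(1)] that(2)]
        infdist_closest_point[OF compact_imp_closed[OF that(1)] that(2)] by auto
    have "infdist (s *\<^sub>R x) ((*\<^sub>R) s ` L) \<le> dist (s *\<^sub>R x) (s *\<^sub>R y)"
      using y by (intro infdist_le) auto
    also have "\<dots> = s * dist x y" using that(3) by (simp add: dist_norm flip: scaleR_diff_right)
    finally show ?thesis using y by simp
  qed
  have "compact ((*\<^sub>R) t ` K)" "(*\<^sub>R) t ` K \<noteq> {}" using assms by (auto simp: compact_scaling)
  from le[OF this, of "1 / t" "t *\<^sub>R x"] have "infdist x K \<le> infdist (t *\<^sub>R x) ((*\<^sub>R) t ` K) / t"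
    using assms(3) by (simp add: image_image)
  then show ?thesis using le[OF assms, of x] assms(3) by (intro antisym) (simp_all add: field_simps)
qed

text \<open>The upper bound tests the point of \<open>K\<close> that supports in direction
  \<open>x\<close>, the lower bound the nearest point itself. Together they say d^2 = |x|^2 - 2 t
  h(x) + O(t^2).\<close>

lemma infdist_scaled_sq_bounds:
  fixes K :: "'a::euclidean_space set"
  assumes "compact K" "0 \<in> K" "\<And>y. y \<in> K \<Longrightarrow> norm y \<le> R" "t \<ge> 0"
  defines "d \<equiv> (\<lambda>x. infdist x ((*\<^sub>R) t ` K))" and "h \<equiv> support_fun K"
  shows "(d x)\<^sup>2 \<le> (norm x)\<^sup>2 - 2 * t * h x + t\<^sup>2 * R\<^sup>2"
    and "(norm x)\<^sup>2 - 2 * t * h x \<le> (d x)\<^sup>2" and "d x \<le> norm x"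
proof -
  have ne: "K \<noteq> {}" using assms(2) by auto
  have sq: "(dist x (t *\<^sub>R y))\<^sup>2 = (norm x)\<^sup>2 - 2 * t * (x \<bullet> y) + t\<^sup>2 * (norm y)\<^sup>2" for y
    unfolding dist_norm power2_norm_eq_inner by (simp add: algebra_simps inner_commute power2_eq_square)
  obtain y where y: "y \<in> K" "h x = x \<bullet> y"
    unfolding h_def by (rule support_fun_attained[OF assms(1) ne, of x])
  have "d x \<le> dist x (t *\<^sub>R y)" unfolding d_def using y by (intro infdist_le) auto
  then have "(d x)\<^sup>2 \<le> (dist x (t *\<^sub>R y))\<^sup>2" by (simp add: d_def infdist_nonneg power_mono)
  moreover have "t\<^sup>2 * (norm y)\<^sup>2 \<le> t\<^sup>2 * R\<^sup>2"
    using assms(3)[OF y(1)] by (intro mult_left_mono power_mono) auto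
  ultimately show "(d x)\<^sup>2 \<le> (norm x)\<^sup>2 - 2 * t * h x + t\<^sup>2 * R\<^sup>2" unfolding sq y(2) by linarith
  have cl: "closed ((*\<^sub>R) t ` K)" using assms(1) by (simp add: compact_scaling compact_imp_closed)
  have "closest_point ((*\<^sub>R) t ` K) x \<in> (*\<^sub>R) t ` K"
    using cl ne by (intro closest_point_in_set) auto
  then obtain z where z: "z \<in> K" "closest_point ((*\<^sub>R) t ` K) x = t *\<^sub>R z" by blast
  have "d x = dist x (t *\<^sub>R z)"
    unfolding d_def z(2)[symmetric] using cl ne by (intro infdist_closest_point) auto
  then have "(d x)\<^sup>2 = (norm x)\<^sup>2 - 2 * t * (x \<bullet> z) + t\<^sup>2 * (norm z)\<^sup>2" by (simp only: sq)
  moreover have "2 * t * (x \<bullet> z) \<le> 2 * t * h x"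
    unfolding h_def using support_fun_upper[OF assms(1) z(1)] assms(4) by (intro mult_left_mono) auto
  moreover have "0 \<le> t\<^sup>2 * (norm z)\<^sup>2" by simp
  ultimately show "(norm x)\<^sup>2 - 2 * t * h x \<le> (d x)\<^sup>2" by linarith
  have "0 \<in> (*\<^sub>R) t ` K" using assms(2) by (intro image_eqI[of _ _ 0]) auto
  then show "d x \<le> norm x" unfolding d_def using infdist_le[of 0 _ x] by simp
qed

text \<open>By the expansion of the squared distance, exp(-d^2/2) has the derivative h(x)
  exp(-|x|^2/2) at t = 0. Dominated convergence moves the limit under the integral.\<close>

lemma gauss_mean_derivative:
  fixes K :: "'a::euclidean_space set"
  assumes "compact K" "0 \<in> K"
    and int: "\<And>t. t > 0 \<Longrightarrow> integrable lborel (\<lambda>x. exp (- (infdist x ((*\<^sub>R) t ` K))\<^sup>2 / 2))"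
  defines "t \<equiv> (\<lambda>k. 1 / real (Suc k))"
  shows "(\<lambda>k. ((\<integral>x. exp (- (infdist x ((*\<^sub>R) (t k) ` K))\<^sup>2 / 2) \<partial>lborel)
      - (\<integral>x. exp (- (norm (x :: 'a))\<^sup>2 / 2) \<partial>lborel)) / t k) \<longlonglongrightarrow> gauss_mean (support_fun K)"
proof -
  have ne: "K \<noteq> {}" using assms(2) by auto
  obtain R where R: "\<And>y. y \<in> K \<Longrightarrow> norm y \<le> R"
    using compact_imp_bounded[OF assms(1)] by (auto simp: bounded_iff)
  define h where "h = support_fun K"
  have h: "0 \<le> h x" "h x \<le> R * norm x" for x
    unfolding h_def using support_fun_bound[OF assms(1,2) R] by auto
  have [measurable]: "h \<in> borel_measurable borel"
    unfolding h_def by (intro borel_measurable_continuous_onI continuous_support_fun assms ne)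
  have t: "t k > 0" "t k \<le> 1" for k by (auto simp: t_def)
  have t0: "t \<longlonglongrightarrow> 0"
    unfolding t_def using LIMSEQ_inverse_real_of_nat by (simp add: inverse_eq_divide)
  define d where "d k x = infdist x ((*\<^sub>R) (t k) ` K)" for k x
  have [measurable]: "d k \<in> borel_measurable borel" for k
    unfolding d_def[abs_def] by (intro borel_measurable_continuous_onI continuous_intros)
  define s where "s k x = (exp (- (d k x)\<^sup>2 / 2) - exp (- (norm x)\<^sup>2 / 2)) / t k" for k x
  have d: "(d k x)\<^sup>2 \<le> (norm x)\<^sup>2 - 2 * t k * h x + (t k)\<^sup>2 * R\<^sup>2"
    "(norm x)\<^sup>2 - 2 * t k * h x \<le> (d k x)\<^sup>2" "d k x \<le> norm x" for k x
    using infdist_scaled_sq_bounds[OF assms(1,2) R less_imp_le[OF t(1)[of k]], of x] unfolding d_def h_def by auto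
  define E where "E k x = ((norm x)\<^sup>2 - (d k x)\<^sup>2) / 2" for k x
  have sE: "s k x = (exp (E k x) - 1) / t k * exp (- (norm x)\<^sup>2 / 2)" for k x
  proof -
    have "exp (- (d k x)\<^sup>2 / 2) = exp (E k x) * exp (- (norm x)\<^sup>2 / 2)"
      unfolding exp_add[symmetric] E_def by (simp add: field_simps)
    then show ?thesis by (simp add: s_def algebra_simps diff_divide_distrib)
  qed
  have E: "t k * h x - (t k)\<^sup>2 * R\<^sup>2 / 2 \<le> E k x" "E k x \<le> t k * h x" "0 \<le> E k x" for k x
  proof -
    have "0 \<le> d k x" unfolding d_def by (rule infdist_nonneg)
    then have "(d k x)\<^sup>2 \<le> (norm x)\<^sup>2" using d(3) by (intro power_mono)
    then show "t k * h x - (t k)\<^sup>2 * R\<^sup>2 / 2 \<le> E k x" "E k x \<le> t k * h x" "0 \<le> E k x"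
      using d(1)[of k x] d(2)[of x k] unfolding E_def by (simp_all add: field_simps)
  qed
  have lower: "h x - t k * R\<^sup>2 / 2 \<le> (exp (E k x) - 1) / t k" for k x
  proof -
    have "t k * (h x - t k * R\<^sup>2 / 2) \<le> E k x" using E(1)[of k x] by (simp add: power2_eq_square algebra_simps)
    also have "\<dots> \<le> exp (E k x) - 1" using exp_ge_add_one_self[of "E k x"] by linarith
    finally show ?thesis using t(1)[of k] by (simp add: field_simps)
  qed
  \<comment> \<open>From 1 - a <= exp(-a), multiplied by exp(a). As t <= 1, the bound is at most
    exp(2 h(x)), hence at most exp(2 R |x|), which the Gaussian weight can absorb.\<close>
  have upper: "(exp (E k x) - 1) / t k \<le> h x * exp (t k * h x)" for k x
  proof -
    let ?a = "t k * h x"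
    have "1 - ?a \<le> exp (- ?a)" using exp_ge_add_one_self[of "- ?a"] by simp
    then have "(1 - ?a) * exp ?a \<le> exp (- ?a) * exp ?a" by (intro mult_right_mono) auto
    also have "exp (- ?a) * exp ?a = 1" by (simp flip: exp_add)
    finally have "exp ?a - 1 \<le> ?a * exp ?a" by (simp add: algebra_simps)
    moreover have "exp (E k x) \<le> exp ?a" using E(2) by simp
    ultimately have "exp (E k x) - 1 \<le> ?a * exp ?a" by linarith
    then have "exp (E k x) - 1 \<le> t k * (h x * exp ?a)" by (simp only: mult.assoc)
    then show ?thesis using t(1)[of k] by (simp add: field_simps)
  qed
  have "(\<lambda>k. \<integral>x. s k x \<partial>lborel) \<longlonglongrightarrow> (\<integral>x. h x * exp (- (norm x)\<^sup>2 / 2) \<partial>lborel)"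
  proof (rule integral_dominated_convergence)
    show "integrable lborel (\<lambda>x :: 'a. exp (4 * R\<^sup>2) * exp (- (norm x)\<^sup>2 / 4))"
      by (intro integrable_mult_right integrable_gauss_quarter)
    show "AE x in lborel. (\<lambda>k. s k x) \<longlonglongrightarrow> h x * exp (- (norm x)\<^sup>2 / 2)"
    proof (rule AE_I2)
      fix x
      have "(\<lambda>k. (exp (E k x) - 1) / t k) \<longlonglongrightarrow> h x"
      proof (rule tendsto_sandwich)
        show "(\<lambda>k. h x - t k * R\<^sup>2 / 2) \<longlonglongrightarrow> h x"
          by (rule tendsto_eq_intros t0 refl | simp)+
        show "(\<lambda>k. h x * exp (t k * h x)) \<longlonglongrightarrow> h x"
          by (rule tendsto_eq_intros t0 refl | simp)+
      qed (use lower upper in auto)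
      then show "(\<lambda>k. s k x) \<longlonglongrightarrow> h x * exp (- (norm x)\<^sup>2 / 2)"
        unfolding sE by (rule tendsto_mult_right)
    qed
    show "AE x in lborel. norm (s k x) \<le> exp (4 * R\<^sup>2) * exp (- (norm x)\<^sup>2 / 4)" for k
    proof (rule AE_I2)
      fix x
      have "h x * exp (t k * h x) \<le> exp (h x) * exp (h x)"
        using t[of k] h[of x] le_exp_self[of "h x"] by (intro mult_mono) (auto intro: mult_left_le_one_le)
      also have "\<dots> = exp (2 * h x)" by (simp flip: exp_add)
      also have "\<dots> \<le> exp (2 * R * norm x)" using h(2)[of x] by simp
      finally have "(exp (E k x) - 1) / t k \<le> exp (2 * R * norm x)" using upper[of k x] by linarith
      then have "s k x \<le> exp (2 * R * norm x) * exp (- (norm x)\<^sup>2 / 2)"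
        unfolding sE by (intro mult_right_mono) auto
      also have "\<dots> \<le> exp (4 * R\<^sup>2) * exp (- (norm x)\<^sup>2 / 4)" by (rule exp_linear_gauss_le)
      finally have "s k x \<le> exp (4 * R\<^sup>2) * exp (- (norm x)\<^sup>2 / 4)" .
      moreover have "0 \<le> s k x" unfolding sE using E(3)[of k x] t(1)[of k] by simp
      ultimately show "norm (s k x) \<le> exp (4 * R\<^sup>2) * exp (- (norm x)\<^sup>2 / 4)" by simp
    qed
  qed (unfold s_def, measurable)
  moreover have "(\<integral>x. s k x \<partial>lborel) = ((\<integral>x. exp (- (d k x)\<^sup>2 / 2) \<partial>lborel)
      - (\<integral>x. exp (- (norm (x :: 'a))\<^sup>2 / 2) \<partial>lborel)) / t k" for k
  proof -
    have 1: "integrable lborel (\<lambda>x. exp (- (d k x)\<^sup>2 / 2))" unfolding d_def using int t by blast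
    have 2: "integrable lborel (\<lambda>x :: 'a. exp (- (norm x)\<^sup>2 / 2))"
      by (rule Bochner_Integration.integrable_bound[OF integrable_gauss_quarter]) auto
    show ?thesis unfolding s_def using 1 2 by simp
  qed
  ultimately show ?thesis unfolding gauss_mean_def h_def d_def by simp
qed

text \<open>The volume of tK + rB is the homogenized Steiner polynomial, in which r^i carries the
  factor t^(n-i). Hence the term linear in \<open>t\<close> comes from i = n - 1 alone, and that
  coefficient is V_1 times a ball volume. \<open>gauss_mean_derivative\<close> evaluates the same
  term as a Gaussian mean.\<close>

lemma intrinsic_volume_1_gauss_mean:
  "\<exists>c>0. \<forall>K :: (real ^ 'n::finite) set. compact K \<longrightarrow> convex K \<longrightarrow> 0 \<in> K \<longrightarrow>
     intrinsic_volume 1 K = c * gauss_mean (support_fun K)"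
proof (intro exI conjI allI impI)
  let ?n = "CARD('n)"
  let ?c = "1 / (unit_ball_vol (real (?n - 1)) * half_moment ?n)"
  have ub: "unit_ball_vol (real (?n - 1)) > 0" by (intro unit_ball_vol_pos) simp
  then show "?c > 0" using half_moment_pos by simp
  fix K :: "(real ^ 'n) set" assume K: "compact K" "convex K" "0 \<in> K"
  then have ne: "K \<noteq> {}" by auto
  obtain p where p: "degree p \<le> ?n"
    "\<And>t. t \<ge> 0 \<Longrightarrow> measure lebesgue {x. infdist x K \<le> t} = poly p t"
    by (rule steiner[OF K(1,2) ne]) (rule that)
  have pp: "poly p r = (\<Sum>i\<le>?n. coeff p i * r ^ i)" for r
    unfolding poly_altdef using p(1) by (intro sum.mono_neutral_left) (auto simp: coeff_eq_0)
  define P where "P t = (\<Sum>i\<le>?n. monom (coeff p i * t ^ (?n - i)) i)" for t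
  have cP: "coeff (P t) i = coeff p i * t ^ (?n - i)" if "i \<le> ?n" for t i
    using that by (simp add: P_def coeff_sum)
  have dP: "degree (P t) \<le> ?n" for t
    unfolding P_def by (intro degree_sum_le) (auto intro: order_trans[OF degree_monom_le])
  have Pt: "measure lebesgue {x. infdist x ((*\<^sub>R) t ` K) \<le> r} = poly (P t) r"
    if t: "t > 0" and r: "r \<ge> 0" for t r
  proof -
    note id = infdist_scaleR[OF K(1) ne t]
    have "{x. infdist x ((*\<^sub>R) t ` K) \<le> r} = (\<lambda>x. t *\<^sub>R x + 0) ` {x. infdist x K \<le> r / t}"
    proof (intro equalityI subsetI)
      fix x assume x: "x \<in> {x. infdist x ((*\<^sub>R) t ` K) \<le> r}"
      then show "x \<in> (\<lambda>x. t *\<^sub>R x + 0) ` {x. infdist x K \<le> r / t}"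
        using id[of "(1/t) *\<^sub>R x"] t
        by (intro image_eqI[of _ _ "(1/t) *\<^sub>R x"]) (auto simp: field_simps)
    qed (use id t in \<open>auto simp: field_simps\<close>)
    then have "measure lebesgue {x. infdist x ((*\<^sub>R) t ` K) \<le> r} = t ^ ?n * poly p (r / t)"
      using t r p(2)[of "r / t"] by (simp only: measure_lebesgue_affine) simp
    also have "\<dots> = poly (P t) r"
      unfolding pp P_def poly_sum poly_monom sum_distrib_left
    proof (rule sum.cong)
      fix i assume "i \<in> {..?n}"
      then have "t ^ ?n = t ^ (?n - i) * t ^ i" by (simp flip: power_add)
      then show "t ^ ?n * (coeff p i * (r / t) ^ i) = coeff p i * t ^ (?n - i) * r ^ i"
        using t by (simp add: power_divide)
    qed simp
    finally show ?thesis .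
  qed
  have cp: "compact ((*\<^sub>R) t ` K)" "(*\<^sub>R) t ` K \<noteq> {}" for t
    using K ne by (auto simp: compact_scaling)
  have G: "integrable lborel (\<lambda>x. exp (- (infdist x ((*\<^sub>R) t ` K))\<^sup>2 / 2))"
    "(\<integral>x. exp (- (infdist x ((*\<^sub>R) t ` K))\<^sup>2 / 2) \<partial>lborel)
      = (\<Sum>i\<le>?n. coeff (P t) i * half_moment (Suc i))" if "t > 0" for t
    using gauss_integral_infdist[OF cp dP Pt] that by blast+
  define q where "q = (\<Sum>i\<le>?n. monom (coeff p i * half_moment (Suc i)) (?n - i))"
  have q: "(\<integral>x. exp (- (infdist x ((*\<^sub>R) t ` K))\<^sup>2 / 2) \<partial>lborel) = poly q t" if "t > 0" for t
    unfolding G(2)[OF that] q_def poly_sum poly_monom by (intro sum.cong) (auto simp: cP)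
  have q1: "coeff q 1 = coeff p (?n - 1) * half_moment ?n"
  proof -
    have n: "?n \<ge> 1" by (simp add: Suc_leI)
    have "coeff q 1 = (\<Sum>i\<le>?n. if i = ?n - 1 then coeff p i * half_moment (Suc i) else 0)"
      unfolding q_def coeff_sum coeff_monom using n by (intro sum.cong) auto
    then show ?thesis using n by simp
  qed
  let ?G = "\<integral>x. exp (- (norm (x :: real ^ 'n))\<^sup>2 / 2) \<partial>lborel"
  define t where "t k = 1 / real (Suc k)" for k
  have t: "t k > 0" for k by (simp add: t_def)
  have t0: "t \<longlonglongrightarrow> 0"
    unfolding t_def[abs_def] using LIMSEQ_inverse_real_of_nat by (simp add: inverse_eq_divide)
  have lim: "(\<lambda>k. (poly q (t k) - ?G) / t k) \<longlonglongrightarrow> gauss_mean (support_fun K)"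
    using gauss_mean_derivative[OF K(1,3) G(1)] q unfolding t_def by simp
  \<comment> \<open>Convergence of the difference quotients forces the differences to 0, and this
    identifies \<open>?G\<close> with the constant term of \<open>q\<close>.\<close>
  have "(\<lambda>k. (poly q (t k) - ?G) / t k * t k) \<longlonglongrightarrow> gauss_mean (support_fun K) * 0"
    by (intro tendsto_mult lim t0)
  then have "(\<lambda>k. poly q (t k) - ?G) \<longlonglongrightarrow> 0" using t by (simp add: less_imp_neq[symmetric])
  moreover have "(\<lambda>k. poly q (t k) - ?G) \<longlonglongrightarrow> poly q 0 - ?G"
    by (intro tendsto_intros t0)
  ultimately have G0: "?G = poly q 0" using LIMSEQ_unique by fastforce
  obtain q' where q': "q = pCons (poly q 0) q'" by (metis poly_0_coeff_0 pCons_cases coeff_pCons_0)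
  have "(poly q (t k) - ?G) / t k = poly q' (t k)" for k
    unfolding G0 using t[of k] by (subst q') simp
  then have "(\<lambda>k. poly q' (t k)) \<longlonglongrightarrow> gauss_mean (support_fun K)" using lim by simp
  moreover have "(\<lambda>k. poly q' (t k)) \<longlonglongrightarrow> poly q' 0" by (intro tendsto_intros t0)
  ultimately have "gauss_mean (support_fun K) = poly q' 0" using LIMSEQ_unique by blast
  also have "\<dots> = coeff q 1" by (subst q') (simp add: poly_0_coeff_0)
  finally have "gauss_mean (support_fun K) = coeff p (?n - 1) * half_moment ?n" using q1 by simp
  moreover have "intrinsic_volume 1 K = coeff p (?n - 1) / unit_ball_vol (real (?n - 1))"
    by (rule intrinsic_volume_eq_coeff[OF K(1) ne p]) (simp_all add: Suc_leI)
  ultimately show "intrinsic_volume 1 K = ?c * gauss_mean (support_fun K)"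
    using half_moment_pos[of ?n] by simp
qed

subsection \<open>The half-normal quantile function\<close>

definition half_normal :: "real measure" where
  "half_normal = distr (density lborel (\<lambda>x. ennreal (std_normal_density x))) borel abs"

text \<open>
  The mass that the image of the half-normal distribution under division by \<open>t\<close> gives to \<open>A\<close>. The
  ratio of its density to the half-normal density is monotone; this yields the
  monotonicity of the two quotients of quantiles on which the main inequality rests.
\<close>
definition stretched_mass :: "real \<Rightarrow> real set \<Rightarrow> real" where
  "stretched_mass t A = (\<integral>s. indicator A \<bar>s\<bar> * (t * std_normal_density (t * s)) \<partial>lborel)"

lemma half_normal_distribution: "cdf_distribution half_normal"
proof -
  have "prob_space (density lborel (\<lambda>x. ennreal (std_normal_density x)))"
    by (intro prob_space_normal_density) simp
  then have "prob_space half_normal"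
    unfolding half_normal_def by (rule prob_space.prob_space_distr) simp
  then show ?thesis
    by (simp add: cdf_distribution_def real_distribution_def real_distribution_axioms_def half_normal_def)
qed

interpretation hn: cdf_distribution half_normal
  by (rule half_normal_distribution)

lemma integrable_stretched:
  assumes "t > 0" "A \<in> sets borel"
  shows "integrable lborel (\<lambda>s. indicator A \<bar>s\<bar> * (t * std_normal_density (t * s)))"
proof (rule Bochner_Integration.integrable_bound)
  have "integrable lborel (\<lambda>s. std_normal_density (0 + t * s))"
    using assms(1) by (subst lborel_integrable_real_affine_iff) auto
  then show "integrable lborel (\<lambda>s. t * std_normal_density (t * s))" by simp
  show "(\<lambda>s. indicator A \<bar>s\<bar> * (t * std_normal_density (t * s))) \<in> borel_measurable lborel"
    using assms(2) by measurable
qed (use assms in \<open>auto simp: indicator_def\<close>)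

text \<open>Substitution x = t s. It moves the dilation from the set into the density, so that
  different dilations can be compared on one fixed set.\<close>

lemma half_normal_scaled:
  assumes "t > 0" and [measurable]: "A \<in> sets borel" "B \<in> sets borel"
    and AB: "\<And>s. s \<ge> 0 \<Longrightarrow> t * s \<in> A \<longleftrightarrow> s \<in> B"
  shows "measure half_normal A = stretched_mass t B"
proof -
  have [measurable]: "abs -` A \<in> sets borel"
    by (rule measurable_sets_borel[OF _ assms(2)]) simp
  have "measure half_normal A
      = measure (density lborel (\<lambda>x. ennreal (std_normal_density x))) (abs -` A)"
    unfolding half_normal_def by (simp add: measure_distr)
  also have "\<dots> = (\<integral>x. indicator A \<bar>x\<bar> * std_normal_density x \<partial>lborel)"
  proof -
    have "emeasure (density lborel (\<lambda>x. ennreal (std_normal_density x))) (abs -` A)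
        = (\<integral>\<^sup>+x. ennreal (indicator A \<bar>x\<bar> * std_normal_density x) \<partial>lborel)"
      by (subst emeasure_density) (auto intro!: nn_integral_cong simp: indicator_def measurable_sets_borel)
    also have "\<dots> = ennreal (\<integral>x. indicator A \<bar>x\<bar> * std_normal_density x \<partial>lborel)"
      using integrable_stretched[of 1 A] by (intro nn_integral_eq_integral) auto
    finally show ?thesis by (simp add: measure_def)
  qed
  also have "\<dots> = t * (\<integral>s. indicator A \<bar>t * s\<bar> * std_normal_density (t * s) \<partial>lborel)"
    using lborel_integral_real_affine[of t "\<lambda>x. indicator A \<bar>x\<bar> * std_normal_density x" 0] assms(1)
    by simp
  also have "\<dots> = stretched_mass t B"
  proof -
    have "indicator A \<bar>t * s\<bar> = (indicator B \<bar>s\<bar> :: real)" for s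
      using AB[of "\<bar>s\<bar>"] assms(1) by (auto simp: indicator_def abs_mult)
    then show ?thesis
      unfolding stretched_mass_def by (simp flip: integral_mult_right_zero add: mult_ac)
  qed
  finally show ?thesis .
qed

lemma stretched_mass_Un:
  assumes "t > 0" "A \<in> sets borel" "B \<in> sets borel" "A \<inter> B = {}"
  shows "stretched_mass t (A \<union> B) = stretched_mass t A + stretched_mass t B"
proof -
  have "indicator (A \<union> B) \<bar>s\<bar> = (indicator A \<bar>s\<bar> + indicator B \<bar>s\<bar> :: real)" for s
    using assms(4) by (auto simp: indicator_def)
  then show ?thesis
    unfolding stretched_mass_def using integrable_stretched[OF assms(1)] assms(2,3)
    by (simp add: distrib_right)
qed

lemma stretched_mass_nonneg: "t > 0 \<Longrightarrow> 0 \<le> stretched_mass t A"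
  unfolding stretched_mass_def by (intro Bochner_Integration.integral_nonneg) (simp add: indicator_def)

lemma integral_pos_if_pos_on_interval:
  fixes f :: "real \<Rightarrow> real"
  assumes "integrable lborel f" "\<And>x. 0 \<le> f x" "a < b" "\<And>x. a < x \<Longrightarrow> x < b \<Longrightarrow> 0 < f x"
  shows "0 < (\<integral>x. f x \<partial>lborel)"
proof (rule ccontr)
  assume "\<not> 0 < (\<integral>x. f x \<partial>lborel)"
  then have "(\<integral>x. f x \<partial>lborel) = 0"
    using Bochner_Integration.integral_nonneg[of lborel f] assms(2) by (metis antisym not_less)
  then have "AE x in lborel. f x = 0"
    using integral_nonneg_eq_0_iff_AE[OF assms(1)] assms(2) by simp
  then have "AE x in lborel. x \<notin> {a<..<b}"
    by eventually_elim (use assms(4) in force)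
  then have "emeasure lborel {x \<in> space lborel. \<not> x \<notin> {a<..<b}} = 0"
    by (subst (asm) AE_iff_measurable[OF _ refl]) auto
  moreover have "{x \<in> space lborel. \<not> x \<notin> {a<..<b}} = {a<..<b}" by auto
  ultimately show False using assms(3) by simp
qed

lemma stretched_mass_pos:
  assumes "t > 0" "A \<in> sets borel" "0 \<le> a" "a < b" "{a<..<b} \<subseteq> A"
  shows "stretched_mass t A > 0"
  unfolding stretched_mass_def
  using assms normal_density_pos[of 1 0]
  by (intro integral_pos_if_pos_on_interval[of _ a b] integrable_stretched)
    (auto simp: indicator_def intro!: mult_nonneg_nonneg)

text \<open>The likelihood ratio of the stretched normal density to the original one at distance
  \<open>s\<close> from 0.\<close>

definition stretch_ratio :: "real \<Rightarrow> real \<Rightarrow> real" where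
  "stretch_ratio t s = t * exp (- ((t\<^sup>2 - 1) * s\<^sup>2) / 2)"

lemma stretch_ratio: "t * std_normal_density (t * s) = stretch_ratio t \<bar>s\<bar> * std_normal_density s"
proof -
  have "exp (- (t * s)\<^sup>2 / 2) = exp (- ((t\<^sup>2 - 1) * s\<^sup>2) / 2) * exp (- s\<^sup>2 / 2)"
    unfolding exp_add[symmetric] by (simp add: field_simps power_mult_distrib)
  then show ?thesis by (simp add: stretch_ratio_def std_normal_density_def)
qed

lemma stretch_ratio_antimono:
  assumes "t \<ge> 1" "0 \<le> r" "r \<le> s"
  shows "stretch_ratio t s \<le> stretch_ratio t r"
proof -
  have "(t\<^sup>2 - 1) * r\<^sup>2 \<le> (t\<^sup>2 - 1) * s\<^sup>2"
    using assms by (intro mult_left_mono power_mono) (auto simp: one_le_power)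
  then show ?thesis using assms(1) by (simp add: stretch_ratio_def)
qed

lemma stretch_ratio_strict_antimono:
  assumes "t > 1" "0 \<le> r" "r < s"
  shows "stretch_ratio t s < stretch_ratio t r"
proof -
  have "(t\<^sup>2 - 1) * r\<^sup>2 < (t\<^sup>2 - 1) * s\<^sup>2"
    using assms by (intro mult_strict_left_mono power_strict_mono) (auto simp: one_less_power)
  then show ?thesis using assms(1) by (simp add: stretch_ratio_def)
qed

lemma stretched_mass_le:
  assumes "t \<ge> 1" "A \<in> sets borel" "x \<ge> 0" "A \<subseteq> {x..}"
  shows "stretched_mass t A \<le> stretch_ratio t x * stretched_mass 1 A"
proof -
  have "stretched_mass t A
      \<le> (\<integral>s. stretch_ratio t x * (indicator A \<bar>s\<bar> * (1 * std_normal_density (1 * s))) \<partial>lborel)"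
    unfolding stretched_mass_def
  proof (rule integral_mono)
    fix s
    show "indicator A \<bar>s\<bar> * (t * std_normal_density (t * s))
        \<le> stretch_ratio t x * (indicator A \<bar>s\<bar> * (1 * std_normal_density (1 * s)))"
      using stretch_ratio_antimono[OF assms(1,3), of "\<bar>s\<bar>"] assms(4)
      by (auto simp: indicator_def stretch_ratio intro!: mult_right_mono)
  qed (use assms integrable_stretched[of 1 A] in \<open>auto intro!: integrable_stretched\<close>)
  then show ?thesis unfolding stretched_mass_def by simp
qed

lemma stretched_mass_ge:
  assumes "t \<ge> 1" "A \<in> sets borel" "A \<subseteq> {..x}"
  shows "stretch_ratio t x * stretched_mass 1 A \<le> stretched_mass t A"
proof -
  have "(\<integral>s. stretch_ratio t x * (indicator A \<bar>s\<bar> * (1 * std_normal_density (1 * s))) \<partial>lborel)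
      \<le> stretched_mass t A"
    unfolding stretched_mass_def
  proof (rule integral_mono)
    fix s
    show "stretch_ratio t x * (indicator A \<bar>s\<bar> * (1 * std_normal_density (1 * s)))
        \<le> indicator A \<bar>s\<bar> * (t * std_normal_density (t * s))"
      using stretch_ratio_antimono[OF assms(1), of "\<bar>s\<bar>" x] assms(3)
      by (auto simp: indicator_def stretch_ratio intro!: mult_right_mono)
  qed (use assms integrable_stretched[of 1 A] in \<open>auto intro!: integrable_stretched\<close>)
  then show ?thesis unfolding stretched_mass_def by simp
qed

text \<open>The strict form of \<open>stretched_mass_ge\<close> on an interval. The strictness
  passes through \<open>hn_tail_ratio\<close> to T/Q and from there to the uniqueness of the
  minimizer.\<close>

lemma stretched_mass_Ioc_gt:
  assumes "t > 1" "0 \<le> x" "x < y"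
  shows "stretch_ratio t y * stretched_mass 1 {x<..y} < stretched_mass t {x<..y}"
proof -
  let ?g = "\<lambda>s. indicator {x<..y} \<bar>s\<bar> * (t * std_normal_density (t * s))
      - stretch_ratio t y * (indicator {x<..y} \<bar>s\<bar> * (1 * std_normal_density (1 * s)))"
  have eq: "?g s = indicator {x<..y} \<bar>s\<bar> * ((stretch_ratio t \<bar>s\<bar> - stretch_ratio t y) * std_normal_density s)" for s
    by (simp only: stretch_ratio[of t s]) (simp add: algebra_simps)
  have pos: "0 \<le> ?g s" "x < s \<Longrightarrow> s < y \<Longrightarrow> 0 < ?g s" for s
    unfolding eq using stretch_ratio_antimono[of t "\<bar>s\<bar>" y] stretch_ratio_strict_antimono[OF assms(1), of s y] assms
      normal_density_pos[of 1 0 s]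
    by (auto simp: indicator_def)
  have i: "integrable lborel (\<lambda>s. indicator {x<..y} \<bar>s\<bar> * (t * std_normal_density (t * s)))"
    "integrable lborel (\<lambda>s. stretch_ratio t y * (indicator {x<..y} \<bar>s\<bar> * (1 * std_normal_density (1 * s))))"
    using assms integrable_stretched[of 1 "{x<..y}"] by (auto intro!: integrable_stretched)
  have "0 < (\<integral>s. ?g s \<partial>lborel)"
    using pos assms(3) i by (intro integral_pos_if_pos_on_interval[of _ x y]) auto
  also have "\<dots> = stretched_mass t {x<..y} - stretch_ratio t y * stretched_mass 1 {x<..y}"
    unfolding stretched_mass_def Bochner_Integration.integral_diff[OF i] by simp
  finally show ?thesis by simp
qed

abbreviation hn_cdf :: "real \<Rightarrow> real" where "hn_cdf \<equiv> cdf half_normal"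

lemma hn_cdf_stretch: "t > 0 \<Longrightarrow> hn_cdf (t * x) = stretched_mass t {..x}"
  unfolding cdf_def by (rule half_normal_scaled) auto

lemma hn_tail_stretch: "t > 0 \<Longrightarrow> 1 - hn_cdf (t * x) = stretched_mass t {x<..}"
proof -
  assume t: "t > 0"
  have "1 - hn_cdf (t * x) = measure half_normal (space half_normal - {..t * x})"
    unfolding cdf_def by (subst hn.prob_compl) auto
  also have "space half_normal - {..t * x} = {t * x<..}"
    using hn.borel_UNIV by auto
  also have "measure half_normal \<dots> = stretched_mass t {x<..}"
    using t by (intro half_normal_scaled) auto
  finally show ?thesis .
qed

lemma hn_cdf_eq: "hn_cdf x = stretched_mass 1 {..x}" and hn_tail_eq: "1 - hn_cdf x = stretched_mass 1 {x<..}"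
  using hn_cdf_stretch[of 1 x] hn_tail_stretch[of 1 x] by simp_all

lemma hn_cdf_0: "hn_cdf 0 = 0"
proof -
  have "AE s :: real in lborel. s \<noteq> 0" by (rule AE_lborel_singleton)
  then have "AE s in lborel. indicator {..0::real} \<bar>s\<bar> * (1 * std_normal_density (1 * s)) = 0"
    by eventually_elim (simp add: indicator_def)
  then show ?thesis unfolding hn_cdf_eq stretched_mass_def by (rule integral_eq_zero_AE)
qed

lemma hn_cdf_strict_mono:
  assumes "0 \<le> x" "x < y"
  shows "hn_cdf x < hn_cdf y"
proof -
  have "stretched_mass 1 ({..x} \<union> {x<..y}) = stretched_mass 1 {..x} + stretched_mass 1 {x<..y}"
    by (intro stretched_mass_Un) auto
  moreover have "{..x} \<union> {x<..y} = {..y}" using assms by auto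
  moreover have "stretched_mass 1 {x<..y} > 0"
    using assms by (intro stretched_mass_pos[of _ _ x y]) auto
  ultimately show ?thesis unfolding hn_cdf_eq by simp
qed

lemma hn_cdf_less_1: "hn_cdf x < 1"
  using hn_cdf_strict_mono[of "max x 0" "max x 0 + 1"] hn.cdf_bounded_prob[of "max x 0 + 1"]
    hn.cdf_nondecreasing[of x "max x 0"] by linarith

lemma isCont_hn_cdf: "isCont hn_cdf x"
proof -
  have "measure half_normal {x} = stretched_mass 1 {x}"
    by (rule half_normal_scaled) auto
  moreover have "AE s in lborel. s \<noteq> x" "AE s in lborel. s \<noteq> - x" by (rule AE_lborel_singleton)+
  then have "AE s in lborel. indicator {x} \<bar>s\<bar> * (1 * std_normal_density (1 * s)) = 0"
    by eventually_elim (auto simp: indicator_def abs_if split: if_splits)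
  then have "stretched_mass 1 {x} = 0" unfolding stretched_mass_def by (rule integral_eq_zero_AE)
  ultimately show ?thesis by (simp add: hn.isCont_cdf)
qed

lemma cross_ineq:
  fixes a b c d k :: real
  assumes "k * a \<le> c" "d \<le> k * b" "0 \<le> a" "0 \<le> b"
  shows "d * a \<le> c * b"
  using mult_right_mono[OF assms(2,3)] mult_right_mono[OF assms(1,4)] by (simp add: mult_ac)

text \<open>Split the interval up to \<open>y\<close> at \<open>x\<close>: on the lower part the
  likelihood ratio is at least its value at \<open>x\<close>, on the upper part at most that value.
  So the quotient of hn_cdf (t y) by hn_cdf y does not increase with \<open>y\<close>.\<close>

lemma hn_cdf_ratio:
  assumes "t \<ge> 1" "0 \<le> x" "x \<le> y"
  shows "hn_cdf (t * y) * hn_cdf x \<le> hn_cdf (t * x) * hn_cdf y"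
proof -
  have t: "t > 0" using assms by simp
  have U: "{..y} = {..x} \<union> {x<..y}" using assms by auto
  have "stretched_mass t {x<..y} * stretched_mass 1 {..x} \<le> stretched_mass t {..x} * stretched_mass 1 {x<..y}"
    using assms by (intro cross_ineq[of "stretch_ratio t x"] stretched_mass_ge stretched_mass_le
        stretched_mass_nonneg) auto
  moreover have "stretched_mass s {..y} = stretched_mass s {..x} + stretched_mass s {x<..y}" if "s > 0" for s
    unfolding U using that by (intro stretched_mass_Un) auto
  ultimately show ?thesis
    unfolding hn_cdf_stretch[OF t] unfolding hn_cdf_eq using t by (simp add: algebra_simps)
qed

text \<open>The counterpart for tails, split at \<open>y\<close>: the likelihood ratio exceeds its
  value at \<open>y\<close> before \<open>y\<close> and stays below it afterwards.\<close>

lemma hn_tail_ratio: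
  assumes "t > 1" "0 \<le> x" "x < y"
  shows "(1 - hn_cdf (t * y)) * (1 - hn_cdf x) < (1 - hn_cdf (t * x)) * (1 - hn_cdf y)"
proof -
  have t: "t > 0" using assms by simp
  have U: "{x<..} = {x<..y} \<union> {y<..}" using assms by auto
  let ?a = "stretched_mass 1 {x<..y}" and ?b = "stretched_mass 1 {y<..}"
    and ?c = "stretched_mass t {x<..y}" and ?d = "stretched_mass t {y<..}"
  have b: "?b > 0" using assms by (intro stretched_mass_pos[of _ _ y "y + 1"]) auto
  have "?d * ?a \<le> stretch_ratio t y * ?b * ?a"
    using assms by (intro mult_right_mono stretched_mass_le stretched_mass_nonneg) auto
  also have "\<dots> = stretch_ratio t y * ?a * ?b" by simp
  also have "\<dots> < ?c * ?b"
    using b stretched_mass_Ioc_gt[OF assms] by (rule mult_strict_right_mono[rotated])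
  finally have "?d * ?a < ?c * ?b" .
  moreover have "stretched_mass s {x<..} = stretched_mass s {x<..y} + stretched_mass s {y<..}" if "s > 0" for s
    unfolding U using that by (intro stretched_mass_Un) auto
  ultimately show ?thesis
    unfolding hn_tail_stretch[OF t] unfolding hn_tail_eq using t by (simp add: algebra_simps)
qed

section \<open>Quantiles and their two monotone quotients\<close>

definition hn_quantile :: "real \<Rightarrow> real" where
  "hn_quantile v = Inf {x. v \<le> hn_cdf x}"

lemma hn_quantile_le_iff: "0 < v \<Longrightarrow> v < 1 \<Longrightarrow> hn_quantile v \<le> x \<longleftrightarrow> v \<le> hn_cdf x"
  unfolding hn_quantile_def by (rule hn.pseudoinverse[symmetric])

lemma hn_quantile_pos:
  assumes "0 < v" "v < 1"
  shows "0 < hn_quantile v"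
  using hn_quantile_le_iff[OF assms, of 0] assms hn_cdf_0 by simp

lemma hn_cdf_quantile:
  assumes "0 < v" "v < 1"
  shows "hn_cdf (hn_quantile v) = v"
proof (rule antisym)
  show "v \<le> hn_cdf (hn_quantile v)" using hn_quantile_le_iff[OF assms] by blast
  have "(hn_cdf \<longlongrightarrow> hn_cdf (hn_quantile v)) (at_left (hn_quantile v))"
    using isCont_hn_cdf by (simp add: isCont_def filterlim_at_split)
  moreover have "\<forall>\<^sub>F x in at_left (hn_quantile v). hn_cdf x \<le> v"
  proof (rule eventually_at_leftI[of "hn_quantile v - 1"])
    fix x assume "x \<in> {hn_quantile v - 1<..<hn_quantile v}"
    then show "hn_cdf x \<le> v" using hn_quantile_le_iff[OF assms, of x] by auto
  qed simp
  ultimately show "hn_cdf (hn_quantile v) \<le> v"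
    by (intro tendsto_upperbound) auto
qed

lemma hn_quantile_cdf:
  assumes "0 < x"
  shows "hn_quantile (hn_cdf x) = x" "0 < hn_cdf x" "hn_cdf x < 1"
proof -
  show *: "0 < hn_cdf x" "hn_cdf x < 1"
    using hn_cdf_strict_mono[of 0 x] hn_cdf_0 hn_cdf_less_1 assms by auto
  show "hn_quantile (hn_cdf x) = x"
  proof (rule antisym)
    show "hn_quantile (hn_cdf x) \<le> x" using hn_quantile_le_iff[OF *] by simp
    show "x \<le> hn_quantile (hn_cdf x)"
    proof (rule ccontr)
      assume "\<not> x \<le> hn_quantile (hn_cdf x)"
      then have "hn_cdf (hn_quantile (hn_cdf x)) < hn_cdf x"
        using hn_quantile_pos[OF *] by (intro hn_cdf_strict_mono) auto
      then show False using hn_cdf_quantile[OF *] by simp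
    qed
  qed
qed

lemma hn_quantile_strict_mono:
  assumes "0 < v" "v < w" "w < 1"
  shows "hn_quantile v < hn_quantile w"
proof (rule ccontr)
  assume "\<not> hn_quantile v < hn_quantile w"
  then have "hn_cdf (hn_quantile w) \<le> hn_cdf (hn_quantile v)"
    by (intro hn.cdf_nondecreasing) simp
  then show False using assms by (simp add: hn_cdf_quantile)
qed

text \<open>Write Q for \<open>hn_quantile\<close>. With t = Q(q) / Q(p) the claim is Q(q v) <= t
  Q(p v), which is \<open>hn_cdf_ratio\<close> at the points Q(p v) and Q(p). It is the reason why X
  decreases: relative to the largest coordinate, the others shrink as its level rises.\<close>

lemma hn_quantile_scaled_ratio:
  assumes "0 < p" "p \<le> q" "q < 1" "0 < v" "v \<le> 1"
  shows "hn_quantile (q * v) / hn_quantile q \<le> hn_quantile (p * v) / hn_quantile p"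
proof -
  let ?Q = hn_quantile
  have pv: "0 < p * v" "p * v \<le> p" "0 < q * v" "q * v \<le> q" using assms by (auto simp: mult_le_cancel_left1)
  have pos: "0 < ?Q p" "0 < ?Q q" "0 < ?Q (p * v)" using assms pv by (auto intro!: hn_quantile_pos)
  have "?Q p \<le> ?Q q" using hn_quantile_strict_mono[of p q] assms by (cases "p = q") auto
  define t where "t = ?Q q / ?Q p"
  have t: "t \<ge> 1" "t * ?Q p = ?Q q" using \<open>?Q p \<le> ?Q q\<close> pos by (auto simp: t_def)
  have "?Q (p * v) \<le> ?Q p" using hn_quantile_strict_mono[of "p * v" p] pv assms by (cases "p * v = p") auto
  then have "hn_cdf (t * ?Q p) * hn_cdf (?Q (p * v)) \<le> hn_cdf (t * ?Q (p * v)) * hn_cdf (?Q p)"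
    using t pos by (intro hn_cdf_ratio) auto
  then have "q * (p * v) \<le> hn_cdf (t * ?Q (p * v)) * p"
    using assms pv by (simp add: t(2) hn_cdf_quantile)
  then have "q * v \<le> hn_cdf (t * ?Q (p * v))" using assms by simp
  then have "?Q (q * v) \<le> t * ?Q (p * v)" using hn_quantile_le_iff[of "q * v"] pv assms by simp
  then show ?thesis using pos by (simp add: t_def field_simps)
qed

text \<open>The tail beyond level u + (1 - u) x is (1 - u) (1 - x), so the factor 1 - u cancels and
  \<open>hn_tail_ratio\<close> applies. Integrated over \<open>u\<close> this makes T/Q decrease; at
  a pair p v < p it separates \<open>u\<close> from the gauge in \<open>top_mean_ge\<close>.\<close>

lemma hn_quantile_shifted_ratio:
  assumes "0 < p" "p < q" "q < 1" "0 < u" "u < 1"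
  shows "hn_quantile (u + (1 - u) * q) / hn_quantile q < hn_quantile (u + (1 - u) * p) / hn_quantile p"
proof -
  let ?Q = hn_quantile
  let ?y = "\<lambda>x. u + (1 - u) * x"
  have y: "x < ?y x" "?y x < 1" if "0 < x" "x < 1" for x
  proof -
    have "0 < u * (1 - x)" "0 < (1 - u) * (1 - x)" using that assms by auto
    then show "x < ?y x" "?y x < 1" by (simp_all add: algebra_simps)
  qed
  have yp: "p < ?y p" "?y p < 1" and yq: "q < ?y q" "?y q < 1" using y[of p] y[of q] assms by auto
  have pos: "0 < ?Q p" "0 < ?Q q" using assms by (auto intro!: hn_quantile_pos)
  define t where "t = ?Q (?y p) / ?Q p"
  have t: "t > 1" "t * ?Q p = ?Q (?y p)"
    using hn_quantile_strict_mono[OF assms(1) yp] pos by (auto simp: t_def)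
  have "?Q p < ?Q q" using hn_quantile_strict_mono assms by auto
  then have "(1 - hn_cdf (t * ?Q q)) * (1 - hn_cdf (?Q p)) < (1 - hn_cdf (t * ?Q p)) * (1 - hn_cdf (?Q q))"
    using t pos by (intro hn_tail_ratio) auto
  then have "(1 - hn_cdf (t * ?Q q)) * (1 - p) < (1 - ?y p) * (1 - q)"
    using assms yp by (simp add: t(2) hn_cdf_quantile)
  also have "(1 - ?y p) * (1 - q) = (1 - ?y q) * (1 - p)" by (simp add: algebra_simps)
  finally have lt: "?y q < hn_cdf (t * ?Q q)" using assms by (simp add: mult_less_cancel_right)
  have "?Q (?y q) < t * ?Q q"
  proof (rule ccontr)
    assume "\<not> ?Q (?y q) < t * ?Q q"
    then have "hn_cdf (t * ?Q q) \<le> hn_cdf (?Q (?y q))" by (intro hn.cdf_nondecreasing) simp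
    then show False using lt hn_cdf_quantile[of "?y q"] yq assms by simp
  qed
  then show ?thesis using pos by (simp add: t_def field_simps)
qed

text \<open>The open interval keeps each point of the space strictly between 0 and 1, where
  \<open>hn_quantile\<close> is positive and inverse to \<open>hn_cdf\<close>.\<close>

definition unit_measure :: "real measure" where
  "unit_measure = restrict_space lborel {0<..<1}"

lemma space_unit_measure [simp]: "space unit_measure = {0<..<1}"
  by (simp add: unit_measure_def space_restrict_space)

lemma prob_space_unit_measure: "prob_space unit_measure"
  by (auto simp: unit_measure_def emeasure_restrict_space space_restrict_space intro!: prob_spaceI)

lemma measurable_hn_quantile [measurable]: "hn_quantile \<in> borel_measurable unit_measure"
proof -
  have "hn_quantile \<in> borel_measurable (restrict_space borel {0<..<1})"
    unfolding hn_quantile_def[abs_def] by (rule hn.measurable_CI)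
  then show ?thesis
    by (simp add: unit_measure_def cong: measurable_cong_sets sets_restrict_space_cong)
qed

lemma nn_integral_unit_measure:
  assumes "G \<in> borel_measurable unit_measure"
  shows "(\<integral>\<^sup>+v. G v \<partial>unit_measure) = (\<integral>\<^sup>+v. G v * indicator {0<..<1} v \<partial>lborel)"
  unfolding unit_measure_def by (rule nn_integral_restrict_space) simp

text \<open>Quantile transform: an even function depends on |x| alone, and
  \<open>hn_quantile\<close> carries the uniform law to the law of |x|.\<close>

lemma nn_integral_even_gauss:
  fixes G :: "real \<Rightarrow> ennreal"
  assumes [measurable]: "G \<in> borel_measurable borel" and even: "\<And>x. G (- x) = G x"
  shows "(\<integral>\<^sup>+x. ennreal (std_normal_density x) * G x \<partial>lborel) = (\<integral>\<^sup>+v. G (hn_quantile v) \<partial>unit_measure)"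
proof -
  have "distr unit_measure borel hn_quantile = half_normal"
    unfolding unit_measure_def hn_quantile_def[abs_def] by (rule hn.distr_I_eq_M)
  then have "(\<integral>\<^sup>+v. G (hn_quantile v) \<partial>unit_measure) = (\<integral>\<^sup>+x. G x \<partial>half_normal)"
    using nn_integral_distr[OF measurable_hn_quantile, of G] by simp
  also have "\<dots> = (\<integral>\<^sup>+x. G \<bar>x\<bar> \<partial>density lborel (\<lambda>x. ennreal (std_normal_density x)))"
    unfolding half_normal_def by (rule nn_integral_distr) auto
  also have "\<dots> = (\<integral>\<^sup>+x. ennreal (std_normal_density x) * G x \<partial>lborel)"
    using even by (subst nn_integral_density) (auto simp: abs_if intro!: nn_integral_cong)
  finally show ?thesis by simp
qed

lemma hn_quantile_integrable: "integrable unit_measure hn_quantile"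
proof (rule integrableI_nonneg)
  have "(\<integral>\<^sup>+v. ennreal \<bar>hn_quantile v\<bar> \<partial>unit_measure) = (\<integral>\<^sup>+x. ennreal (std_normal_density x) * ennreal \<bar>x\<bar> \<partial>lborel)"
    by (subst nn_integral_even_gauss) auto
  also have "\<dots> = (\<integral>\<^sup>+x. ennreal (norm (std_normal_density x * \<bar>x\<bar> ^ 1)) \<partial>lborel)"
    by (simp add: abs_mult ennreal_mult')
  also have "\<dots> < \<infinity>"
    using integrable_std_normal_moment_abs[of 1] unfolding integrable_iff_bounded by blast
  also have "(\<integral>\<^sup>+v. ennreal \<bar>hn_quantile v\<bar> \<partial>unit_measure) = (\<integral>\<^sup>+v. ennreal (hn_quantile v) \<partial>unit_measure)"
    using hn_quantile_pos by (intro nn_integral_cong) (auto simp: abs_of_pos)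
  finally show "(\<integral>\<^sup>+v. ennreal (hn_quantile v) \<partial>unit_measure) < \<infinity>" .
  show "AE v in unit_measure. 0 \<le> hn_quantile v"
    using hn_quantile_pos by (intro AE_I2) (auto intro: less_imp_le)
qed simp

subsection \<open>The uniform distribution on the cube\<close>

abbreviation cube :: "'i set \<Rightarrow> ('i \<Rightarrow> real) measure" where
  "cube I \<equiv> PiM I (\<lambda>_. unit_measure)"

interpretation unit_measure: prob_space unit_measure
  by (rule prob_space_unit_measure)

interpretation unit_product: product_sigma_finite "\<lambda>_. unit_measure"
  by (simp add: product_sigma_finite_def unit_measure.sigma_finite_measure_axioms)

lemma prob_space_cube: "prob_space (cube I)"
  by (intro prob_space_PiM prob_space_unit_measure)

lemma space_cube_iff: "v \<in> space (cube I) \<longleftrightarrow> (\<forall>k\<in>I. 0 < v k \<and> v k < 1) \<and> v \<in> extensional I"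
  by (auto simp: space_PiM PiE_iff)

lemma measurable_cube_upd [measurable (raw)]:
  assumes "k \<in> I" "f \<in> measurable N (cube I)" "h \<in> measurable N unit_measure"
  shows "(\<lambda>x. (f x)(k := h x)) \<in> measurable N (cube I)"
  using assms by (intro measurable_fun_upd[of I I k]) auto

text \<open>Coordinate \<open>k\<close> is resampled while the outer integral stays on the full
  cube, where the old value of \<open>k\<close> integrates out. This way the index set never shrinks
  during conditioning.\<close>

lemma nn_integral_cube_coord:
  assumes "finite I" "k \<in> I" and [measurable]: "F \<in> borel_measurable (cube I)"
  shows "(\<integral>\<^sup>+v. F v \<partial>cube I) = (\<integral>\<^sup>+v. \<integral>\<^sup>+x. F (v(k := x)) \<partial>unit_measure \<partial>cube I)"
    and "(\<integral>\<^sup>+v. F v \<partial>cube I) = (\<integral>\<^sup>+x. \<integral>\<^sup>+v. F (v(k := x)) \<partial>cube I \<partial>unit_measure)"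
proof -
  define J where "J = I - {k}"
  have I: "I = insert k J" "finite J" "k \<notin> J" using assms(1,2) by (auto simp: J_def)
  note [measurable] = \<open>k \<in> I\<close>
  have 1: "(\<integral>\<^sup>+v. F v \<partial>cube I) = (\<integral>\<^sup>+v. \<integral>\<^sup>+x. F (v(k := x)) \<partial>unit_measure \<partial>cube J)"
    using assms(3) unfolding I(1) by (intro unit_product.product_nn_integral_insert I)
  define G where "G v = (\<integral>\<^sup>+x. F (v(k := x)) \<partial>unit_measure)" for v
  have G: "G \<in> borel_measurable (cube I)" unfolding G_def[abs_def] by measurable
  have "(\<integral>\<^sup>+v. G v \<partial>cube I) = (\<integral>\<^sup>+v. \<integral>\<^sup>+x. G (v(k := x)) \<partial>unit_measure \<partial>cube J)"
    using G unfolding I(1) by (intro unit_product.product_nn_integral_insert I)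
  also have "\<dots> = (\<integral>\<^sup>+v. G v \<partial>cube J)"
    by (simp add: G_def unit_measure.emeasure_space_1[simplified])
  finally show 2: "(\<integral>\<^sup>+v. F v \<partial>cube I) = (\<integral>\<^sup>+v. \<integral>\<^sup>+x. F (v(k := x)) \<partial>unit_measure \<partial>cube I)"
    using 1 by (simp add: G_def)
  interpret P: prob_space "cube I" by (rule prob_space_cube)
  interpret pair_sigma_finite unit_measure "cube I"
    by (simp add: pair_sigma_finite_def unit_measure.sigma_finite_measure_axioms P.sigma_finite_measure_axioms)
  have "(\<integral>\<^sup>+v. \<integral>\<^sup>+x. F (v(k := x)) \<partial>unit_measure \<partial>cube I) = (\<integral>\<^sup>+x. \<integral>\<^sup>+v. F (v(k := x)) \<partial>cube I \<partial>unit_measure)"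
    by (rule Fubini') measurable
  with 2 show "(\<integral>\<^sup>+v. F v \<partial>cube I) = (\<integral>\<^sup>+x. \<integral>\<^sup>+v. F (v(k := x)) \<partial>cube I \<partial>unit_measure)" by simp
qed

lemma affine_unit_interval:
  fixes a b x :: real
  assumes "0 \<le> a" "a < b" "b \<le> 1" "0 < x" "x < 1"
  shows "0 < a + (b - a) * x" "a + (b - a) * x < 1" "a < a + (b - a) * x" "a + (b - a) * x < b"
proof -
  have "0 < (b - a) * x" using assms by simp
  moreover have "(b - a) * x < (b - a) * 1" using assms by (intro mult_strict_left_mono) auto
  then have "(b - a) * x < b - a" by simp
  ultimately show "0 < a + (b - a) * x" "a + (b - a) * x < 1" "a < a + (b - a) * x" "a + (b - a) * x < b"
    using assms by linarith+
qed

lemma measurable_affine_unit_measure: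
  assumes "0 \<le> a" "a < b" "b \<le> 1"
  shows "(\<lambda>x. a + (b - a) * x) \<in> measurable unit_measure unit_measure"
  unfolding unit_measure_def using affine_unit_interval[OF assms]
  by (intro measurable_restrict_space3) auto

lemma nn_integral_unit_affine:
  fixes G :: "real \<Rightarrow> ennreal"
  assumes G: "G \<in> borel_measurable unit_measure" and ab: "0 \<le> a" "a < b" "b \<le> 1"
  shows "(\<integral>\<^sup>+x. (if a < x \<and> x < b then G x else 0) \<partial>unit_measure)
    = ennreal (b - a) * (\<integral>\<^sup>+x. G (a + (b - a) * x) \<partial>unit_measure)"
proof -
  have [measurable]: "(\<lambda>x. G x * indicator {0<..<1} x) \<in> borel_measurable borel"
    using G unfolding unit_measure_def by (subst (asm) borel_measurable_restrict_space_iff_ennreal) auto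
  have GA: "(\<lambda>x. G (a + (b - a) * x)) \<in> borel_measurable unit_measure"
    using measurable_compose[OF measurable_affine_unit_measure[OF ab] G] .
  have "(\<lambda>x. G x * indicator {0<..<1} x * indicator {a<..<b} x) \<in> borel_measurable borel"
    by measurable
  have "(\<integral>\<^sup>+x. (if a < x \<and> x < b then G x else 0) \<partial>unit_measure)
      = (\<integral>\<^sup>+x. (G x * indicator {0<..<1} x) * indicator {a<..<b} x \<partial>lborel)"
    unfolding unit_measure_def
    by (subst nn_integral_restrict_space) (auto intro!: nn_integral_cong simp: indicator_def)
  also have "\<dots> = ennreal \<bar>b - a\<bar> * (\<integral>\<^sup>+x. (G (a + (b - a) * x) * indicator {0<..<1} (a + (b - a) * x))
      * indicator {a<..<b} (a + (b - a) * x) \<partial>lborel)"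
    using ab by (subst nn_integral_real_affine[where c = "b - a" and t = a]) auto
  also have "(\<integral>\<^sup>+x. (G (a + (b - a) * x) * indicator {0<..<1} (a + (b - a) * x))
      * indicator {a<..<b} (a + (b - a) * x) \<partial>lborel)
      = (\<integral>\<^sup>+x. G (a + (b - a) * x) * indicator {0<..<1} x \<partial>lborel)"
  proof (rule nn_integral_cong)
    fix x
    have "a < a + (b - a) * x \<longleftrightarrow> 0 < x" using ab by (simp add: zero_less_mult_iff)
    moreover have "(b - a) * x < (b - a) * 1 \<longleftrightarrow> x < 1"
      using ab by (intro mult_less_cancel_left_pos) simp
    then have "a + (b - a) * x < b \<longleftrightarrow> x < 1"
      by (simp only: mult_1_right less_diff_eq add.commute)
    ultimately show "(G (a + (b - a) * x) * indicator {0<..<1} (a + (b - a) * x))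
        * indicator {a<..<b} (a + (b - a) * x) = G (a + (b - a) * x) * indicator {0<..<1} x"
      using ab by (auto simp: indicator_def)
  qed
  also have "\<dots> = (\<integral>\<^sup>+x. G (a + (b - a) * x) \<partial>unit_measure)"
    by (rule nn_integral_unit_measure[OF GA, symmetric])
  finally show ?thesis using ab by simp
qed

lemma measurable_cube_component:
  assumes "k \<in> I"
  shows "(\<lambda>v. v k) \<in> borel_measurable (cube I)"
proof -
  have "(\<lambda>x. x) \<in> borel_measurable unit_measure"
    unfolding unit_measure_def by (intro measurable_restrict_space1) simp
  from measurable_compose[OF measurable_component_singleton[OF assms] this] show ?thesis .
qed

lemma sets_cube_less:
  assumes "i \<in> I" "k \<in> I"
  shows "{v \<in> space (cube I). v i < v k} \<in> sets (cube I)"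
  by (intro borel_measurable_less measurable_cube_component assms)

definition affine_on :: "'i set \<Rightarrow> real \<Rightarrow> real \<Rightarrow> ('i \<Rightarrow> real) \<Rightarrow> 'i \<Rightarrow> real" where
  "affine_on J a b v k = (if k \<in> J then a + (b - a) * v k else v k)"

lemma measurable_affine_on:
  assumes "J \<subseteq> I" "0 \<le> a" "a < b" "b \<le> 1"
  shows "affine_on J a b \<in> measurable (cube I) (cube I)"
  unfolding affine_on_def[abs_def]
proof (rule measurable_PiM_single')
  fix k assume k: "k \<in> I"
  have m: "(\<lambda>v. v k) \<in> measurable (cube I) unit_measure"
    using k by (rule measurable_component_singleton)
  show "(\<lambda>v. if k \<in> J then a + (b - a) * v k else v k) \<in> measurable (cube I) unit_measure"
    using m measurable_compose[OF m measurable_affine_unit_measure[OF assms(2-4)]]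
    by (cases "k \<in> J") auto
next
  show "(\<lambda>v k. if k \<in> J then a + (b - a) * v k else v k) \<in> space (cube I) \<rightarrow> (\<Pi>\<^sub>E k\<in>I. space unit_measure)"
    using affine_unit_interval[OF assms(2-4)] assms(1)
    by (auto simp: space_PiM PiE_iff extensional_def)
qed

text \<open>Given the event, the coordinates in \<open>J\<close> are again independent and uniform,
  on (a,b), and the power of b - a is the probability of the event. The coordinates are rescaled one
  at a time.\<close>

lemma nn_integral_cube_affine:
  assumes "finite I" "J \<subseteq> I" and ab: "0 \<le> a" "a < b" "b \<le> 1"
    and "F \<in> borel_measurable (cube I)"
  shows "(\<integral>\<^sup>+v. (if \<forall>k\<in>J. a < v k \<and> v k < b then F v else 0) \<partial>cube I)
    = ennreal ((b - a) ^ card J) * (\<integral>\<^sup>+v. F (affine_on J a b v) \<partial>cube I)"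
proof -
  have "finite J" using assms finite_subset by blast
  then show ?thesis using assms(2,6)
  proof (induction J arbitrary: F)
    case empty
    then show ?case by (simp add: affine_on_def[abs_def])
  next
    case (insert j J F)
    then have j[measurable]: "j \<in> I" and J: "J \<subseteq> I" and [measurable]: "F \<in> borel_measurable (cube I)" by auto
    have [measurable]: "affine_on J a b \<in> measurable (cube I) (cube I)"
      "affine_on (insert j J) a b \<in> measurable (cube I) (cube I)"
      using insert.prems(1) ab by (auto intro!: measurable_affine_on)
    have [measurable]: "(\<lambda>x. a + (b - a) * x) \<in> measurable unit_measure unit_measure"
      by (rule measurable_affine_unit_measure[OF ab])
    define F' where "F' v = (\<integral>\<^sup>+x. F (v(j := a + (b - a) * x)) \<partial>unit_measure)" for v
    have F'[measurable]: "F' \<in> borel_measurable (cube I)" unfolding F'_def[abs_def] by measurable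
    have fK: "finite (insert j J)" using insert.hyps by simp
    have "(\<lambda>v. if \<forall>k\<in>insert j J. a < v k \<and> v k < b then F v else 0) \<in> borel_measurable (cube I)"
    proof (rule measurable_If)
      have "{v \<in> space (cube I). \<forall>k\<in>insert j J. a < v k \<and> v k < b} =
          space (cube I) \<inter> (\<Inter>k\<in>insert j J. {v \<in> space (cube I). a < v k \<and> v k < b})" by auto
      also have "\<dots> \<in> sets (cube I)"
      proof (intro sets.Int sets.top sets.finite_INT fK)
        fix k assume "k \<in> insert j J"
        then have "(\<lambda>v. v k) \<in> borel_measurable (cube I)"
          using j J by (intro measurable_cube_component) auto
        then show "{v \<in> space (cube I). a < v k \<and> v k < b} \<in> sets (cube I)" by simp
      qed simp
      finally show "{v \<in> space (cube I). \<forall>k\<in>insert j J. a < v k \<and> v k < b} \<in> sets (cube I)" .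
    qed auto
    then have "(\<integral>\<^sup>+v. (if \<forall>k\<in>insert j J. a < v k \<and> v k < b then F v else 0) \<partial>cube I)
        = (\<integral>\<^sup>+v. \<integral>\<^sup>+x. (if \<forall>k\<in>insert j J. a < (v(j := x)) k \<and> (v(j := x)) k < b then F (v(j := x)) else 0)
            \<partial>unit_measure \<partial>cube I)"
      by (rule nn_integral_cube_coord(1)[OF assms(1) j])
    also have "\<dots> = (\<integral>\<^sup>+v. (if \<forall>k\<in>J. a < v k \<and> v k < b then ennreal (b - a) * F' v else 0) \<partial>cube I)"
    proof (rule nn_integral_cong)
      fix v assume v[measurable]: "v \<in> space (cube I)"
      have iff: "(\<forall>k\<in>insert j J. a < (v(j := x)) k \<and> (v(j := x)) k < b)
          \<longleftrightarrow> (\<forall>k\<in>J. a < v k \<and> v k < b) \<and> a < x \<and> x < b" for x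
        using insert.hyps by auto
      have m: "(\<lambda>x. F (v(j := x))) \<in> borel_measurable unit_measure" by measurable
      show "(\<integral>\<^sup>+x. (if \<forall>k\<in>insert j J. a < (v(j := x)) k \<and> (v(j := x)) k < b then F (v(j := x)) else 0)
            \<partial>unit_measure) = (if \<forall>k\<in>J. a < v k \<and> v k < b then ennreal (b - a) * F' v else 0)"
      proof (cases "\<forall>k\<in>J. a < v k \<and> v k < b")
        case True
        then show ?thesis using nn_integral_unit_affine[OF m ab] unfolding iff F'_def by simp
      next
        case False
        show ?thesis unfolding iff by (simp only: False simp_thms if_False nn_integral_const mult_zero_left)
      qed
    qed
    also have "\<dots> = ennreal ((b - a) ^ card J) * (\<integral>\<^sup>+v. ennreal (b - a) * F' (affine_on J a b v) \<partial>cube I)"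
      by (rule insert.IH[OF J]) measurable
    also have "\<dots> = ennreal ((b - a) ^ card (insert j J)) * (\<integral>\<^sup>+v. F' (affine_on J a b v) \<partial>cube I)"
    proof -
      have "(\<lambda>v. F' (affine_on J a b v)) \<in> borel_measurable (cube I)" by measurable
      then show ?thesis
        using insert.hyps ab by (simp add: nn_integral_cmult ennreal_mult'' mult_ac)
    qed
    also have "(\<integral>\<^sup>+v. F' (affine_on J a b v) \<partial>cube I)
        = (\<integral>\<^sup>+v. \<integral>\<^sup>+x. F (affine_on (insert j J) a b (v(j := x))) \<partial>unit_measure \<partial>cube I)"
    proof -
      have "(affine_on J a b v)(j := a + (b - a) * x) = affine_on (insert j J) a b (v(j := x))" for v x
        using insert.hyps by (auto simp: affine_on_def fun_eq_iff)
      then show ?thesis by (simp add: F'_def)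
    qed
    also have "\<dots> = (\<integral>\<^sup>+v. F (affine_on (insert j J) a b v) \<partial>cube I)"
      by (rule nn_integral_cube_coord(1)[OF assms(1) j, symmetric]) measurable
    finally show ?case .
  qed
qed

lemma AE_cube_distinct:
  assumes "finite I"
  shows "AE v in cube I. inj_on v I"
proof -
  have "AE v in cube I. v i \<noteq> v k" if "i \<in> I" "k \<in> I" "i \<noteq> k" for i k
  proof -
    have m: "{v \<in> space (cube I). v i = v k} \<in> sets (cube I)"
      by (intro borel_measurable_eq measurable_cube_component that)
    have "emeasure (cube I) {v \<in> space (cube I). v i = v k}
        = (\<integral>\<^sup>+v. indicator {v \<in> space (cube I). v i = v k} v \<partial>cube I)"
      using m by simp
    also have "\<dots> = (\<integral>\<^sup>+v. \<integral>\<^sup>+x. indicator {v \<in> space (cube I). v i = v k} (v(k := x)) \<partial>unit_measure \<partial>cube I)"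
      using m by (intro nn_integral_cube_coord(1)[OF assms \<open>k \<in> I\<close>]) simp
    also have "\<dots> = (\<integral>\<^sup>+v. 0 \<partial>cube I)"
    proof (rule nn_integral_cong)
      fix v
      have "AE x in unit_measure. x \<noteq> v i"
        unfolding unit_measure_def using AE_lborel_singleton[of "v i"]
        by (subst AE_restrict_space_iff) auto
      then have "AE x in unit_measure. indicator {v \<in> space (cube I). v i = v k} (v(k := x)) = (0 :: ennreal)"
        by eventually_elim (use \<open>i \<noteq> k\<close> in \<open>auto simp: indicator_def\<close>)
      then show "(\<integral>\<^sup>+x. indicator {v \<in> space (cube I). v i = v k} (v(k := x)) \<partial>unit_measure) = 0"
        by (rule nn_integral_zero')
    qed
    finally have "emeasure (cube I) {v \<in> space (cube I). v i = v k} = 0" by simp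
    then show ?thesis using m by (subst AE_iff_measurable[OF m]) auto
  qed
  then have "AE v in cube I. \<forall>i\<in>I. \<forall>k\<in>I. i \<noteq> k \<longrightarrow> v i \<noteq> v k"
    using assms by (intro AE_finite_allI) auto
  then show ?thesis by eventually_elim (auto simp: inj_on_def)
qed

text \<open>Distinct values have exactly one strict minimizer, so exactly one summand equals
  \<open>G\<close>. Applied to \<open>- v\<close> this also locates the maximum.\<close>

lemma sum_unique_min:
  fixes v :: "'i \<Rightarrow> real" and G :: ennreal
  assumes "finite J" "J \<noteq> {}" "inj_on v J"
  shows "(\<Sum>i\<in>J. if \<forall>k\<in>J - {i}. v i < v k then G else 0) = G"
proof -
  have "\<exists>i\<in>J. \<forall>k\<in>J. v i \<le> v k"
    using ex_min_if_finite[of "v ` J"] assms(1,2) by (auto simp: not_less)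
  then obtain i where i: "i \<in> J" "\<And>k. k \<in> J \<Longrightarrow> v i \<le> v k" by blast
  have "(\<forall>k\<in>J - {l}. v l < v k) \<longleftrightarrow> l = i" if "l \<in> J" for l
  proof
    assume "\<forall>k\<in>J - {l}. v l < v k"
    then show "l = i" using i that by (metis Diff_iff not_le singletonD)
  next
    assume "l = i"
    then show "\<forall>k\<in>J - {l}. v l < v k"
      using i assms(3) by (metis Diff_iff inj_on_eq_iff order_le_less singletonI)
  qed
  then have "(\<Sum>l\<in>J. if \<forall>k\<in>J - {l}. v l < v k then G else 0) = (\<Sum>l\<in>J. if l = i then G else 0)"
    by (intro sum.cong) auto
  then show ?thesis using i assms(1) by simp
qed

lemma nn_integral_cube_min:
  assumes "finite I" "J \<subseteq> I" "J \<noteq> {}" and [measurable]: "G \<in> borel_measurable (cube I)"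
  shows "(\<integral>\<^sup>+v. G v \<partial>cube I) = (\<Sum>i\<in>J. \<integral>\<^sup>+v. (if \<forall>k\<in>J - {i}. v i < v k then G v else 0) \<partial>cube I)"
    and "(\<integral>\<^sup>+v. G v \<partial>cube I) = (\<Sum>i\<in>J. \<integral>\<^sup>+v. (if \<forall>k\<in>J - {i}. v k < v i then G v else 0) \<partial>cube I)"
proof -
  have fJ: "finite J" using assms finite_subset by blast
  have m: "(\<lambda>v. if \<forall>k\<in>J - {i}. v i < v k then G v else 0) \<in> borel_measurable (cube I)"
    "(\<lambda>v. if \<forall>k\<in>J - {i}. v k < v i then G v else 0) \<in> borel_measurable (cube I)" if "i \<in> J" for i
  proof -
    have "i \<in> I" using that assms by auto
    note s = sets_cube_less[OF \<open>i \<in> I\<close>] sets_cube_less[OF _ \<open>i \<in> I\<close>]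
    show "(\<lambda>v. if \<forall>k\<in>J - {i}. v i < v k then G v else 0) \<in> borel_measurable (cube I)"
      "(\<lambda>v. if \<forall>k\<in>J - {i}. v k < v i then G v else 0) \<in> borel_measurable (cube I)"
      using s fJ assms(2) by (auto intro!: measurable_If sets.sets_Collect_finite_All)
  qed
  have ae: "AE v in cube I. inj_on v J"
    using AE_cube_distinct[OF assms(1)] by eventually_elim (rule inj_on_subset[OF _ assms(2)])
  have "(\<integral>\<^sup>+v. G v \<partial>cube I) = (\<integral>\<^sup>+v. (\<Sum>i\<in>J. if \<forall>k\<in>J - {i}. v i < v k then G v else 0) \<partial>cube I)"
    by (rule nn_integral_cong_AE, use ae in eventually_elim) (simp only: sum_unique_min[OF fJ assms(3)])
  then show "(\<integral>\<^sup>+v. G v \<partial>cube I) = (\<Sum>i\<in>J. \<integral>\<^sup>+v. (if \<forall>k\<in>J - {i}. v i < v k then G v else 0) \<partial>cube I)"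
    using m by (simp add: nn_integral_sum)
  have "(\<integral>\<^sup>+v. G v \<partial>cube I) = (\<integral>\<^sup>+v. (\<Sum>i\<in>J. if \<forall>k\<in>J - {i}. v k < v i then G v else 0) \<partial>cube I)"
  proof (rule nn_integral_cong_AE, use ae in eventually_elim)
    fix v :: "'a \<Rightarrow> real" assume "inj_on v J"
    then have "inj_on (\<lambda>k. - v k) J" by (simp add: inj_on_def)
    from sum_unique_min[OF fJ assms(3) this, of "G v"]
    show "G v = (\<Sum>i\<in>J. if \<forall>k\<in>J - {i}. v k < v i then G v else 0)" by simp
  qed
  then show "(\<integral>\<^sup>+v. G v \<partial>cube I) = (\<Sum>i\<in>J. \<integral>\<^sup>+v. (if \<forall>k\<in>J - {i}. v k < v i then G v else 0) \<partial>cube I)"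
    using m by (simp add: nn_integral_sum)
qed

section \<open>From the Gaussian measure to the cube\<close>

interpretation lborel_product: product_sigma_finite "\<lambda>_. lborel :: real measure"
  by (simp add: product_sigma_finite_def lborel.sigma_finite_measure_axioms)

text \<open>The coordinates are replaced one at a time by half-normal quantiles; integrating one of
  them out preserves evenness in the others.\<close>

lemma nn_integral_gauss_PiM:
  fixes F :: "('i \<Rightarrow> real) \<Rightarrow> ennreal"
  assumes "finite I" "F \<in> borel_measurable (PiM I (\<lambda>_. lborel))"
    and "\<And>v k x. k \<in> I \<Longrightarrow> F (v(k := - x)) = F (v(k := x))"
  shows "(\<integral>\<^sup>+v. (\<Prod>k\<in>I. ennreal (std_normal_density (v k))) * F v \<partial>PiM I (\<lambda>_. lborel))
    = (\<integral>\<^sup>+v. F (\<lambda>k\<in>I. hn_quantile (v k)) \<partial>cube I)"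
  using assms
proof (induction I arbitrary: F)
  case empty
  then show ?case by (simp add: PiM_empty nn_integral_count_space_finite restrict_def)
next
  case (insert j J F)
  let ?P = "PiM J (\<lambda>_. lborel) :: ('i \<Rightarrow> real) measure"
  note [measurable] = insert.prems(1)
  define F' where "F' v = (\<integral>\<^sup>+y. F (v(j := hn_quantile y)) \<partial>unit_measure)" for v
  have mQ: "hn_quantile \<in> measurable unit_measure lborel" by simp
  have upd: "(\<lambda>(v, y). v(j := y)) \<in> measurable (?P \<Otimes>\<^sub>M lborel) (PiM (insert j J) (\<lambda>_. lborel))"
    by (rule measurable_add_dim)
  have updQ: "(\<lambda>(v, y). v(j := hn_quantile y)) \<in> measurable (?P \<Otimes>\<^sub>M unit_measure) (PiM (insert j J) (\<lambda>_. lborel))"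
    using mQ by (intro measurable_split_conv[THEN iffD2] measurable_fun_upd[of _ J j]) auto
  have m1: "(\<lambda>(v, y). F (v(j := y))) \<in> borel_measurable (?P \<Otimes>\<^sub>M lborel)"
    using measurable_compose[OF upd insert.prems(1)] by (simp add: case_prod_unfold)
  have m2: "(\<lambda>(v, y). F (v(j := hn_quantile y))) \<in> borel_measurable (?P \<Otimes>\<^sub>M unit_measure)"
    using measurable_compose[OF updQ insert.prems(1)] by (simp add: case_prod_unfold)
  have F'm: "F' \<in> borel_measurable ?P"
    unfolding F'_def[abs_def] using m2 by (rule unit_measure.borel_measurable_nn_integral)
  have F'e: "F' (v(k := - x)) = F' (v(k := x))" if "k \<in> J" for v k x
  proof -
    have "k \<noteq> j" using that insert.hyps by auto
    then have tw: "F (v(k := z, j := w)) = F (v(j := w, k := z))" for z w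
      by (metis fun_upd_twist)
    then show ?thesis
      unfolding F'_def by (simp only: tw insert.prems(2)[OF insertI2[OF that]])
  qed
  have "(\<integral>\<^sup>+v. (\<Prod>k\<in>insert j J. ennreal (std_normal_density (v k))) * F v \<partial>PiM (insert j J) (\<lambda>_. lborel))
      = (\<integral>\<^sup>+v. \<integral>\<^sup>+x. (\<Prod>k\<in>insert j J. ennreal (std_normal_density ((v(j := x)) k))) * F (v(j := x)) \<partial>lborel \<partial>?P)"
    using insert.hyps by (intro lborel_product.product_nn_integral_insert) auto
  also have "\<dots> = (\<integral>\<^sup>+v. (\<Prod>k\<in>J. ennreal (std_normal_density (v k))) * F' v \<partial>?P)"
  proof (rule nn_integral_cong)
    fix v assume v: "v \<in> space ?P"
    have G: "(\<lambda>x. F (v(j := x))) \<in> borel_measurable borel"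
      using measurable_Pair2[OF m1 v] by simp
    have "(\<integral>\<^sup>+x. (\<Prod>k\<in>insert j J. ennreal (std_normal_density ((v(j := x)) k))) * F (v(j := x)) \<partial>lborel)
        = (\<integral>\<^sup>+x. (\<Prod>k\<in>J. ennreal (std_normal_density (v k))) *
            (ennreal (std_normal_density x) * F (v(j := x))) \<partial>lborel)"
    proof (rule nn_integral_cong)
      fix x
      have "(\<Prod>k\<in>J. ennreal (std_normal_density ((v(j := x)) k))) = (\<Prod>k\<in>J. ennreal (std_normal_density (v k)))"
        using insert.hyps by (intro prod.cong) auto
      then show "(\<Prod>k\<in>insert j J. ennreal (std_normal_density ((v(j := x)) k))) * F (v(j := x))
          = (\<Prod>k\<in>J. ennreal (std_normal_density (v k))) * (ennreal (std_normal_density x) * F (v(j := x)))"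
        using insert.hyps by (simp add: mult_ac)
    qed
    also have "\<dots> = (\<Prod>k\<in>J. ennreal (std_normal_density (v k))) *
        (\<integral>\<^sup>+x. ennreal (std_normal_density x) * F (v(j := x)) \<partial>lborel)"
      using G by (intro nn_integral_cmult) auto
    also have "(\<integral>\<^sup>+x. ennreal (std_normal_density x) * F (v(j := x)) \<partial>lborel) = F' v"
      unfolding F'_def by (rule nn_integral_even_gauss[OF G insert.prems(2)[OF insertI1]])
    finally show "(\<integral>\<^sup>+x. (\<Prod>k\<in>insert j J. ennreal (std_normal_density ((v(j := x)) k))) * F (v(j := x)) \<partial>lborel)
        = (\<Prod>k\<in>J. ennreal (std_normal_density (v k))) * F' v" .
  qed
  also have "\<dots> = (\<integral>\<^sup>+v. F' (\<lambda>k\<in>J. hn_quantile (v k)) \<partial>cube J)"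
    by (rule insert.IH[OF F'm F'e])
  also have "\<dots> = (\<integral>\<^sup>+v. \<integral>\<^sup>+y. F (\<lambda>k\<in>insert j J. hn_quantile ((v(j := y)) k)) \<partial>unit_measure \<partial>cube J)"
  proof -
    have "(\<lambda>k\<in>J. hn_quantile (v k))(j := hn_quantile y) = (\<lambda>k\<in>insert j J. hn_quantile ((v(j := y)) k))" for v y
      using insert.hyps by (auto simp: restrict_def fun_eq_iff)
    then show ?thesis by (simp add: F'_def)
  qed
  also have "\<dots> = (\<integral>\<^sup>+v. F (\<lambda>k\<in>insert j J. hn_quantile (v k)) \<partial>cube (insert j J))"
  proof (rule unit_product.product_nn_integral_insert[symmetric])
    have "(\<lambda>v. \<lambda>k\<in>insert j J. hn_quantile (v k)) \<in> measurable (cube (insert j J)) (PiM (insert j J) (\<lambda>_. lborel))"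
      using mQ by (intro measurable_restrict measurable_compose[OF measurable_component_singleton]) auto
    then show "(\<lambda>v. F (\<lambda>k\<in>insert j J. hn_quantile (v k))) \<in> borel_measurable (cube (insert j J))"
      using measurable_compose[OF _ insert.prems(1)] by blast
  qed (use insert.hyps in auto)
  finally show ?case .
qed

abbreviation of_coords :: "('a::euclidean_space \<Rightarrow> real) \<Rightarrow> 'a" where
  "of_coords v \<equiv> (\<Sum>b\<in>Basis. v b *\<^sub>R b)"

lemma exp_norm_sq_prod:
  fixes v :: "'a::euclidean_space \<Rightarrow> real"
  shows "exp (- (norm (of_coords v))\<^sup>2 / 2) = sqrt (2 * pi) ^ DIM('a) * (\<Prod>b\<in>Basis. std_normal_density (v b))"
proof -
  have "(norm (of_coords v))\<^sup>2 = (\<Sum>b\<in>Basis. (v b)\<^sup>2)"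
    unfolding power2_norm_eq_inner by (subst euclidean_inner) (simp add: power2_eq_square)
  then have "exp (- (norm (of_coords v))\<^sup>2 / 2) = (\<Prod>b\<in>(Basis :: 'a set). exp (- (v b)\<^sup>2 / 2))"
    by (simp add: exp_sum[symmetric] sum_negf sum_divide_distrib)
  also have "\<dots> = (\<Prod>b\<in>(Basis :: 'a set). sqrt (2 * pi) * std_normal_density (v b))"
    by (intro prod.cong) (simp_all add: std_normal_density_def)
  finally show ?thesis by (simp add: prod.distrib)
qed

lemma nn_integral_gauss_cube:
  fixes f :: "'a::euclidean_space \<Rightarrow> real"
  assumes [measurable]: "f \<in> borel_measurable borel" and nn: "\<And>x. 0 \<le> f x"
    and even: "\<And>x b. b \<in> Basis \<Longrightarrow> f (x - (2 * (x \<bullet> b)) *\<^sub>R b) = f x"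
  shows "(\<integral>\<^sup>+x. ennreal (f x * exp (- (norm x)\<^sup>2 / 2)) \<partial>lborel)
    = ennreal (sqrt (2 * pi) ^ DIM('a)) * (\<integral>\<^sup>+v. ennreal (f (of_coords (\<lambda>b. hn_quantile (v b)))) \<partial>cube Basis)"
proof -
  let ?P = "PiM (Basis :: 'a set) (\<lambda>_. lborel :: real measure)"
  have [measurable]: "(\<lambda>v. of_coords v :: 'a) \<in> borel_measurable ?P" by measurable
  have "(\<integral>\<^sup>+x. ennreal (f x * exp (- (norm x)\<^sup>2 / 2)) \<partial>lborel)
      = (\<integral>\<^sup>+v. ennreal (f (of_coords v) * exp (- (norm (of_coords v :: 'a))\<^sup>2 / 2)) \<partial>?P)"
    by (subst lborel_eq) (simp add: nn_integral_distr)
  also have "\<dots> = (\<integral>\<^sup>+v. ennreal (sqrt (2 * pi) ^ DIM('a)) *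
      ((\<Prod>b\<in>Basis. ennreal (std_normal_density (v b))) * ennreal (f (of_coords v))) \<partial>?P)"
    unfolding exp_norm_sq_prod
    by (intro nn_integral_cong) (simp add: nn prod_ennreal prod_nonneg mult_ac flip: ennreal_mult)
  also have "\<dots> = ennreal (sqrt (2 * pi) ^ DIM('a)) *
      (\<integral>\<^sup>+v. (\<Prod>b\<in>Basis. ennreal (std_normal_density (v b))) * ennreal (f (of_coords v)) \<partial>?P)"
    by (rule nn_integral_cmult) measurable
  also have "(\<integral>\<^sup>+v. (\<Prod>b\<in>Basis. ennreal (std_normal_density (v b))) * ennreal (f (of_coords v)) \<partial>?P)
      = (\<integral>\<^sup>+v. ennreal (f (of_coords (\<lambda>b\<in>Basis. hn_quantile (v b)))) \<partial>cube Basis)"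
  proof (rule nn_integral_gauss_PiM)
    fix v :: "'a \<Rightarrow> real" and k x assume k: "k \<in> (Basis :: 'a set)"
    let ?y = "of_coords (v(k := x)) :: 'a"
    have "?y - (2 * (?y \<bullet> k)) *\<^sub>R k = of_coords (v(k := - x))"
      by (rule euclidean_eqI) (use k in \<open>auto simp: inner_diff_left inner_Basis\<close>)
    then show "ennreal (f (of_coords (v(k := - x)))) = ennreal (f ?y)"
      using even[OF k, of ?y] by simp
  qed (simp_all, measurable)
  also have "\<dots> = (\<integral>\<^sup>+v. ennreal (f (of_coords (\<lambda>b. hn_quantile (v b)))) \<partial>cube Basis)"
    by simp
  finally show ?thesis .
qed

section \<open>Conditioning on the smallest or on the largest coordinate\<close>

lemma measurable_min_event:
  assumes "finite J" "J \<subseteq> I" "i \<in> I"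
  shows "{v \<in> space (cube I). \<forall>k\<in>J. v i < v k} \<in> sets (cube I)"
    "{v \<in> space (cube I). \<forall>k\<in>J. v k < v i} \<in> sets (cube I)"
proof -
  note s = sets_cube_less[OF assms(3)] sets_cube_less[OF _ assms(3)]
  show "{v \<in> space (cube I). \<forall>k\<in>J. v i < v k} \<in> sets (cube I)"
    "{v \<in> space (cube I). \<forall>k\<in>J. v k < v i} \<in> sets (cube I)"
    using s assms(1,2) by (auto intro!: sets.sets_Collect_finite_All)
qed

text \<open>Fix the level \<open>u\<close> of coordinate \<open>i\<close>. Given that the others
  exceed it, they are independent and uniform on (u,1). Since \<open>H\<close> ignores coordinate
  \<open>i\<close>, the level \<open>u\<close> survives in the rescaling only.\<close>

lemma nn_integral_cube_given_min:
  assumes "finite I" "i \<in> I" and [measurable]: "H \<in> borel_measurable (cube I)"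
    and indep: "\<And>v x. H (v(i := x)) = H v"
  shows "(\<integral>\<^sup>+v. (if \<forall>k\<in>I - {i}. v i < v k then H v else 0) \<partial>cube I)
    = (\<integral>\<^sup>+u. ennreal ((1 - u) ^ card (I - {i})) * (\<integral>\<^sup>+v. H (affine_on (I - {i}) u 1 v) \<partial>cube I) \<partial>unit_measure)"
proof -
  have "(\<lambda>v. if \<forall>k\<in>I - {i}. v i < v k then H v else 0) \<in> borel_measurable (cube I)"
    using assms(1,2,3) by (intro measurable_If measurable_min_event) auto
  then have "(\<integral>\<^sup>+v. (if \<forall>k\<in>I - {i}. v i < v k then H v else 0) \<partial>cube I)
      = (\<integral>\<^sup>+u. \<integral>\<^sup>+v. (if \<forall>k\<in>I - {i}. (v(i := u)) i < (v(i := u)) k then H (v(i := u)) else 0) \<partial>cube I \<partial>unit_measure)"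
    by (rule nn_integral_cube_coord(2)[OF assms(1,2)])
  also have "\<dots> = (\<integral>\<^sup>+u. ennreal ((1 - u) ^ card (I - {i})) * (\<integral>\<^sup>+v. H (affine_on (I - {i}) u 1 v) \<partial>cube I) \<partial>unit_measure)"
  proof (rule nn_integral_cong)
    fix u assume u: "u \<in> space unit_measure"
    have "(\<integral>\<^sup>+v. (if \<forall>k\<in>I - {i}. (v(i := u)) i < (v(i := u)) k then H (v(i := u)) else 0) \<partial>cube I)
        = (\<integral>\<^sup>+v. (if \<forall>k\<in>I - {i}. u < v k \<and> v k < 1 then H v else 0) \<partial>cube I)"
      by (intro nn_integral_cong) (auto simp: space_cube_iff indep)
    also have "\<dots> = ennreal ((1 - u) ^ card (I - {i})) * (\<integral>\<^sup>+v. H (affine_on (I - {i}) u 1 v) \<partial>cube I)"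
      using u assms(1,2,3) by (intro nn_integral_cube_affine) auto
    finally show "(\<integral>\<^sup>+v. (if \<forall>k\<in>I - {i}. (v(i := u)) i < (v(i := u)) k then H (v(i := u)) else 0) \<partial>cube I)
        = ennreal ((1 - u) ^ card (I - {i})) * (\<integral>\<^sup>+v. H (affine_on (I - {i}) u 1 v) \<partial>cube I)" .
  qed
  finally show ?thesis .
qed

text \<open>The counterpart at the top, where \<open>H\<close> may depend on coordinate
  \<open>j\<close>, which is therefore kept at its level \<open>p\<close>. Coordinates outside
  \<open>J\<close> other than \<open>j\<close> are not rescaled.\<close>

lemma nn_integral_cube_given_max:
  assumes "finite I" "J \<subseteq> I" "j \<in> I" "j \<notin> J" and [measurable]: "H \<in> borel_measurable (cube I)"
  shows "(\<integral>\<^sup>+v. (if \<forall>k\<in>J. v k < v j then H v else 0) \<partial>cube I)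
    = (\<integral>\<^sup>+p. ennreal (p ^ card J) * (\<integral>\<^sup>+v. H ((affine_on J 0 p v)(j := p)) \<partial>cube I) \<partial>unit_measure)"
proof -
  have fJ: "finite J" using assms finite_subset by blast
  have "(\<lambda>v. if \<forall>k\<in>J. v k < v j then H v else 0) \<in> borel_measurable (cube I)"
    using assms fJ by (intro measurable_If measurable_min_event) auto
  then have "(\<integral>\<^sup>+v. (if \<forall>k\<in>J. v k < v j then H v else 0) \<partial>cube I)
      = (\<integral>\<^sup>+p. \<integral>\<^sup>+v. (if \<forall>k\<in>J. (v(j := p)) k < (v(j := p)) j then H (v(j := p)) else 0) \<partial>cube I \<partial>unit_measure)"
    using assms by (intro nn_integral_cube_coord(2)) auto
  also have "\<dots> = (\<integral>\<^sup>+p. ennreal (p ^ card J) * (\<integral>\<^sup>+v. H ((affine_on J 0 p v)(j := p)) \<partial>cube I) \<partial>unit_measure)"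
  proof (rule nn_integral_cong)
    fix p assume p: "p \<in> space unit_measure"
    note [measurable] = assms(3)
    have [measurable]: "(\<lambda>v. H (v(j := p))) \<in> borel_measurable (cube I)"
      using p by measurable
    have iff: "(\<forall>k\<in>J. (v(j := p)) k < (v(j := p)) j) \<longleftrightarrow> (\<forall>k\<in>J. 0 < v k \<and> v k < p)"
      if "v \<in> space (cube I)" for v
      using that assms(2,4) by (auto simp: space_cube_iff)
    have "(\<integral>\<^sup>+v. (if \<forall>k\<in>J. (v(j := p)) k < (v(j := p)) j then H (v(j := p)) else 0) \<partial>cube I)
        = (\<integral>\<^sup>+v. (if \<forall>k\<in>J. 0 < v k \<and> v k < p then H (v(j := p)) else 0) \<partial>cube I)"
      by (intro nn_integral_cong) (simp only: iff)
    also have "\<dots> = ennreal ((p - 0) ^ card J) * (\<integral>\<^sup>+v. H ((affine_on J 0 p v)(j := p)) \<partial>cube I)"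
      using p assms by (intro nn_integral_cube_affine) auto
    finally show "(\<integral>\<^sup>+v. (if \<forall>k\<in>J. (v(j := p)) k < (v(j := p)) j then H (v(j := p)) else 0) \<partial>cube I)
        = ennreal (p ^ card J) * (\<integral>\<^sup>+v. H ((affine_on J 0 p v)(j := p)) \<partial>cube I)" by simp
  qed
  finally show ?thesis .
qed

text \<open>A box of positive volume meets every set of full measure. This evaluates
  almost-everywhere identities close to prescribed points.\<close>

lemma AE_cube_box_witness:
  assumes "finite I" "AE v in cube I. P v" "0 \<le> a" "a < b" "b \<le> 1"
  shows "\<exists>v\<in>space (cube I). P v \<and> (\<forall>k\<in>I. a < v k \<and> v k < b)"
proof (rule ccontr)
  interpret P: prob_space "cube I" by (rule prob_space_cube)
  assume none: "\<not> ?thesis"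
  have "AE v in cube I. \<not> (\<forall>k\<in>I. a < v k \<and> v k < b)"
    using assms(2) AE_space by eventually_elim (use none in blast)
  then have "AE v in cube I. (if \<forall>k\<in>I. a < v k \<and> v k < b then 1 else 0 :: ennreal) = 0"
    by eventually_elim (simp only: if_False)
  then have "(\<integral>\<^sup>+v. (if \<forall>k\<in>I. a < v k \<and> v k < b then 1 else 0 :: ennreal) \<partial>cube I) = 0"
    by (rule nn_integral_zero')
  moreover have "(\<integral>\<^sup>+v. (if \<forall>k\<in>I. a < v k \<and> v k < b then 1 else 0 :: ennreal) \<partial>cube I)
      = ennreal ((b - a) ^ card I)"
    using nn_integral_cube_affine[OF assms(1) order_refl assms(3-5), of "\<lambda>_. 1"] P.emeasure_space_1
    by simp
  ultimately show False using assms(4) by simp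
qed

lemma AE_unit_measure_witness:
  assumes "AE x in unit_measure. P x" "0 \<le> a" "a < b" "b \<le> 1"
  shows "\<exists>x. P x \<and> a < x \<and> x < b"
proof (rule ccontr)
  assume none: "\<not> ?thesis"
  have "AE x in unit_measure. \<not> (a < x \<and> x < b)"
    using assms(1) by eventually_elim (use none in blast)
  then have "AE x in unit_measure. (if a < x \<and> x < b then 1 else 0 :: ennreal) = 0"
    by eventually_elim (simp only: if_False)
  then have "(\<integral>\<^sup>+x. (if a < x \<and> x < b then 1 else 0 :: ennreal) \<partial>unit_measure) = 0"
    by (rule nn_integral_zero')
  moreover have "(\<integral>\<^sup>+x. (if a < x \<and> x < b then 1 else 0 :: ennreal) \<partial>unit_measure) = ennreal (b - a)"
    using nn_integral_unit_affine[of "\<lambda>_. 1" a b] assms unit_measure.emeasure_space_1 by simp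
  ultimately show False using assms(3) by simp
qed

text \<open>Let \<open>m\<close> be the mean of \<open>X\<close> for the weight \<open>w\<close>.
  Since \<open>X\<close> decreases, X - m changes sign at one point \<open>c\<close> from plus to
  minus, as does r - r(c), so their product is nonnegative. As w (X - m) has integral 0, subtracting
  r(c) from \<open>r\<close> is free. In the equality case the product vanishes almost everywhere,
  and r differs from r(c) off \<open>c\<close>.\<close>

lemma chebyshev_unit_measure:
  fixes w r X :: "real \<Rightarrow> real"
  assumes w: "\<And>p. 0 < p \<Longrightarrow> p < 1 \<Longrightarrow> 0 < w p"
    and r: "\<And>p q. 0 < p \<Longrightarrow> p < q \<Longrightarrow> q < 1 \<Longrightarrow> r q < r p"
    and X: "\<And>p q. 0 < p \<Longrightarrow> p \<le> q \<Longrightarrow> q < 1 \<Longrightarrow> X q \<le> X p"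
    and i: "integrable unit_measure w" "integrable unit_measure (\<lambda>p. w p * r p)"
      "integrable unit_measure (\<lambda>p. w p * X p)" "integrable unit_measure (\<lambda>p. w p * r p * X p)"
  shows "(\<integral>p. w p * r p \<partial>unit_measure) * (\<integral>p. w p * X p \<partial>unit_measure)
      \<le> (\<integral>p. w p * r p * X p \<partial>unit_measure) * (\<integral>p. w p \<partial>unit_measure)" (is "?le")
    and "(\<integral>p. w p * r p \<partial>unit_measure) * (\<integral>p. w p * X p \<partial>unit_measure)
      = (\<integral>p. w p * r p * X p \<partial>unit_measure) * (\<integral>p. w p \<partial>unit_measure)
      \<Longrightarrow> 0 < p \<Longrightarrow> p < 1 \<Longrightarrow> 0 < q \<Longrightarrow> q < 1 \<Longrightarrow> X p = X q"
proof -
  let ?U = unit_measure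
  define W where "W = (\<integral>p. w p \<partial>?U)"
  have zero: "AE p in ?U. h p = 0" if "integrable ?U h" "(\<integral>p. h p \<partial>?U) = 0"
    "\<And>p. 0 < p \<Longrightarrow> p < 1 \<Longrightarrow> 0 \<le> h p" for h :: "real \<Rightarrow> real"
  proof -
    have "AE p in ?U. 0 \<le> h p" using that(3) by (intro AE_I2) auto
    then show ?thesis using integral_nonneg_eq_0_iff_AE[OF that(1)] that(2) by blast
  qed
  have Wpos: "W > 0"
  proof (rule ccontr)
    assume "\<not> W > 0"
    moreover have "W \<ge> 0" unfolding W_def
      using w by (intro Bochner_Integration.integral_nonneg_AE AE_I2) (auto intro: less_imp_le)
    ultimately have "AE p in ?U. w p = 0"
      using w by (intro zero i) (auto simp: W_def intro: less_imp_le)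
    then show False using AE_unit_measure_witness[of "\<lambda>p. w p = 0" 0 1] w by force
  qed
  define m where "m = (\<integral>p. w p * X p \<partial>?U) / W"
  have centered: "integrable ?U (\<lambda>p. w p * (X p - m))" "(\<integral>p. w p * (X p - m) \<partial>?U) = 0"
    using i Wpos by (simp_all add: right_diff_distrib m_def W_def[symmetric])
  \<comment> \<open>\<open>D\<close> is the integral of w r (X - m), and \<open>W * D\<close> is the
    difference of the two sides of the inequality.\<close>
  define D where "D = (\<integral>p. w p * r p * X p \<partial>?U) - m * (\<integral>p. w p * r p \<partial>?U)"
  have "0 \<le> D \<and> (D = 0 \<longrightarrow> (AE p in ?U. X p = m))"
  \<comment> \<open>If X - m keeps one sign, its vanishing weighted integral forces X = m almost
    everywhere; otherwise there is a crossing point inside the interval.\<close>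
  proof (cases "(\<forall>p. 0 < p \<and> p < 1 \<longrightarrow> X p \<le> m) \<or> (\<forall>p. 0 < p \<and> p < 1 \<longrightarrow> m \<le> X p)")
    case True
    have "AE p in ?U. w p * (X p - m) = 0"
      using True
    proof
      assume *: "\<forall>p. 0 < p \<and> p < 1 \<longrightarrow> X p \<le> m"
      have "0 \<le> - (w p * (X p - m))" if "0 < p" "p < 1" for p
        using w[OF that] * that by (simp add: mult_nonneg_nonpos)
      then have "AE p in ?U. - (w p * (X p - m)) = 0"
        using centered by (intro zero) auto
      then show ?thesis by simp
    next
      assume *: "\<forall>p. 0 < p \<and> p < 1 \<longrightarrow> m \<le> X p"
      have "0 \<le> w p * (X p - m)" if "0 < p" "p < 1" for p
        using w[OF that] * that by simp
      then show ?thesis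
        using centered by (intro zero) auto
    qed
    then have Xm: "AE p in ?U. X p = m"
      using AE_space by eventually_elim (use w in force)
    have "(\<integral>p. w p * r p * X p \<partial>?U) = (\<integral>p. w p * r p * m \<partial>?U)"
      using Xm by (intro integral_cong_AE borel_measurable_integrable i integrable_mult_left)
        (auto elim: eventually_mono)
    then show ?thesis using Xm by (simp add: D_def)
  next
    case False
    then obtain a b where a: "0 < a" "a < 1" "X a > m" and b: "0 < b" "b < 1" "X b < m"
      by (auto simp: not_le)
    have "a < b" using X[of b a] a b by (cases "a < b") auto
    define c where "c = Sup {p. 0 < p \<and> p < 1 \<and> m \<le> X p}"
    have ub: "p \<le> b" if "0 < p" "p < 1" "m \<le> X p" for p
      using X[of b p] that b by (cases "p \<le> b") auto
    have bdd: "bdd_above {p. 0 < p \<and> p < 1 \<and> m \<le> X p}" by (intro bdd_aboveI[of _ 1]) auto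
    have c: "0 < c" "c < 1"
    proof -
      have "a \<le> c" unfolding c_def using a bdd by (intro cSup_upper) auto
      then show "0 < c" using a by simp
      have "c \<le> b" unfolding c_def using a ub by (intro cSup_least) auto
      then show "c < 1" using b by simp
    qed
    have left: "m \<le> X p" if "0 < p" "p < c" for p
    proof -
      have "a \<in> {p. 0 < p \<and> p < 1 \<and> m \<le> X p}" using a by simp
      then have "{p. 0 < p \<and> p < 1 \<and> m \<le> X p} \<noteq> {}" by blast
      then have "\<exists>q\<in>{p. 0 < p \<and> p < 1 \<and> m \<le> X p}. p < q"
        using that(2) unfolding c_def by (rule less_cSupD)
      then obtain q where q: "0 < q" "q < 1" "m \<le> X q" "p < q" by auto
      then show ?thesis using X[of p q] that by simp
    qed
    have right: "X p < m" if "c < p" "p < 1" for p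
    proof (rule ccontr)
      assume "\<not> X p < m"
      then have "p \<le> c" unfolding c_def using that c bdd by (intro cSup_upper) auto
      then show False using that by simp
    qed
    have prod: "0 \<le> (r p - r c) * (X p - m)" if p: "0 < p" "p < 1" for p
    proof -
      consider "p < c" | "p = c" | "c < p" by linarith
      then show ?thesis
      proof cases
        case 1
        then show ?thesis using r[of p c] left[of p] p c by simp
      next
        case 3
        then show ?thesis using r[of c p] right[of p] p c by (simp add: mult_nonpos_nonpos)
      qed simp
    qed
    let ?h = "\<lambda>p. w p * ((r p - r c) * (X p - m))"
    have eq: "?h p = w p * r p * X p - m * (w p * r p) - r c * (w p * (X p - m))" for p
      by (simp add: algebra_simps)
    have ih: "integrable ?U ?h" unfolding eq using i centered by simp
    have int: "(\<integral>p. ?h p \<partial>?U) = D"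
      unfolding eq D_def using i centered by simp
    have nn: "0 \<le> ?h p" if "0 < p" "p < 1" for p
      using prod[OF that] w[OF that] by simp
    have "0 \<le> D" unfolding int[symmetric]
      using nn by (intro Bochner_Integration.integral_nonneg_AE AE_I2) auto
    moreover have "AE p in ?U. X p = m" if "D = 0"
    proof -
      have "AE p in ?U. ?h p = 0" using ih int that nn by (intro zero) auto
      moreover have "AE p in ?U. p \<noteq> c"
        unfolding unit_measure_def using AE_lborel_singleton[of c] by (subst AE_restrict_space_iff) auto
      ultimately show ?thesis using AE_space
      proof eventually_elim
        case (elim p)
        then have p: "0 < p" "p < 1" by auto
        have "r p \<noteq> r c" using r[of p c] r[of c p] p c \<open>p \<noteq> c\<close> by (cases "p < c") auto
        then show ?case using elim w[OF p] by auto
      qed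
    qed
    ultimately show ?thesis by blast
  qed
  then have D: "0 \<le> D" "D = 0 \<Longrightarrow> AE p in ?U. X p = m" by auto
  have WD: "W * D = (\<integral>p. w p * r p * X p \<partial>?U) * W - (\<integral>p. w p * r p \<partial>?U) * (\<integral>p. w p * X p \<partial>?U)"
    using Wpos by (simp add: D_def m_def algebra_simps)
  have "0 \<le> W * D" using D(1) Wpos by simp
  then show ?le unfolding WD by (simp add: W_def)
  assume eq: "(\<integral>p. w p * r p \<partial>?U) * (\<integral>p. w p * X p \<partial>?U) = (\<integral>p. w p * r p * X p \<partial>?U) * (\<integral>p. w p \<partial>?U)"
    and p: "0 < p" "p < 1" and q: "0 < q" "q < 1"
  have "W * D = 0" unfolding WD using eq by (simp add: W_def)
  then have Xm: "AE p in ?U. X p = m" using D(2) Wpos by simp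
  \<comment> \<open>Almost everywhere becomes everywhere: \<open>x\<close> is squeezed between
    points y < x < z where \<open>X\<close> equals \<open>m\<close>, and \<open>X\<close> is
    monotone.\<close>
  have "X x = m" if "0 < x" "x < 1" for x
  proof -
    obtain y where y: "X y = m" "0 < y" "y < x"
      using AE_unit_measure_witness[OF Xm, of 0 x] \<open>0 < x\<close> \<open>x < 1\<close> by auto
    obtain z where z: "X z = m" "x < z" "z < 1"
      using AE_unit_measure_witness[OF Xm, of x 1] \<open>0 < x\<close> \<open>x < 1\<close> by auto
    show ?thesis using X[of y x] X[of x z] y z that by simp
  qed
  then show "X p = X q" using p q by simp
qed

subsection \<open>Functions increasing in each coordinate\<close>

lemma measurable_into_unit_measure:
  assumes "f \<in> borel_measurable M" "\<And>x. x \<in> space M \<Longrightarrow> 0 < f x \<and> f x < 1"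
  shows "f \<in> measurable M unit_measure"
  unfolding unit_measure_def using assms by (intro measurable_restrict_space2) auto

lemma measurable_quantile_comp:
  assumes "f \<in> borel_measurable M" "\<And>x. x \<in> space M \<Longrightarrow> 0 < f x \<and> f x < 1"
  shows "(\<lambda>x. hn_quantile (f x)) \<in> borel_measurable M"
  using measurable_compose[OF measurable_into_unit_measure[OF assms] measurable_hn_quantile] .

lemma unit_borel [measurable]: "(\<lambda>x. x) \<in> borel_measurable unit_measure"
  unfolding unit_measure_def by (intro measurable_restrict_space1) simp

text \<open>
  The factor \<open>(1 - u) ^ N\<close> is the probability that the other \<open>N\<close> coordinates exceed the smallest one,
  \<open>u\<close>; the point at relative height \<open>p\<close> in \<open>{u<..<1}\<close> is \<open>u + (1 - u) * p\<close>.
\<close>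
definition tail_weight :: "nat \<Rightarrow> real \<Rightarrow> real" where
  "tail_weight N p = (\<integral>u. (1 - u) ^ N * hn_quantile (u + (1 - u) * p) \<partial>unit_measure)"

lemma shift_unit:
  fixes u p :: real
  assumes "0 \<le> u" "u < 1" "0 < p" "p < 1"
  shows "0 < u + (1 - u) * p" "u + (1 - u) * p < 1" "p \<le> u + (1 - u) * p"
proof -
  have "0 < (1 - u) * p" "0 < (1 - u) * (1 - p)" "0 \<le> u * (1 - p)" using assms by auto
  then show "0 < u + (1 - u) * p" "u + (1 - u) * p < 1" "p \<le> u + (1 - u) * p"
    using assms by (auto simp: algebra_simps)
qed

text \<open>Since u + (1 - u) p = p + (1 - p) u, the integral over \<open>u\<close> is, up to the
  factor 1 - p, at most the integral of the quantile function over (p,1).\<close>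

lemma tail_weight_integrable:
  assumes p: "0 < p" "p < 1"
  shows "integrable unit_measure (\<lambda>u. (1 - u) ^ N * hn_quantile (u + (1 - u) * p))"
proof (rule integrableI_nonneg)
  show "(\<lambda>u. (1 - u) ^ N * hn_quantile (u + (1 - u) * p)) \<in> borel_measurable unit_measure"
    using p shift_unit by (intro borel_measurable_times measurable_quantile_comp) auto
  have q: "0 \<le> hn_quantile (u + (1 - u) * p)" if "0 < u" "u < 1" for u
    using shift_unit[of u p] that p by (intro less_imp_le hn_quantile_pos) auto
  then show "AE u in unit_measure. 0 \<le> (1 - u) ^ N * hn_quantile (u + (1 - u) * p)"
    by (intro AE_I2) simp
  let ?Q = "\<lambda>x. ennreal (hn_quantile x)"
  have fin: "(\<integral>\<^sup>+x. ?Q x \<partial>unit_measure) < \<infinity>"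
    using hn_quantile_integrable hn_quantile_pos
    by (subst nn_integral_eq_integral) (auto intro!: AE_I2 less_imp_le)
  have "ennreal (1 - p) * (\<integral>\<^sup>+u. ?Q (p + (1 - p) * u) \<partial>unit_measure)
      = (\<integral>\<^sup>+x. (if p < x \<and> x < 1 then ?Q x else 0) \<partial>unit_measure)"
    using p by (intro nn_integral_unit_affine[symmetric]) auto
  also have "\<dots> \<le> (\<integral>\<^sup>+x. ?Q x \<partial>unit_measure)" by (intro nn_integral_mono) auto
  finally have "ennreal (1 - p) * (\<integral>\<^sup>+u. ?Q (p + (1 - p) * u) \<partial>unit_measure) < \<infinity>"
    using fin by (rule le_less_trans)
  then have "(\<integral>\<^sup>+u. ?Q (p + (1 - p) * u) \<partial>unit_measure) < \<infinity>"
    using p by (auto simp: ennreal_mult_less_top)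
  moreover have "(\<integral>\<^sup>+u. ennreal ((1 - u) ^ N * hn_quantile (u + (1 - u) * p)) \<partial>unit_measure)
      \<le> (\<integral>\<^sup>+u. ?Q (p + (1 - p) * u) \<partial>unit_measure)"
  proof (rule nn_integral_mono)
    fix u assume u: "u \<in> space unit_measure"
    have "u + (1 - u) * p = p + (1 - p) * u" by (simp add: algebra_simps)
    moreover have "(1 - u) ^ N \<le> 1" using u by (intro power_le_one) auto
    ultimately show "ennreal ((1 - u) ^ N * hn_quantile (u + (1 - u) * p)) \<le> ?Q (p + (1 - p) * u)"
      using q[of u] u by (intro ennreal_leI) (auto intro: mult_left_le_one_le)
  qed
  ultimately show "(\<integral>\<^sup>+u. ennreal ((1 - u) ^ N * hn_quantile (u + (1 - u) * p)) \<partial>unit_measure) < \<infinity>"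
    by (rule le_less_trans[rotated])
qed

lemma tail_weight_nn_integral:
  assumes "0 < p" "p < 1"
  shows "(\<integral>\<^sup>+u. ennreal ((1 - u) ^ N * hn_quantile (u + (1 - u) * p)) \<partial>unit_measure) = ennreal (tail_weight N p)"
  unfolding tail_weight_def using tail_weight_integrable[OF assms] shift_unit[of _ p] assms
  by (intro nn_integral_eq_integral) (auto intro!: AE_I2 mult_nonneg_nonneg less_imp_le[OF hn_quantile_pos])

lemma tail_weight_ratio_strict_antimono:
  assumes "0 < p" "p < q" "q < 1"
  shows "tail_weight N q / hn_quantile q < tail_weight N p / hn_quantile p"
proof -
  let ?h = "\<lambda>p u. (1 - u) ^ N * hn_quantile (u + (1 - u) * p) / hn_quantile p"
  have i: "integrable unit_measure (?h p)" "integrable unit_measure (?h q)"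
    using assms by (auto intro!: integrable_divide tail_weight_integrable)
  have lt: "?h q u < ?h p u" if "u \<in> space unit_measure" for u
    using mult_strict_left_mono[OF hn_quantile_shifted_ratio[OF assms, of u], of "(1 - u) ^ N"] that
    by simp
  have "(\<integral>u. ?h q u \<partial>unit_measure) < (\<integral>u. ?h p u \<partial>unit_measure)"
  proof (rule unit_measure.integral_less_AE_space[OF i(2,1)])
    show "AE u in unit_measure. ?h q u < ?h p u" using lt by (rule AE_I2)
    show "emeasure unit_measure (space unit_measure) \<noteq> 0" using unit_measure.emeasure_space_1 by simp
  qed
  then show ?thesis by (simp add: tail_weight_def)
qed

text \<open>These are the properties of the averaged support function on which the comparison rests.
  Dimension at least 2 guarantees that a largest coordinate remains after one has been
  dropped.\<close>

locale coordinate_gauge =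
  fixes f :: "'a::euclidean_space \<Rightarrow> real"
  assumes f_meas: "f \<in> borel_measurable borel"
    and f_scale: "\<And>c x. c \<ge> 0 \<Longrightarrow> f (c *\<^sub>R x) = c * f x"
    and f_mono: "\<And>x y. (\<And>b. b \<in> Basis \<Longrightarrow> 0 \<le> x \<bullet> b) \<Longrightarrow> (\<And>b. b \<in> Basis \<Longrightarrow> x \<bullet> b \<le> y \<bullet> b) \<Longrightarrow> f x \<le> f y"
    and f_add: "\<And>x y. f (x + y) \<le> f x + f y"
    and dim: "DIM('a) \<ge> 2"
begin

abbreviation g :: "('a \<Rightarrow> real) \<Rightarrow> real" where
  "g v \<equiv> f (of_coords v)"

lemma g_mono: "(\<And>b. b \<in> Basis \<Longrightarrow> 0 \<le> v b) \<Longrightarrow> (\<And>b. b \<in> Basis \<Longrightarrow> v b \<le> w b) \<Longrightarrow> g v \<le> g w"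
  by (rule f_mono) simp_all

lemma g_scale: "c \<ge> 0 \<Longrightarrow> g (\<lambda>b. c * v b) = c * g v"
  using f_scale[of c "of_coords v"] by (simp add: scaleR_sum_right)

lemma f_zero: "f 0 = 0"
  using f_scale[of 0 0] by simp

lemma g_nonneg: "(\<And>b. b \<in> Basis \<Longrightarrow> 0 \<le> v b) \<Longrightarrow> 0 \<le> g v"
  using g_mono[of "\<lambda>_. 0" v] f_zero by simp

lemma f_Basis: "b \<in> Basis \<Longrightarrow> f b = g (\<lambda>k. if k = b then 1 else 0)"
  by (simp add: if_distrib[of "\<lambda>c. c *\<^sub>R _"] cong: if_cong)

lemma f_Basis_nonneg: "b \<in> Basis \<Longrightarrow> 0 \<le> f b"
  unfolding f_Basis by (rule g_nonneg) simp

lemma g_le_sum: "(\<And>b. b \<in> Basis \<Longrightarrow> 0 \<le> v b) \<Longrightarrow> g v \<le> (\<Sum>b\<in>Basis. v b * f b)"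
proof -
  assume v: "\<And>b. b \<in> Basis \<Longrightarrow> 0 \<le> v b"
  have "finite S \<Longrightarrow> f (\<Sum>b\<in>S. v b *\<^sub>R b) \<le> (\<Sum>b\<in>S. f (v b *\<^sub>R b))" for S
  proof (induction S rule: finite_induct)
    case (insert b S)
    then show ?case using f_add[of "v b *\<^sub>R b" "\<Sum>b\<in>S. v b *\<^sub>R b"] by simp
  qed (simp add: f_zero)
  from this[OF finite_Basis] show ?thesis using v by (simp add: f_scale)
qed

lemma g_meas:
  "(\<And>b. b \<in> Basis \<Longrightarrow> (\<lambda>x. h x b) \<in> borel_measurable M) \<Longrightarrow> (\<lambda>x. g (h x)) \<in> borel_measurable M"
  by (rule measurable_compose[OF _ f_meas]) (auto intro!: borel_measurable_sum borel_measurable_scaleR)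

definition slice :: "'a \<Rightarrow> ('a \<Rightarrow> real) \<Rightarrow> real" where
  "slice i v = g (\<lambda>b. if b = i then 0 else hn_quantile (v b))"

text \<open>
  Here \<open>i\<close> is the coordinate that is dropped, \<open>j\<close> the largest of the others, at level \<open>p\<close>, and
  the remaining ones are \<open>p * v b\<close>; dividing by \<open>hn_quantile p\<close> makes the largest entry 1.
\<close>
definition shape :: "'a \<Rightarrow> 'a \<Rightarrow> real \<Rightarrow> ('a \<Rightarrow> real) \<Rightarrow> 'a \<Rightarrow> real" where
  "shape i j p v b = (if b = i then 0 else if b = j then 1 else hn_quantile (p * v b) / hn_quantile p)"

text \<open>The share of the pair (i, j) in the function X of the overview, which is
  \<open>shape_sum\<close> below. All entries of a shape lie in [0,1], so the mean is bounded
  uniformly in \<open>p\<close>.\<close>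

definition shape_mean :: "'a \<Rightarrow> 'a \<Rightarrow> real \<Rightarrow> real" where
  "shape_mean i j p = (\<integral>v. g (shape i j p v) \<partial>cube Basis)"

lemma quantile_coord_meas: "b \<in> Basis \<Longrightarrow> (\<lambda>v. hn_quantile (v b)) \<in> borel_measurable (cube Basis)"
  by (rule measurable_compose[OF measurable_component_singleton[where M = "\<lambda>_. unit_measure"] measurable_hn_quantile])

lemma slice_meas: "slice i \<in> borel_measurable (cube Basis)"
  unfolding slice_def[abs_def]
proof (rule g_meas)
  fix b :: 'a assume "b \<in> Basis"
  then show "(\<lambda>v. if b = i then 0 else hn_quantile (v b)) \<in> borel_measurable (cube Basis)"
    using quantile_coord_meas[of b] by (cases "b = i") auto
qed

lemma pv_unit:
  assumes "p \<in> space unit_measure" "v \<in> space (cube Basis)" "b \<in> (Basis :: 'a set)"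
  shows "0 < p * v b" "p * v b < p" "p * v b < 1"
proof -
  have "0 < v b" "v b < 1" "0 < p" "p < 1" using assms by (auto simp: space_cube_iff)
  then show "0 < p * v b" "p * v b < p" by auto
  then show "p * v b < 1" using \<open>p < 1\<close> by linarith
qed

lemma shape_bounds:
  assumes "p \<in> space unit_measure" "v \<in> space (cube Basis)" "b \<in> Basis"
  shows "0 \<le> shape i j p v b" "shape i j p v b \<le> 1"
proof -
  have p: "0 < hn_quantile p" using assms by (auto intro: hn_quantile_pos)
  have "hn_quantile (p * v b) < hn_quantile p" "0 < hn_quantile (p * v b)"
    using pv_unit[OF assms] assms by (auto intro!: hn_quantile_strict_mono hn_quantile_pos)
  with p show "0 \<le> shape i j p v b" "shape i j p v b \<le> 1" by (auto simp: shape_def)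
qed

lemma shape_joint_meas:
  "(\<lambda>(p, v). g (shape i j p v)) \<in> borel_measurable (unit_measure \<Otimes>\<^sub>M cube Basis)"
  unfolding case_prod_unfold
proof (rule g_meas)
  fix b :: 'a assume b: "b \<in> Basis"
  let ?M = "unit_measure \<Otimes>\<^sub>M cube (Basis :: 'a set)"
  have 1: "(\<lambda>z. fst z) \<in> borel_measurable ?M"
    by (rule measurable_compose[OF measurable_fst unit_borel])
  have 2: "(\<lambda>z. snd z b) \<in> borel_measurable ?M"
    by (rule measurable_compose[OF measurable_snd measurable_cube_component[OF b]])
  have "(\<lambda>z. hn_quantile (fst z * snd z b)) \<in> borel_measurable ?M"
    using 1 2 pv_unit[OF _ _ b]
    by (intro measurable_quantile_comp borel_measurable_times) (auto simp: space_pair_measure simp del: space_unit_measure)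
  moreover have "(\<lambda>z. hn_quantile (fst z)) \<in> borel_measurable ?M"
    by (rule measurable_compose[OF measurable_fst measurable_hn_quantile])
  ultimately show "(\<lambda>z. shape i j (fst z) (snd z) b) \<in> borel_measurable ?M"
    unfolding shape_def by (cases "b = i"; cases "b = j") auto
qed

lemma shape_meas: "p \<in> space unit_measure \<Longrightarrow> (\<lambda>v. g (shape i j p v)) \<in> borel_measurable (cube Basis)"
  using measurable_Pair2[OF shape_joint_meas] by simp

lemma g_shape_bounds:
  assumes "p \<in> space unit_measure" "v \<in> space (cube Basis)"
  shows "0 \<le> g (shape i j p v)" "g (shape i j p v) \<le> g (\<lambda>_. 1)"
proof -
  show "0 \<le> g (shape i j p v)" by (rule g_nonneg) (rule shape_bounds[OF assms])
  show "g (shape i j p v) \<le> g (\<lambda>_. 1)" by (rule g_mono) (rule shape_bounds[OF assms], assumption)+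
qed

interpretation C: prob_space "cube (Basis :: 'a set)"
  by (rule prob_space_cube)

lemma shape_integrable:
  assumes "p \<in> space unit_measure"
  shows "integrable (cube Basis) (\<lambda>v. g (shape i j p v))"
  using g_shape_bounds[OF assms]
  by (intro C.integrable_const_bound[where B = "g (\<lambda>_. 1)"] shape_meas[OF assms] AE_I2) auto

lemma shape_mean_nn:
  assumes "p \<in> space unit_measure"
  shows "(\<integral>\<^sup>+v. ennreal (g (shape i j p v)) \<partial>cube Basis) = ennreal (shape_mean i j p)"
  unfolding shape_mean_def using g_shape_bounds[OF assms]
  by (intro nn_integral_eq_integral shape_integrable[OF assms] AE_I2) auto

lemma shape_mean_bounds:
  assumes "p \<in> space unit_measure"
  shows "0 \<le> shape_mean i j p" "shape_mean i j p \<le> g (\<lambda>_. 1)"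
proof -
  show "0 \<le> shape_mean i j p"
    unfolding shape_mean_def using g_shape_bounds[OF assms]
    by (intro Bochner_Integration.integral_nonneg_AE AE_I2) auto
  have "shape_mean i j p \<le> (\<integral>v. g (\<lambda>_. 1) \<partial>cube (Basis :: 'a set))"
    unfolding shape_mean_def using g_shape_bounds[OF assms]
    by (intro integral_mono_AE shape_integrable[OF assms] AE_I2) auto
  then show "shape_mean i j p \<le> g (\<lambda>_. 1)" by (simp add: C.prob_space)
qed

lemma shape_mean_meas: "shape_mean i j \<in> borel_measurable unit_measure"
  unfolding shape_mean_def[abs_def]
  using C.borel_measurable_lebesgue_integral[OF shape_joint_meas] by simp

lemma shape_mean_antimono:
  assumes "0 < p" "p \<le> q" "q < 1"
  shows "shape_mean i j q \<le> shape_mean i j p"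
  unfolding shape_mean_def
proof (rule integral_mono_AE)
  have pq: "p \<in> space unit_measure" "q \<in> space unit_measure" using assms by auto
  show "integrable (cube Basis) (\<lambda>v. g (shape i j q v))" "integrable (cube Basis) (\<lambda>v. g (shape i j p v))"
    using pq by (auto intro!: shape_integrable simp del: space_unit_measure)
  show "AE v in cube Basis. g (shape i j q v) \<le> g (shape i j p v)"
  proof (rule AE_I2)
    fix v :: "'a \<Rightarrow> real" assume v: "v \<in> space (cube Basis)"
    show "g (shape i j q v) \<le> g (shape i j p v)"
    proof (rule g_mono)
      fix b :: 'a assume b: "b \<in> Basis"
      show "0 \<le> shape i j q v b" using shape_bounds[OF pq(2) v b] by simp
      have "0 < v b" "v b < 1" using v b by (auto simp: space_cube_iff)
      then show "shape i j q v b \<le> shape i j p v b"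
        using hn_quantile_scaled_ratio[OF assms, of "v b"] by (auto simp: shape_def)
    qed
  qed
qed

text \<open>With coordinate \<open>i\<close> at level \<open>u\<close>, the others are uniform on
  (u,1). The largest of them, \<open>j\<close>, is put at relative level \<open>p\<close>, and the
  remaining n - 2 fall below it with probability p^(n-2). At u = 0 the condition on \<open>i\<close>
  disappears.\<close>

lemma slice_decomposition:
  assumes i: "i \<in> Basis" and u: "0 \<le> u" "u < 1"
  shows "(\<integral>\<^sup>+v. ennreal (slice i (affine_on (Basis - {i}) u 1 v)) \<partial>cube Basis)
    = (\<Sum>j\<in>Basis - {i}. \<integral>\<^sup>+p. ennreal (p ^ (DIM('a) - 2)) * (\<integral>\<^sup>+v. ennreal
        (g (\<lambda>b. if b = i then 0 else if b = j then hn_quantile (u + (1 - u) * p)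
           else hn_quantile (u + (1 - u) * (p * v b)))) \<partial>cube Basis) \<partial>unit_measure)"
proof -
  let ?J = "Basis - {i}"
  have card: "card (?J - {j}) = DIM('a) - 2" if "j \<in> ?J" for j using that i by simp
  have "card ?J \<noteq> 0" using dim i by simp
  then have ne: "?J \<noteq> {}" by (metis card.empty)
  define H where "H v = ennreal (slice i (affine_on ?J u 1 v))" for v
  have mH: "H \<in> borel_measurable (cube Basis)"
    unfolding H_def[abs_def]
    using measurable_compose[OF measurable_affine_on[of ?J Basis u 1] slice_meas[of i]] u by simp
  have "(\<integral>\<^sup>+v. H v \<partial>cube Basis) = (\<Sum>j\<in>?J. \<integral>\<^sup>+v. (if \<forall>k\<in>?J - {j}. v k < v j then H v else 0) \<partial>cube Basis)"
    using ne by (intro nn_integral_cube_min(2) mH) auto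
  also have "\<dots> = (\<Sum>j\<in>?J. \<integral>\<^sup>+p. ennreal (p ^ (DIM('a) - 2)) *
      (\<integral>\<^sup>+v. H ((affine_on (?J - {j}) 0 p v)(j := p)) \<partial>cube Basis) \<partial>unit_measure)"
  proof (rule sum.cong)
    fix j assume j: "j \<in> ?J"
    show "(\<integral>\<^sup>+v. (if \<forall>k\<in>?J - {j}. v k < v j then H v else 0) \<partial>cube Basis)
        = (\<integral>\<^sup>+p. ennreal (p ^ (DIM('a) - 2)) * (\<integral>\<^sup>+v. H ((affine_on (?J - {j}) 0 p v)(j := p)) \<partial>cube Basis) \<partial>unit_measure)"
      using nn_integral_cube_given_max[of Basis "?J - {j}" j H] j mH unfolding card[OF j] by auto
  qed simp
  also have "\<dots> = (\<Sum>j\<in>?J. \<integral>\<^sup>+p. ennreal (p ^ (DIM('a) - 2)) * (\<integral>\<^sup>+v. ennreal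
        (g (\<lambda>b. if b = i then 0 else if b = j then hn_quantile (u + (1 - u) * p)
           else hn_quantile (u + (1 - u) * (p * v b)))) \<partial>cube Basis) \<partial>unit_measure)"
  proof (intro sum.cong nn_integral_cong arg_cong2[where f = "(*)"] refl)
    fix j p v assume j: "j \<in> ?J"
    have "of_coords (\<lambda>b. if b = i then 0 else hn_quantile (affine_on ?J u 1 ((affine_on (?J - {j}) 0 p v)(j := p)) b))
      = (of_coords (\<lambda>b. if b = i then 0 else if b = j then hn_quantile (u + (1 - u) * p)
           else hn_quantile (u + (1 - u) * (p * v b))) :: 'a)"
      using j by (intro sum.cong) (auto simp: affine_on_def)
    then show "H ((affine_on (?J - {j}) 0 p v)(j := p)) = ennreal
        (g (\<lambda>b. if b = i then 0 else if b = j then hn_quantile (u + (1 - u) * p)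
           else hn_quantile (u + (1 - u) * (p * v b))))"
      unfolding H_def slice_def by simp
  qed
  finally show ?thesis unfolding H_def .
qed

text \<open>The conditional mean of \<open>slice i\<close> when the smallest coordinate
  \<open>i\<close> has level \<open>u\<close> and the largest one \<open>j\<close> has relative
  level \<open>p\<close> above it.\<close>

definition top_mean :: "'a \<Rightarrow> 'a \<Rightarrow> real \<Rightarrow> real \<Rightarrow> ennreal" where
  "top_mean i j u p = (\<integral>\<^sup>+v. ennreal (g (\<lambda>b. if b = i then 0 else if b = j then hn_quantile (u + (1 - u) * p)
     else hn_quantile (u + (1 - u) * (p * v b)))) \<partial>cube Basis)"

lemma top_mean_meas: "(\<lambda>(u, p). top_mean i j u p) \<in> borel_measurable (unit_measure \<Otimes>\<^sub>M unit_measure)"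
proof -
  let ?M = "(unit_measure \<Otimes>\<^sub>M unit_measure) \<Otimes>\<^sub>M cube (Basis :: 'a set)"
  have "(\<lambda>z. g (\<lambda>b. if b = i then 0 else if b = j then hn_quantile (fst (fst z) + (1 - fst (fst z)) * snd (fst z))
     else hn_quantile (fst (fst z) + (1 - fst (fst z)) * (snd (fst z) * snd z b)))) \<in> borel_measurable ?M"
  proof (rule g_meas)
    fix b :: 'a assume b: "b \<in> Basis"
    have m: "(\<lambda>z. fst (fst z)) \<in> borel_measurable ?M" "(\<lambda>z. snd (fst z)) \<in> borel_measurable ?M"
      by (rule measurable_compose[OF _ unit_borel], measurable)+
    have v: "(\<lambda>z. snd z b) \<in> borel_measurable ?M"
      by (rule measurable_compose[OF measurable_snd measurable_cube_component[OF b]])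
    have 1: "(\<lambda>z. hn_quantile (fst (fst z) + (1 - fst (fst z)) * snd (fst z))) \<in> borel_measurable ?M"
      using m shift_unit
      by (intro measurable_quantile_comp borel_measurable_add borel_measurable_times borel_measurable_diff)
        (auto simp: space_pair_measure)
    have 2: "(\<lambda>z. hn_quantile (fst (fst z) + (1 - fst (fst z)) * (snd (fst z) * snd z b))) \<in> borel_measurable ?M"
    proof (rule measurable_quantile_comp)
      fix z assume z: "z \<in> space ?M"
      then have "0 < snd (fst z) * snd z b" "snd (fst z) * snd z b < 1"
        using pv_unit[of "snd (fst z)" "snd z" b] b by (auto simp: space_pair_measure)
      then show "0 < fst (fst z) + (1 - fst (fst z)) * (snd (fst z) * snd z b) \<and>
          fst (fst z) + (1 - fst (fst z)) * (snd (fst z) * snd z b) < 1"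
        using z shift_unit[of "fst (fst z)" "snd (fst z) * snd z b"] by (auto simp: space_pair_measure)
    qed (use m v in auto)
    show "(\<lambda>z. if b = i then 0 else if b = j then hn_quantile (fst (fst z) + (1 - fst (fst z)) * snd (fst z))
       else hn_quantile (fst (fst z) + (1 - fst (fst z)) * (snd (fst z) * snd z b))) \<in> borel_measurable ?M"
      using 1 2 by (cases "b = i"; cases "b = j") auto
  qed
  then have "(\<lambda>z. \<integral>\<^sup>+v. ennreal (g (\<lambda>b. if b = i then 0 else if b = j then hn_quantile (fst z + (1 - fst z) * snd z)
     else hn_quantile (fst z + (1 - fst z) * (snd z * v b)))) \<partial>cube Basis) \<in> borel_measurable (unit_measure \<Otimes>\<^sub>M unit_measure)"
    by (intro C.borel_measurable_nn_integral) (simp add: case_prod_unfold)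
  then show ?thesis by (simp add: top_mean_def case_prod_unfold)
qed

text \<open>This is the decomposition at u = 0; homogeneity then pulls the largest coordinate, the
  quantile of \<open>p\<close>, out of the gauge.\<close>

lemma slice_integral:
  assumes i: "i \<in> Basis"
  shows "(\<integral>\<^sup>+v. ennreal (slice i v) \<partial>cube Basis)
    = (\<Sum>j\<in>Basis - {i}. \<integral>\<^sup>+p. ennreal (p ^ (DIM('a) - 2) * hn_quantile p * shape_mean i j p) \<partial>unit_measure)"
proof -
  have "affine_on (Basis - {i}) 0 1 v = v" for v :: "'a \<Rightarrow> real"
    by (simp add: affine_on_def fun_eq_iff)
  then have "(\<integral>\<^sup>+v. ennreal (slice i v) \<partial>cube Basis) = (\<integral>\<^sup>+v. ennreal (slice i (affine_on (Basis - {i}) 0 1 v)) \<partial>cube Basis)"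
    by simp
  also have "\<dots> = (\<Sum>j\<in>Basis - {i}. \<integral>\<^sup>+p. ennreal (p ^ (DIM('a) - 2)) * top_mean i j 0 p \<partial>unit_measure)"
    using slice_decomposition[OF i, of 0] unfolding top_mean_def by simp
  also have "\<dots> = (\<Sum>j\<in>Basis - {i}. \<integral>\<^sup>+p. ennreal (p ^ (DIM('a) - 2) * hn_quantile p * shape_mean i j p) \<partial>unit_measure)"
  proof (intro sum.cong nn_integral_cong refl)
    fix j p assume p: "p \<in> space unit_measure" and j: "j \<in> Basis - {i}"
    have q: "0 < hn_quantile p" using p by (auto intro: hn_quantile_pos)
    have "g (\<lambda>b. if b = i then 0 else if b = j then hn_quantile (0 + (1 - 0) * p)
        else hn_quantile (0 + (1 - 0) * (p * v b))) = hn_quantile p * g (shape i j p v)" for v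
    proof -
      have "hn_quantile p * g (shape i j p v) = g (\<lambda>b. hn_quantile p * shape i j p v b)"
        using q by (simp only: g_scale less_imp_le)
      also have "(\<lambda>b. hn_quantile p * shape i j p v b) = (\<lambda>b. if b = i then 0 else if b = j then hn_quantile (0 + (1 - 0) * p)
        else hn_quantile (0 + (1 - 0) * (p * v b)))"
        using q by (auto simp: shape_def)
      finally show ?thesis by simp
    qed
    then have "top_mean i j 0 p = (\<integral>\<^sup>+v. ennreal (hn_quantile p) * ennreal (g (shape i j p v)) \<partial>cube Basis)"
      unfolding top_mean_def using q g_shape_bounds[OF p]
      by (intro nn_integral_cong) (simp only: ennreal_mult less_imp_le)
    also have "\<dots> = ennreal (hn_quantile p) * ennreal (shape_mean i j p)"
      using shape_meas[OF p, of i j] by (simp add: nn_integral_cmult shape_mean_nn[OF p])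
    finally show "ennreal (p ^ (DIM('a) - 2)) * top_mean i j 0 p
        = ennreal (p ^ (DIM('a) - 2) * hn_quantile p * shape_mean i j p)"
      using p q shape_mean_bounds(1)[OF p, of i j] by (simp add: ennreal_mult' mult.assoc)
  qed
  finally show ?thesis .
qed

text \<open>The same decomposition on the event that coordinate \<open>i\<close> is smallest,
  integrated over its level \<open>u\<close>. Fubini moves \<open>p\<close> outside, so that the
  result can be compared with \<open>slice_integral\<close> for each \<open>p\<close>.\<close>

lemma slice_min_integral:
  assumes i: "i \<in> Basis"
  shows "(\<integral>\<^sup>+v. (if \<forall>k\<in>Basis - {i}. v i < v k then ennreal (slice i v) else 0) \<partial>cube Basis)
    = (\<Sum>j\<in>Basis - {i}. \<integral>\<^sup>+p. ennreal (p ^ (DIM('a) - 2)) *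
        (\<integral>\<^sup>+u. ennreal ((1 - u) ^ (DIM('a) - 1)) * top_mean i j u p \<partial>unit_measure) \<partial>unit_measure)"
proof -
  let ?U = unit_measure
  interpret UU: pair_sigma_finite unit_measure unit_measure
    by (simp add: pair_sigma_finite_def unit_measure.sigma_finite_measure_axioms)
  have "slice i (v(i := x)) = slice i v" for v x
    unfolding slice_def by (intro arg_cong[where f = f] sum.cong) auto
  then have "(\<integral>\<^sup>+v. (if \<forall>k\<in>Basis - {i}. v i < v k then ennreal (slice i v) else 0) \<partial>cube Basis)
    = (\<integral>\<^sup>+u. ennreal ((1 - u) ^ card (Basis - {i})) *
        (\<integral>\<^sup>+v. ennreal (slice i (affine_on (Basis - {i}) u 1 v)) \<partial>cube Basis) \<partial>?U)"
    using i slice_meas[of i] by (intro nn_integral_cube_given_min) auto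
  also have "\<dots> = (\<integral>\<^sup>+u. (\<Sum>j\<in>Basis - {i}. \<integral>\<^sup>+p. ennreal ((1 - u) ^ (DIM('a) - 1)) * (ennreal (p ^ (DIM('a) - 2)) * top_mean i j u p) \<partial>?U) \<partial>?U)"
  proof (rule nn_integral_cong)
    fix u assume u: "u \<in> space ?U"
    have "(\<lambda>p. top_mean i j u p) \<in> borel_measurable ?U" for j
      using measurable_Pair2[OF top_mean_meas u] by simp
    then have "(\<Sum>j\<in>Basis - {i}. \<integral>\<^sup>+p. ennreal ((1 - u) ^ (DIM('a) - 1)) * (ennreal (p ^ (DIM('a) - 2)) * top_mean i j u p) \<partial>?U)
        = ennreal ((1 - u) ^ (DIM('a) - 1)) * (\<Sum>j\<in>Basis - {i}. \<integral>\<^sup>+p. ennreal (p ^ (DIM('a) - 2)) * top_mean i j u p \<partial>?U)"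
      by (simp add: nn_integral_cmult sum_distrib_left)
    then show "ennreal ((1 - u) ^ card (Basis - {i})) *
        (\<integral>\<^sup>+v. ennreal (slice i (affine_on (Basis - {i}) u 1 v)) \<partial>cube Basis)
      = (\<Sum>j\<in>Basis - {i}. \<integral>\<^sup>+p. ennreal ((1 - u) ^ (DIM('a) - 1)) * (ennreal (p ^ (DIM('a) - 2)) * top_mean i j u p) \<partial>?U)"
      using slice_decomposition[OF i, of u] u i by (simp add: top_mean_def)
  qed
  also have "\<dots> = (\<Sum>j\<in>Basis - {i}. \<integral>\<^sup>+p. ennreal (p ^ (DIM('a) - 2)) *
        (\<integral>\<^sup>+u. ennreal ((1 - u) ^ (DIM('a) - 1)) * top_mean i j u p \<partial>?U) \<partial>?U)"
  proof -
    have m: "(\<lambda>(u, p). ennreal ((1 - u) ^ (DIM('a) - 1)) * (ennreal (p ^ (DIM('a) - 2)) * top_mean i j u p))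
        \<in> borel_measurable (?U \<Otimes>\<^sub>M ?U)" for j
      using top_mean_meas[of i j] by measurable
    have "(\<integral>\<^sup>+u. (\<Sum>j\<in>Basis - {i}. \<integral>\<^sup>+p. ennreal ((1 - u) ^ (DIM('a) - 1)) * (ennreal (p ^ (DIM('a) - 2)) * top_mean i j u p) \<partial>?U) \<partial>?U)
        = (\<Sum>j\<in>Basis - {i}. \<integral>\<^sup>+u. \<integral>\<^sup>+p. ennreal ((1 - u) ^ (DIM('a) - 1)) * (ennreal (p ^ (DIM('a) - 2)) * top_mean i j u p) \<partial>?U \<partial>?U)"
      using m by (intro nn_integral_sum unit_measure.borel_measurable_nn_integral)
    also have "\<dots> = (\<Sum>j\<in>Basis - {i}. \<integral>\<^sup>+p. \<integral>\<^sup>+u. ennreal ((1 - u) ^ (DIM('a) - 1)) * (ennreal (p ^ (DIM('a) - 2)) * top_mean i j u p) \<partial>?U \<partial>?U)"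
      using m by (intro sum.cong refl UU.Fubini'[symmetric])
    also have "\<dots> = (\<Sum>j\<in>Basis - {i}. \<integral>\<^sup>+p. ennreal (p ^ (DIM('a) - 2)) *
        (\<integral>\<^sup>+u. ennreal ((1 - u) ^ (DIM('a) - 1)) * top_mean i j u p \<partial>?U) \<partial>?U)"
    proof (intro sum.cong nn_integral_cong refl)
      fix j p assume p: "p \<in> space ?U"
      have [measurable]: "(\<lambda>u. top_mean i j u p) \<in> borel_measurable ?U"
        using measurable_Pair1[OF top_mean_meas p] by simp
      have "(\<integral>\<^sup>+u. ennreal ((1 - u) ^ (DIM('a) - 1)) * (ennreal (p ^ (DIM('a) - 2)) * top_mean i j u p) \<partial>?U)
          = (\<integral>\<^sup>+u. ennreal (p ^ (DIM('a) - 2)) * (ennreal ((1 - u) ^ (DIM('a) - 1)) * top_mean i j u p) \<partial>?U)"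
        by (simp add: mult_ac)
      also have "\<dots> = ennreal (p ^ (DIM('a) - 2)) * (\<integral>\<^sup>+u. ennreal ((1 - u) ^ (DIM('a) - 1)) * top_mean i j u p \<partial>?U)"
        by (rule nn_integral_cmult) measurable
      finally show "(\<integral>\<^sup>+u. ennreal ((1 - u) ^ (DIM('a) - 1)) * (ennreal (p ^ (DIM('a) - 2)) * top_mean i j u p) \<partial>?U)
          = ennreal (p ^ (DIM('a) - 2)) * (\<integral>\<^sup>+u. ennreal ((1 - u) ^ (DIM('a) - 1)) * top_mean i j u p \<partial>?U)" .
    qed
    finally show ?thesis .
  qed
  finally show ?thesis .
qed

text \<open>By \<open>hn_quantile_shifted_ratio\<close> at p v < p, raising the levels by
  \<open>u\<close> enlarges every entry in at least the proportion in which it enlarges the largest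
  one. So the vector dominates a multiple of the shape for u = 0, and \<open>u\<close> enters
  through that factor alone.\<close>

lemma top_mean_ge:
  assumes u: "u \<in> space unit_measure" and p: "p \<in> space unit_measure"
  shows "ennreal (hn_quantile (u + (1 - u) * p)) * ennreal (shape_mean i j p) \<le> top_mean i j u p"
proof -
  let ?y = "\<lambda>x. u + (1 - u) * x"
  have q: "0 < hn_quantile p" "0 < hn_quantile (?y p)"
    using p u shift_unit[of u p] by (auto intro!: hn_quantile_pos)
  have "ennreal (hn_quantile (?y p)) * ennreal (shape_mean i j p)
      = (\<integral>\<^sup>+v. ennreal (hn_quantile (?y p)) * ennreal (g (shape i j p v)) \<partial>cube Basis)"
    using shape_meas[OF p, of i j] by (simp add: nn_integral_cmult shape_mean_nn[OF p])
  also have "\<dots> \<le> top_mean i j u p"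
    unfolding top_mean_def
  proof (rule nn_integral_mono)
    fix v :: "'a \<Rightarrow> real" assume v: "v \<in> space (cube Basis)"
    have "hn_quantile (?y p) * g (shape i j p v) = g (\<lambda>b. hn_quantile (?y p) * shape i j p v b)"
      using q by (simp only: g_scale less_imp_le)
    also have "\<dots> \<le> g (\<lambda>b. if b = i then 0 else if b = j then hn_quantile (?y p) else hn_quantile (?y (p * v b)))"
    proof (rule g_mono)
      fix b :: 'a assume b: "b \<in> Basis"
      show "0 \<le> hn_quantile (?y p) * shape i j p v b" using q shape_bounds[OF p v b] by simp
      note pv = pv_unit[OF p v b]
      have "hn_quantile (?y p) / hn_quantile p < hn_quantile (?y (p * v b)) / hn_quantile (p * v b)"
        using pv p u by (intro hn_quantile_shifted_ratio) auto
      then have "hn_quantile (?y p) * (hn_quantile (p * v b) / hn_quantile p) \<le> hn_quantile (?y (p * v b))"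
        using q(1) hn_quantile_pos[OF pv(1,3)] by (simp add: field_simps)
      then show "hn_quantile (?y p) * shape i j p v b
          \<le> (if b = i then 0 else if b = j then hn_quantile (?y p) else hn_quantile (?y (p * v b)))"
        by (auto simp: shape_def)
    qed
    finally show "ennreal (hn_quantile (?y p)) * ennreal (g (shape i j p v))
      \<le> ennreal (g (\<lambda>b. if b = i then 0 else if b = j then hn_quantile (?y p) else hn_quantile (?y (p * v b))))"
      using q g_shape_bounds[OF p v] by (simp add: ennreal_leI flip: ennreal_mult)
  qed
  finally show ?thesis .
qed

lemma slice_min_integral_ge:
  assumes i: "i \<in> Basis"
  shows "(\<Sum>j\<in>Basis - {i}. \<integral>\<^sup>+p. ennreal (p ^ (DIM('a) - 2) * tail_weight (DIM('a) - 1) p * shape_mean i j p) \<partial>unit_measure)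
    \<le> (\<integral>\<^sup>+v. (if \<forall>k\<in>Basis - {i}. v i < v k then ennreal (slice i v) else 0) \<partial>cube Basis)"
  unfolding slice_min_integral[OF i]
proof (intro sum_mono nn_integral_mono)
  fix j p assume p: "p \<in> space unit_measure"
  then have p': "0 < p" "p < 1" by auto
  note X = shape_mean_bounds(1)[OF p, of i j]
  have q: "0 < hn_quantile (u + (1 - u) * p)" if "u \<in> space unit_measure" for u
    using shift_unit[of u p] p' that by (intro hn_quantile_pos) auto
  have "ennreal (tail_weight (DIM('a) - 1) p * shape_mean i j p)
      = (\<integral>\<^sup>+u. ennreal ((1 - u) ^ (DIM('a) - 1) * hn_quantile (u + (1 - u) * p)) \<partial>unit_measure) * ennreal (shape_mean i j p)"
    using X by (simp add: tail_weight_nn_integral[OF p'] ennreal_mult'')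
  also have "\<dots> = (\<integral>\<^sup>+u. ennreal ((1 - u) ^ (DIM('a) - 1) * hn_quantile (u + (1 - u) * p)) * ennreal (shape_mean i j p) \<partial>unit_measure)"
    using borel_measurable_integrable[OF tail_weight_integrable[OF p', of "DIM('a) - 1"]]
    by (intro nn_integral_multc[symmetric]) auto
  also have "\<dots> \<le> (\<integral>\<^sup>+u. ennreal ((1 - u) ^ (DIM('a) - 1)) * top_mean i j u p \<partial>unit_measure)"
  proof (rule nn_integral_mono)
    fix u assume u: "u \<in> space unit_measure"
    have "ennreal ((1 - u) ^ (DIM('a) - 1) * hn_quantile (u + (1 - u) * p)) * ennreal (shape_mean i j p)
        = ennreal ((1 - u) ^ (DIM('a) - 1)) * (ennreal (hn_quantile (u + (1 - u) * p)) * ennreal (shape_mean i j p))"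
      using u q[OF u] by (simp add: ennreal_mult mult.assoc)
    also have "\<dots> \<le> ennreal ((1 - u) ^ (DIM('a) - 1)) * top_mean i j u p"
      by (intro mult_left_mono top_mean_ge u p) simp
    finally show "ennreal ((1 - u) ^ (DIM('a) - 1) * hn_quantile (u + (1 - u) * p)) * ennreal (shape_mean i j p)
        \<le> ennreal ((1 - u) ^ (DIM('a) - 1)) * top_mean i j u p" .
  qed
  finally have *: "ennreal (tail_weight (DIM('a) - 1) p * shape_mean i j p)
      \<le> (\<integral>\<^sup>+u. ennreal ((1 - u) ^ (DIM('a) - 1)) * top_mean i j u p \<partial>unit_measure)" .
  have "ennreal (p ^ (DIM('a) - 2) * tail_weight (DIM('a) - 1) p * shape_mean i j p)
      = ennreal (p ^ (DIM('a) - 2)) * ennreal (tail_weight (DIM('a) - 1) p * shape_mean i j p)"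
    using p' by (simp add: ennreal_mult' mult.assoc)
  also have "\<dots> \<le> ennreal (p ^ (DIM('a) - 2)) * (\<integral>\<^sup>+u. ennreal ((1 - u) ^ (DIM('a) - 1)) * top_mean i j u p \<partial>unit_measure)"
    using * by (rule mult_left_mono) simp
  finally show "ennreal (p ^ (DIM('a) - 2) * tail_weight (DIM('a) - 1) p * shape_mean i j p)
      \<le> ennreal (p ^ (DIM('a) - 2)) * (\<integral>\<^sup>+u. ennreal ((1 - u) ^ (DIM('a) - 1)) * top_mean i j u p \<partial>unit_measure)" .
qed

end

lemma quantile_coord_integral:
  fixes b :: "'a::euclidean_space"
  assumes b: "b \<in> Basis"
  shows "integrable (cube Basis) (\<lambda>v. hn_quantile (v b))"
    and "(\<integral>v. hn_quantile (v b) \<partial>cube Basis) = (\<integral>x. hn_quantile x \<partial>unit_measure)"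
proof -
  interpret C: prob_space "cube (Basis :: 'a set)" by (rule prob_space_cube)
  have m: "(\<lambda>v. hn_quantile (v b)) \<in> borel_measurable (cube Basis)"
    by (rule measurable_compose[OF measurable_component_singleton[where M = "\<lambda>_. unit_measure", OF b] measurable_hn_quantile])
  have nn: "AE v in cube Basis. 0 \<le> hn_quantile (v b)"
    using b by (intro AE_I2 less_imp_le hn_quantile_pos) (auto simp: space_cube_iff)
  have "(\<integral>\<^sup>+v. ennreal (hn_quantile (v b)) \<partial>cube Basis)
      = (\<integral>\<^sup>+v. \<integral>\<^sup>+x. ennreal (hn_quantile ((v(b := x)) b)) \<partial>unit_measure \<partial>cube Basis)"
    using m by (intro nn_integral_cube_coord(1) b) auto
  also have "\<dots> = (\<integral>\<^sup>+x. ennreal (hn_quantile x) \<partial>unit_measure)"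
    by (simp add: C.emeasure_space_1)
  also have "\<dots> = ennreal (\<integral>x. hn_quantile x \<partial>unit_measure)"
    using hn_quantile_integrable
    by (intro nn_integral_eq_integral AE_I2) (auto intro!: less_imp_le hn_quantile_pos)
  finally have "(\<integral>\<^sup>+v. ennreal (hn_quantile (v b)) \<partial>cube Basis) = ennreal (\<integral>x. hn_quantile x \<partial>unit_measure)" .
  moreover have "0 \<le> (\<integral>x. hn_quantile x \<partial>unit_measure)"
    by (intro Bochner_Integration.integral_nonneg_AE AE_I2) (auto intro!: less_imp_le hn_quantile_pos)
  ultimately have "has_bochner_integral (cube Basis) (\<lambda>v. hn_quantile (v b)) (\<integral>x. hn_quantile x \<partial>unit_measure)"
    by (intro has_bochner_integral_nn_integral m nn)
  then show "integrable (cube Basis) (\<lambda>v. hn_quantile (v b))"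
    "(\<integral>v. hn_quantile (v b) \<partial>cube Basis) = (\<integral>x. hn_quantile x \<partial>unit_measure)"
    by (simp_all add: has_bochner_integral_iff)
qed

lemma tail_weight_meas [measurable]: "tail_weight N \<in> borel_measurable unit_measure"
proof -
  have m: "(\<lambda>z. fst z) \<in> borel_measurable (unit_measure \<Otimes>\<^sub>M unit_measure)"
    "(\<lambda>z. snd z) \<in> borel_measurable (unit_measure \<Otimes>\<^sub>M unit_measure)"
    by (rule measurable_compose[OF measurable_fst unit_borel], rule measurable_compose[OF measurable_snd unit_borel])
  have "(\<lambda>(p, u). (1 - u) ^ N * hn_quantile (u + (1 - u) * p)) \<in> borel_measurable (unit_measure \<Otimes>\<^sub>M unit_measure)"
    unfolding case_prod_unfold using m shift_unit
    by (intro borel_measurable_times borel_measurable_power measurable_quantile_comp borel_measurable_add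
        borel_measurable_diff) (auto simp: space_pair_measure)
  from unit_measure.borel_measurable_lebesgue_integral[OF this] show ?thesis
    unfolding tail_weight_def[abs_def] .
qed

lemma tail_weight_nonneg: "0 < p \<Longrightarrow> p < 1 \<Longrightarrow> 0 \<le> tail_weight N p"
  unfolding tail_weight_def using shift_unit[of _ p]
  by (intro Bochner_Integration.integral_nonneg_AE AE_I2) (auto intro!: mult_nonneg_nonneg less_imp_le[OF hn_quantile_pos])

section \<open>Numerator, denominator and the numerator without its smallest coordinate\<close>

context coordinate_gauge
begin

interpretation C: prob_space "cube (Basis :: 'a set)"
  by (rule prob_space_cube)

definition num :: ennreal where
  "num = (\<integral>\<^sup>+v. ennreal (g (\<lambda>b. hn_quantile (v b))) \<partial>cube Basis)"

definition den :: ennreal where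
  "den = (\<Sum>i\<in>Basis. \<integral>\<^sup>+v. ennreal (slice i v) \<partial>cube Basis)"

text \<open>The numerator with the smallest coordinate replaced by 0, split according to the
  position \<open>i\<close> of that coordinate.\<close>

definition num_min :: ennreal where
  "num_min = (\<Sum>i\<in>Basis. \<integral>\<^sup>+v. (if \<forall>k\<in>Basis - {i}. v i < v k then ennreal (slice i v) else 0) \<partial>cube Basis)"

definition shape_sum :: "real \<Rightarrow> real" where
  "shape_sum p = (\<Sum>i\<in>Basis. \<Sum>j\<in>Basis - {i}. shape_mean i j p)"

lemma quantile_vec_pos: "v \<in> space (cube Basis) \<Longrightarrow> b \<in> Basis \<Longrightarrow> 0 < hn_quantile (v b)"
  by (rule hn_quantile_pos) (auto simp: space_cube_iff)

lemma g_quantile_meas: "(\<lambda>v. g (\<lambda>b. hn_quantile (v b))) \<in> borel_measurable (cube Basis)"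
  by (rule g_meas) (rule quantile_coord_meas)

lemma slice_le:
  assumes "v \<in> space (cube Basis)"
  shows "slice i v \<le> g (\<lambda>b. hn_quantile (v b))" "0 \<le> slice i v"
proof -
  have "0 \<le> (if b = i then 0 else hn_quantile (v b))" "(if b = i then 0 else hn_quantile (v b)) \<le> hn_quantile (v b)"
    if "b \<in> Basis" for b
    using quantile_vec_pos[OF assms that] by auto
  then show "slice i v \<le> g (\<lambda>b. hn_quantile (v b))" "0 \<le> slice i v"
    unfolding slice_def by (auto intro!: g_mono g_nonneg simp del: sum.delta)
qed

lemma num_split:
  "num = (\<Sum>i\<in>Basis. \<integral>\<^sup>+v. (if \<forall>k\<in>Basis - {i}. v i < v k then ennreal (g (\<lambda>b. hn_quantile (v b))) else 0) \<partial>cube Basis)"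
  unfolding num_def using g_quantile_meas by (intro nn_integral_cube_min(1)) auto

lemma num_min_le_num: "num_min \<le> num"
  unfolding num_split num_min_def using slice_le by (intro sum_mono nn_integral_mono) (auto intro: ennreal_leI)

lemma num_finite: "num < \<infinity>"
proof -
  have "num \<le> (\<integral>\<^sup>+v. ennreal (\<Sum>b\<in>Basis. hn_quantile (v b) * f b) \<partial>cube Basis)"
    unfolding num_def using quantile_vec_pos
    by (intro nn_integral_mono ennreal_leI g_le_sum) (auto intro: less_imp_le)
  also have "\<dots> = ennreal (\<integral>v. (\<Sum>b\<in>Basis. hn_quantile (v b) * f b) \<partial>cube Basis)"
  proof (intro nn_integral_eq_integral AE_I2 Bochner_Integration.integrable_sum integrable_mult_left)
    fix v :: "'a \<Rightarrow> real" assume "v \<in> space (cube Basis)"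
    then show "0 \<le> (\<Sum>b\<in>Basis. hn_quantile (v b) * f b)"
      using quantile_vec_pos f_Basis_nonneg by (intro sum_nonneg mult_nonneg_nonneg) (auto intro: less_imp_le)
  qed (rule quantile_coord_integral)
  finally show ?thesis by (simp add: le_less_trans)
qed

lemma shape_sum_meas: "shape_sum \<in> borel_measurable unit_measure"
  unfolding shape_sum_def[abs_def] by (intro borel_measurable_sum shape_mean_meas)

lemma shape_sum_antimono: "0 < p \<Longrightarrow> p \<le> q \<Longrightarrow> q < 1 \<Longrightarrow> shape_sum q \<le> shape_sum p"
  unfolding shape_sum_def by (intro sum_mono shape_mean_antimono)

lemma shape_sum_nonneg: "p \<in> space unit_measure \<Longrightarrow> 0 \<le> shape_sum p"
  unfolding shape_sum_def by (intro sum_nonneg shape_mean_bounds)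

lemma shape_sum_bounded: "\<exists>B. \<forall>p\<in>space unit_measure. \<bar>shape_sum p\<bar> \<le> B"
proof (intro exI ballI)
  fix p assume p: "p \<in> space unit_measure"
  have "shape_sum p \<le> (\<Sum>i\<in>(Basis :: 'a set). \<Sum>j\<in>Basis - {i}. g (\<lambda>_. 1))"
    unfolding shape_sum_def by (intro sum_mono shape_mean_bounds p)
  with shape_sum_nonneg[OF p] show "\<bar>shape_sum p\<bar> \<le> (\<Sum>i\<in>(Basis :: 'a set). \<Sum>j\<in>Basis - {i}. g (\<lambda>_. 1))"
    by linarith
qed

lemma nn_integral_shape_sum:
  assumes [measurable]: "w \<in> borel_measurable unit_measure" and w: "\<And>p. p \<in> space unit_measure \<Longrightarrow> 0 \<le> w p"
  shows "(\<integral>\<^sup>+p. ennreal (w p * shape_sum p) \<partial>unit_measure)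
    = (\<Sum>i\<in>Basis. \<Sum>j\<in>Basis - {i}. \<integral>\<^sup>+p. ennreal (w p * shape_mean i j p) \<partial>unit_measure)"
proof -
  have m: "(\<lambda>p. ennreal (w p * shape_mean i j p)) \<in> borel_measurable unit_measure" for i j
    using shape_mean_meas[of i j] by measurable
  have "(\<integral>\<^sup>+p. ennreal (w p * shape_sum p) \<partial>unit_measure)
      = (\<integral>\<^sup>+p. (\<Sum>i\<in>Basis. \<Sum>j\<in>Basis - {i}. ennreal (w p * shape_mean i j p)) \<partial>unit_measure)"
  proof (rule nn_integral_cong)
    fix p assume p: "p \<in> space unit_measure"
    show "ennreal (w p * shape_sum p) = (\<Sum>i\<in>Basis. \<Sum>j\<in>Basis - {i}. ennreal (w p * shape_mean i j p))"
      using w[OF p] shape_mean_bounds(1)[OF p]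
      by (simp add: shape_sum_def sum_distrib_left sum_nonneg)
  qed
  also have "\<dots> = (\<Sum>i\<in>Basis. \<Sum>j\<in>Basis - {i}. \<integral>\<^sup>+p. ennreal (w p * shape_mean i j p) \<partial>unit_measure)"
    using m by (simp add: nn_integral_sum)
  finally show ?thesis .
qed

lemma den_eq:
  "den = (\<integral>\<^sup>+p. ennreal (p ^ (DIM('a) - 2) * hn_quantile p * shape_sum p) \<partial>unit_measure)"
  unfolding den_def
  by (subst nn_integral_shape_sum)
    (auto intro!: sum.cong slice_integral mult_nonneg_nonneg less_imp_le[OF hn_quantile_pos])

lemma num_min_ge:
  "(\<integral>\<^sup>+p. ennreal (p ^ (DIM('a) - 2) * tail_weight (DIM('a) - 1) p * shape_sum p) \<partial>unit_measure) \<le> num_min"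
proof -
  have "(\<integral>\<^sup>+p. ennreal (p ^ (DIM('a) - 2) * tail_weight (DIM('a) - 1) p * shape_sum p) \<partial>unit_measure)
      = (\<Sum>i\<in>Basis. \<Sum>j\<in>Basis - {i}. \<integral>\<^sup>+p.
          ennreal (p ^ (DIM('a) - 2) * tail_weight (DIM('a) - 1) p * shape_mean i j p) \<partial>unit_measure)"
    by (intro nn_integral_shape_sum) (auto intro!: mult_nonneg_nonneg tail_weight_nonneg)
  also have "\<dots> \<le> num_min"
    unfolding num_min_def by (intro sum_mono slice_min_integral_ge)
  finally show ?thesis .
qed

end

text \<open>For this gauge the estimates are identities: every shape has value 1, dropping the
  smallest coordinate changes nothing, and \<open>top_mean\<close> is the quantile of the largest
  coordinate.\<close>

locale maximum_gauge = coordinate_gauge +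
  assumes is_max: "\<And>v m. m \<in> Basis \<Longrightarrow> (\<And>b. b \<in> Basis \<Longrightarrow> 0 \<le> v b \<and> v b \<le> v m) \<Longrightarrow> g v = v m"
begin

interpretation C: prob_space "cube (Basis :: 'a set)"
  by (rule prob_space_cube)

lemma shape_mean_1:
  assumes "i \<in> Basis" "j \<in> Basis - {i}" and p: "p \<in> space unit_measure"
  shows "shape_mean i j p = 1"
proof -
  have "shape_mean i j p = (\<integral>v. 1 \<partial>cube (Basis :: 'a set))"
    unfolding shape_mean_def
  proof (rule Bochner_Integration.integral_cong)
    fix v :: "'a \<Rightarrow> real" assume v: "v \<in> space (cube Basis)"
    have "shape i j p v j = 1" using assms by (simp add: shape_def)
    then show "g (shape i j p v) = 1"
      using is_max[of j "shape i j p v"] shape_bounds[OF p v] assms by simp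
  qed simp
  then show ?thesis by (simp add: C.prob_space)
qed

lemma shape_sum_const: "p \<in> space unit_measure \<Longrightarrow> shape_sum p = real (DIM('a) * (DIM('a) - 1))"
  unfolding shape_sum_def by (simp add: shape_mean_1)

lemma num_eq_num_min: "num = num_min"
  unfolding num_split num_min_def
proof (intro sum.cong nn_integral_cong refl)
  fix i :: 'a and v :: "'a \<Rightarrow> real" assume i: "i \<in> Basis" and v: "v \<in> space (cube Basis)"
  show "(if \<forall>k\<in>Basis - {i}. v i < v k then ennreal (g (\<lambda>b. hn_quantile (v b))) else 0)
      = (if \<forall>k\<in>Basis - {i}. v i < v k then ennreal (slice i v) else 0)"
  proof (cases "\<forall>k\<in>Basis - {i}. v i < v k")
    case True
    have "card (Basis - {i}) \<noteq> 0" using dim i by simp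
    then have ne: "Basis - {i} \<noteq> {}" by (metis card.empty)
    have fin: "finite ((\<lambda>b. hn_quantile (v b)) ` (Basis - {i}))" by simp
    have "Max ((\<lambda>b. hn_quantile (v b)) ` (Basis - {i})) \<in> (\<lambda>b. hn_quantile (v b)) ` (Basis - {i})"
      using ne by (intro Max_in fin) auto
    then obtain m where m: "m \<in> Basis - {i}" "Max ((\<lambda>b. hn_quantile (v b)) ` (Basis - {i})) = hn_quantile (v m)"
      by auto
    have le: "hn_quantile (v b) \<le> hn_quantile (v m)" if "b \<in> Basis - {i}" for b
      unfolding m(2)[symmetric] using that by (intro Max_ge fin) auto
    have "v i < v m" using True m(1) by blast
    then have "hn_quantile (v i) < hn_quantile (v m)"
      using v i m(1) by (intro hn_quantile_strict_mono) (auto simp: space_cube_iff)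
    then have le': "hn_quantile (v b) \<le> hn_quantile (v m)" if "b \<in> Basis" for b
      using le[of b] that by (cases "b = i") auto
    have "g (\<lambda>b. hn_quantile (v b)) = hn_quantile (v m)"
      using m(1) le' quantile_vec_pos[OF v] by (intro is_max) (auto intro: less_imp_le)
    moreover have "slice i v = (if m = i then 0 else hn_quantile (v m))"
      unfolding slice_def using m(1) le' quantile_vec_pos[OF v]
      by (intro is_max[where v = "\<lambda>b. if b = i then 0 else hn_quantile (v b)"]) (auto intro: less_imp_le)
    ultimately show ?thesis using m(1) by simp
  qed (simp only: if_False)
qed

lemma top_mean_eq:
  assumes ij: "i \<in> Basis" "j \<in> Basis - {i}" and u: "u \<in> space unit_measure" and p: "p \<in> space unit_measure"
  shows "top_mean i j u p = ennreal (hn_quantile (u + (1 - u) * p))"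
proof -
  let ?y = "\<lambda>x. u + (1 - u) * x"
  have "top_mean i j u p = (\<integral>\<^sup>+v. ennreal (hn_quantile (?y p)) \<partial>cube (Basis :: 'a set))"
    unfolding top_mean_def
  proof (rule nn_integral_cong)
    fix v :: "'a \<Rightarrow> real" assume v: "v \<in> space (cube Basis)"
    let ?z = "\<lambda>b. if b = i then 0 else if b = j then hn_quantile (?y p) else hn_quantile (?y (p * v b))"
    have "g ?z = ?z j"
    proof (rule is_max)
      fix b :: 'a assume b: "b \<in> Basis"
      note pv = pv_unit[OF p v b]
      have "?y (p * v b) < ?y p" using pv u by simp
      then have "hn_quantile (?y (p * v b)) < hn_quantile (?y p)"
        using shift_unit[of u "p * v b"] shift_unit[of u p] pv u p by (intro hn_quantile_strict_mono) auto
      moreover have "0 < hn_quantile (?y (p * v b))"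
        using shift_unit[of u "p * v b"] pv u by (intro hn_quantile_pos) auto
      ultimately show "0 \<le> ?z b \<and> ?z b \<le> ?z j" using ij by auto
    qed (use ij in auto)
    also have "?z j = hn_quantile (?y p)" using ij by simp
    finally show "ennreal (g ?z) = ennreal (hn_quantile (?y p))" by simp
  qed
  then show ?thesis by (simp add: C.emeasure_space_1)
qed

lemma num_min_eq:
  "num_min = (\<integral>\<^sup>+p. ennreal (p ^ (DIM('a) - 2) * tail_weight (DIM('a) - 1) p * shape_sum p) \<partial>unit_measure)"
proof -
  have "num_min = (\<Sum>i\<in>Basis. \<Sum>j\<in>Basis - {i}.
      \<integral>\<^sup>+p. ennreal (p ^ (DIM('a) - 2) * tail_weight (DIM('a) - 1) p * shape_mean i j p) \<partial>unit_measure)"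
    unfolding num_min_def
  proof (intro sum.cong refl)
    fix i :: 'a assume i: "i \<in> Basis"
    show "(\<integral>\<^sup>+v. (if \<forall>k\<in>Basis - {i}. v i < v k then ennreal (slice i v) else 0) \<partial>cube Basis)
        = (\<Sum>j\<in>Basis - {i}. \<integral>\<^sup>+p. ennreal (p ^ (DIM('a) - 2) * tail_weight (DIM('a) - 1) p * shape_mean i j p) \<partial>unit_measure)"
      unfolding slice_min_integral[OF i]
    proof (intro sum.cong nn_integral_cong refl)
      fix j :: 'a and p assume j: "j \<in> Basis - {i}" and p: "p \<in> space unit_measure"
      have "(\<integral>\<^sup>+u. ennreal ((1 - u) ^ (DIM('a) - 1)) * top_mean i j u p \<partial>unit_measure)
          = (\<integral>\<^sup>+u. ennreal ((1 - u) ^ (DIM('a) - 1) * hn_quantile (u + (1 - u) * p)) \<partial>unit_measure)"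
        by (intro nn_integral_cong) (simp add: top_mean_eq[OF i j _ p] ennreal_mult' del: space_unit_measure, simp add: ennreal_mult')
      also have "\<dots> = ennreal (tail_weight (DIM('a) - 1) p)"
        using p by (intro tail_weight_nn_integral) auto
      finally show "ennreal (p ^ (DIM('a) - 2)) * (\<integral>\<^sup>+u. ennreal ((1 - u) ^ (DIM('a) - 1)) * top_mean i j u p \<partial>unit_measure)
          = ennreal (p ^ (DIM('a) - 2) * tail_weight (DIM('a) - 1) p * shape_mean i j p)"
        using p by (simp add: shape_mean_1[OF i j p] ennreal_mult')
    qed
  qed
  also have "\<dots> = (\<integral>\<^sup>+p. ennreal (p ^ (DIM('a) - 2) * tail_weight (DIM('a) - 1) p * shape_sum p) \<partial>unit_measure)"
    by (subst nn_integral_shape_sum) (auto intro!: mult_nonneg_nonneg tail_weight_nonneg)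
  finally show ?thesis .
qed

end

section \<open>The maximum norm and integrability of the weights\<close>

lemma infnorm_le_iff: "c \<ge> 0 \<Longrightarrow> infnorm (x :: 'a::euclidean_space) \<le> c \<longleftrightarrow> (\<forall>b\<in>Basis. \<bar>x \<bullet> b\<bar> \<le> c)"
  unfolding infnorm_Max by (subst Max_le_iff) auto

lemma maximum_gauge_infnorm:
  assumes "DIM('a::euclidean_space) \<ge> 2"
  shows "maximum_gauge (infnorm :: 'a \<Rightarrow> real)"
proof
  show "(infnorm :: 'a \<Rightarrow> real) \<in> borel_measurable borel"
    by (intro borel_measurable_continuous_onI) (auto intro: continuous_intros)
  show "infnorm (c *\<^sub>R x) = c * infnorm x" if "c \<ge> 0" for c and x :: 'a
    using that by (simp add: infnorm_mul)
  show "infnorm x \<le> infnorm y"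
    if "\<And>b. b \<in> Basis \<Longrightarrow> 0 \<le> x \<bullet> b" "\<And>b. b \<in> Basis \<Longrightarrow> x \<bullet> b \<le> y \<bullet> b" for x y :: 'a
  proof (subst infnorm_le_iff[OF infnorm_pos_le], rule ballI)
    fix b :: 'a assume b: "b \<in> Basis"
    have "\<bar>x \<bullet> b\<bar> \<le> \<bar>y \<bullet> b\<bar>" using that[OF b] by simp
    also have "\<dots> \<le> infnorm y" using b by (rule Basis_le_infnorm)
    finally show "\<bar>x \<bullet> b\<bar> \<le> infnorm y" .
  qed
  show "infnorm (x + y) \<le> infnorm x + infnorm y" for x y :: 'a by (rule infnorm_triangle)
  show "infnorm (of_coords v) = v m"
    if m: "m \<in> Basis" and v: "\<And>b. b \<in> Basis \<Longrightarrow> 0 \<le> v b \<and> v b \<le> v m" for v and m :: 'a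
  proof (rule antisym)
    show "infnorm (of_coords v) \<le> v m" using v m by (subst infnorm_le_iff) auto
    show "v m \<le> infnorm (of_coords v)" using Basis_le_infnorm[OF m, of "of_coords v"] m v[OF m] by simp
  qed
qed (fact assms)

text \<open>The integrability of p^(n-2) T(p) is read off from the maximum norm: up to a positive
  constant its integral is \<open>num\<close> for that gauge, which is finite.\<close>

lemma weights_integrable:
  assumes "DIM('a::euclidean_space) \<ge> 2"
  shows "integrable unit_measure (\<lambda>p. p ^ (DIM('a) - 2) * tail_weight (DIM('a) - 1) p)"
    and "integrable unit_measure (\<lambda>p. p ^ (DIM('a) - 2) * hn_quantile p)"
proof -
  interpret M: maximum_gauge "infnorm :: 'a \<Rightarrow> real"
    by (rule maximum_gauge_infnorm[OF assms])
  let ?c = "real (DIM('a) * (DIM('a) - 1))"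
  have c: "?c > 0" using assms by simp
  have "(\<integral>\<^sup>+p. ennreal (p ^ (DIM('a) - 2) * tail_weight (DIM('a) - 1) p * ?c) \<partial>unit_measure) = M.num"
    unfolding M.num_eq_num_min M.num_min_eq by (intro nn_integral_cong) (simp only: M.shape_sum_const)
  then have fin: "(\<integral>\<^sup>+p. ennreal (p ^ (DIM('a) - 2) * tail_weight (DIM('a) - 1) p * ?c) \<partial>unit_measure) < \<infinity>"
    using M.num_finite by simp
  have "integrable unit_measure (\<lambda>p. p ^ (DIM('a) - 2) * tail_weight (DIM('a) - 1) p * ?c)"
  proof (rule integrableI_nonneg[OF _ _ fin])
    show "AE p in unit_measure. 0 \<le> p ^ (DIM('a) - 2) * tail_weight (DIM('a) - 1) p * ?c"
      using c by (intro AE_I2 mult_nonneg_nonneg tail_weight_nonneg) auto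
  qed measurable
  then show "integrable unit_measure (\<lambda>p. p ^ (DIM('a) - 2) * tail_weight (DIM('a) - 1) p)"
    using c by (simp del: of_nat_mult)
  show "integrable unit_measure (\<lambda>p. p ^ (DIM('a) - 2) * hn_quantile p)"
  proof (rule Bochner_Integration.integrable_bound[OF hn_quantile_integrable])
    show "AE p in unit_measure. norm (p ^ (DIM('a) - 2) * hn_quantile p) \<le> norm (hn_quantile p)"
      by (intro AE_I2) (auto simp: abs_mult intro!: mult_left_le_one_le power_le_one)
  qed measurable
qed

section \<open>The inequality for gauges and its equality case\<close>

context coordinate_gauge
begin

interpretation C: prob_space "cube (Basis :: 'a set)"
  by (rule prob_space_cube)

interpretation M: maximum_gauge "infnorm :: 'a \<Rightarrow> real"
  by (rule maximum_gauge_infnorm[OF dim])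

text \<open>The weight for Chebyshev's inequality: integrating X against \<open>wt\<close> gives the
  denominator, against \<open>wt\<close> times T/Q the lower bound of the numerator.\<close>

definition wt :: "real \<Rightarrow> real" where "wt p = p ^ (DIM('a) - 2) * hn_quantile p"

definition ratio :: "real \<Rightarrow> real" where "ratio p = tail_weight (DIM('a) - 1) p / hn_quantile p"

lemma wt_pos: "0 < p \<Longrightarrow> p < 1 \<Longrightarrow> 0 < wt p"
  by (simp add: wt_def hn_quantile_pos)

lemma wt_ratio: "p \<in> space unit_measure \<Longrightarrow> wt p * ratio p = p ^ (DIM('a) - 2) * tail_weight (DIM('a) - 1) p"
  using hn_quantile_pos[of p] by (simp add: wt_def ratio_def)

lemma wt_integrable: "integrable unit_measure wt" "integrable unit_measure (\<lambda>p. wt p * ratio p)"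
proof -
  show "integrable unit_measure wt" unfolding wt_def[abs_def] by (rule weights_integrable(2)[OF dim])
  have "integrable unit_measure (\<lambda>p. wt p * ratio p)
      \<longleftrightarrow> integrable unit_measure (\<lambda>p. p ^ (DIM('a) - 2) * tail_weight (DIM('a) - 1) p)"
    by (intro Bochner_Integration.integrable_cong refl wt_ratio)
  then show "integrable unit_measure (\<lambda>p. wt p * ratio p)" using weights_integrable(1)[OF dim] by simp
qed

lemma integrable_mult_shape_sum:
  assumes "integrable unit_measure h"
  shows "integrable unit_measure (\<lambda>p. h p * shape_sum p)"
proof -
  obtain B where B: "\<And>p. p \<in> space unit_measure \<Longrightarrow> \<bar>shape_sum p\<bar> \<le> B"
    using shape_sum_bounded by blast
  show ?thesis
  proof (rule Bochner_Integration.integrable_bound)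
    show "integrable unit_measure (\<lambda>p. B * h p)" using assms by simp
    show "(\<lambda>p. h p * shape_sum p) \<in> borel_measurable unit_measure"
      using assms shape_sum_meas by auto
    show "AE p in unit_measure. norm (h p * shape_sum p) \<le> norm (B * h p)"
    proof (rule AE_I2)
      fix p assume "p \<in> space unit_measure"
      then have "\<bar>shape_sum p\<bar> \<le> \<bar>B\<bar>" using B by fastforce
      then show "norm (h p * shape_sum p) \<le> norm (B * h p)"
        by (simp add: abs_mult mult.commute[of "\<bar>B\<bar>"] mult_left_mono)
    qed
  qed
qed

lemma den_real: "den = ennreal (\<integral>p. wt p * shape_sum p \<partial>unit_measure)"
  unfolding den_eq wt_def[symmetric] using wt_pos shape_sum_nonneg
  by (intro nn_integral_eq_integral integrable_mult_shape_sum wt_integrable AE_I2)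
    (auto intro!: mult_nonneg_nonneg intro: less_imp_le)

lemma num_min_real: "ennreal (\<integral>p. wt p * ratio p * shape_sum p \<partial>unit_measure) \<le> num_min"
proof -
  have "(\<integral>\<^sup>+p. ennreal (p ^ (DIM('a) - 2) * tail_weight (DIM('a) - 1) p * shape_sum p) \<partial>unit_measure)
      = (\<integral>\<^sup>+p. ennreal (wt p * ratio p * shape_sum p) \<partial>unit_measure)"
    by (intro nn_integral_cong) (simp only: wt_ratio)
  also have "\<dots> = ennreal (\<integral>p. wt p * ratio p * shape_sum p \<partial>unit_measure)"
    using shape_sum_nonneg tail_weight_nonneg
    by (intro nn_integral_eq_integral integrable_mult_shape_sum wt_integrable AE_I2)
      (auto simp: wt_ratio intro!: mult_nonneg_nonneg)
  finally show ?thesis using num_min_ge by simp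
qed

lemma ratio_strict_antimono: "0 < p \<Longrightarrow> p < q \<Longrightarrow> q < 1 \<Longrightarrow> ratio q < ratio p"
  unfolding ratio_def by (rule tail_weight_ratio_strict_antimono)

lemma chebyshev:
  shows "(\<integral>p. wt p * ratio p \<partial>unit_measure) * (\<integral>p. wt p * shape_sum p \<partial>unit_measure)
      \<le> (\<integral>p. wt p * ratio p * shape_sum p \<partial>unit_measure) * (\<integral>p. wt p \<partial>unit_measure)"
    and "(\<integral>p. wt p * ratio p \<partial>unit_measure) * (\<integral>p. wt p * shape_sum p \<partial>unit_measure)
      = (\<integral>p. wt p * ratio p * shape_sum p \<partial>unit_measure) * (\<integral>p. wt p \<partial>unit_measure)
      \<Longrightarrow> 0 < p \<Longrightarrow> p < 1 \<Longrightarrow> 0 < q \<Longrightarrow> q < 1 \<Longrightarrow> shape_sum p = shape_sum q"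
proof -
  note * = chebyshev_unit_measure[where w = wt and r = ratio and X = shape_sum]
  note i = wt_integrable integrable_mult_shape_sum[OF wt_integrable(1)] integrable_mult_shape_sum[OF wt_integrable(2)]
  show "(\<integral>p. wt p * ratio p \<partial>unit_measure) * (\<integral>p. wt p * shape_sum p \<partial>unit_measure)
      \<le> (\<integral>p. wt p * ratio p * shape_sum p \<partial>unit_measure) * (\<integral>p. wt p \<partial>unit_measure)"
    by (rule *(1)) (auto intro: wt_pos ratio_strict_antimono shape_sum_antimono i)
  assume "(\<integral>p. wt p * ratio p \<partial>unit_measure) * (\<integral>p. wt p * shape_sum p \<partial>unit_measure)
      = (\<integral>p. wt p * ratio p * shape_sum p \<partial>unit_measure) * (\<integral>p. wt p \<partial>unit_measure)"
    "0 < p" "p < 1" "0 < q" "q < 1"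
  then show "shape_sum p = shape_sum q"
    by (intro *(2)) (auto intro: wt_pos ratio_strict_antimono shape_sum_antimono i)
qed

lemma wt_integral_pos: "0 < (\<integral>p. wt p \<partial>unit_measure)"
proof -
  have nn: "AE p in unit_measure. 0 \<le> wt p" using wt_pos by (intro AE_I2) (auto intro: less_imp_le)
  have "(\<integral>p. wt p \<partial>unit_measure) \<noteq> 0"
  proof
    assume "(\<integral>p. wt p \<partial>unit_measure) = 0"
    then have "AE p in unit_measure. wt p = 0"
      using integral_nonneg_eq_0_iff_AE[OF wt_integrable(1) nn] by simp
    then show False using AE_unit_measure_witness[of "\<lambda>p. wt p = 0" 0 1] wt_pos by force
  qed
  moreover have "0 \<le> (\<integral>p. wt p \<partial>unit_measure)" using nn by (rule Bochner_Integration.integral_nonneg_AE)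
  ultimately show ?thesis by simp
qed

text \<open>The factor n (n - 1) counts the pairs (i, j), each with \<open>shape_mean\<close> equal
  to 1.\<close>

lemma max_values:
  "M.num = ennreal (real (DIM('a) * (DIM('a) - 1)) * (\<integral>p. wt p * ratio p \<partial>unit_measure))"
  "M.den = ennreal (real (DIM('a) * (DIM('a) - 1)) * (\<integral>p. wt p \<partial>unit_measure))"
proof -
  let ?c = "real (DIM('a) * (DIM('a) - 1))"
  have "M.num = (\<integral>\<^sup>+p. ennreal (wt p * ratio p * ?c) \<partial>unit_measure)"
    unfolding M.num_eq_num_min M.num_min_eq by (intro nn_integral_cong) (simp only: M.shape_sum_const wt_ratio)
  also have "\<dots> = ennreal (\<integral>p. wt p * ratio p * ?c \<partial>unit_measure)"
    using tail_weight_nonneg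
    by (intro nn_integral_eq_integral integrable_mult_left wt_integrable AE_I2)
      (auto simp: wt_ratio intro!: mult_nonneg_nonneg)
  finally show "M.num = ennreal (?c * (\<integral>p. wt p * ratio p \<partial>unit_measure))"
    by (simp add: mult.commute del: of_nat_mult)
  have "M.den = (\<integral>\<^sup>+p. ennreal (wt p * ?c) \<partial>unit_measure)"
    unfolding M.den_eq wt_def by (intro nn_integral_cong) (simp only: M.shape_sum_const)
  also have "\<dots> = ennreal (\<integral>p. wt p * ?c \<partial>unit_measure)"
    using wt_pos by (intro nn_integral_eq_integral integrable_mult_left wt_integrable AE_I2)
      (auto intro!: mult_nonneg_nonneg intro: less_imp_le)
  finally show "M.den = ennreal (?c * (\<integral>p. wt p \<partial>unit_measure))"
    by (simp add: mult.commute del: of_nat_mult)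
qed

lemma enn2real_num_ge: "(\<integral>p. wt p * ratio p * shape_sum p \<partial>unit_measure) \<le> enn2real num_min"
  "enn2real num_min \<le> enn2real num"
proof -
  have fin: "num_min < \<infinity>" using num_min_le_num num_finite by (rule le_less_trans)
  show "(\<integral>p. wt p * ratio p * shape_sum p \<partial>unit_measure) \<le> enn2real num_min"
    using enn2real_mono[OF num_min_real] fin
    by (cases "0 \<le> (\<integral>p. wt p * ratio p * shape_sum p \<partial>unit_measure)") (auto intro: order_trans[OF _ enn2real_nonneg])
  show "enn2real num_min \<le> enn2real num"
    using enn2real_mono[OF num_min_le_num] num_finite by simp
qed

lemma wt_ratio_integral_nonneg: "0 \<le> (\<integral>p. wt p * ratio p \<partial>unit_measure)"
  using tail_weight_nonneg
  by (intro Bochner_Integration.integral_nonneg_AE AE_I2) (auto simp: wt_ratio intro!: mult_nonneg_nonneg)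

lemma den_integral_nonneg: "0 \<le> (\<integral>p. wt p * shape_sum p \<partial>unit_measure)"
  using wt_pos shape_sum_nonneg
  by (intro Bochner_Integration.integral_nonneg_AE AE_I2) (auto intro!: mult_nonneg_nonneg intro: less_imp_le)

theorem num_den_ineq: "enn2real M.num * enn2real den \<le> enn2real num * enn2real M.den"
proof -
  let ?c = "real (DIM('a) * (DIM('a) - 1))" and ?W = "\<integral>p. wt p \<partial>unit_measure"
  have "(\<integral>p. wt p * ratio p \<partial>unit_measure) * (\<integral>p. wt p * shape_sum p \<partial>unit_measure)
      \<le> (\<integral>p. wt p * ratio p * shape_sum p \<partial>unit_measure) * ?W"
    by (rule chebyshev(1))
  also have "\<dots> \<le> enn2real num * ?W"
    using enn2real_num_ge wt_integral_pos by (intro mult_right_mono) auto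
  finally have "?c * ((\<integral>p. wt p * ratio p \<partial>unit_measure) * (\<integral>p. wt p * shape_sum p \<partial>unit_measure))
      \<le> ?c * (enn2real num * ?W)"
    by (rule mult_left_mono) simp
  then show ?thesis
    unfolding max_values den_real
    using wt_integral_pos wt_ratio_integral_nonneg den_integral_nonneg by (simp add: mult_ac)
qed

text \<open>Equality makes X constant. As \<open>p\<close> tends to 1, each
  \<open>shape_mean i j p\<close> tends to its lower bound \<open>f j\<close>, so by constancy all
  these bounds are attained already at p = 1/2. The shapes there have entries arbitrarily close to
  1, which settles vectors with a vanishing coordinate; equality of \<open>num\<close> and
  \<open>num_min\<close> then settles the full vector \<open>One\<close>.\<close>

theorem num_den_eq:
  assumes eq: "enn2real M.num * enn2real den = enn2real num * enn2real M.den" and dim3: "DIM('a) \<ge> 3"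
    and b: "b \<in> Basis"
  shows "f One = f b"
proof -
  let ?c = "real (DIM('a) * (DIM('a) - 1))" and ?W = "\<integral>p. wt p \<partial>unit_measure"
  let ?A = "\<integral>p. wt p * ratio p \<partial>unit_measure" and ?Y = "\<integral>p. wt p * shape_sum p \<partial>unit_measure"
  let ?Z = "\<integral>p. wt p * ratio p * shape_sum p \<partial>unit_measure"
  have c: "?c > 0" using dim by simp
  have "?c * (?A * ?Y) = ?c * (enn2real num * ?W)"
    using eq unfolding max_values den_real
    using wt_integral_pos wt_ratio_integral_nonneg den_integral_nonneg by (simp add: mult_ac)
  then have AY: "?A * ?Y = enn2real num * ?W" using c by (simp del: of_nat_mult)
  have ch: "?A * ?Y \<le> ?Z * ?W" by (rule chebyshev(1))
  \<comment> \<open>The chain from \<open>?A * ?Y\<close> to the numerator closes up, so Chebyshev,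
    the bound by shapes and the loss of the smallest coordinate are all tight.\<close>
  have Z: "?Z = enn2real num_min" "enn2real num_min = enn2real num"
  proof -
    have "enn2real num * ?W \<le> ?Z * ?W" using AY ch by simp
    then have "enn2real num \<le> ?Z" using wt_integral_pos by simp
    then show "?Z = enn2real num_min" "enn2real num_min = enn2real num" using enn2real_num_ge by auto
  qed
  have const: "shape_sum p = shape_sum q" if "0 < p" "p < 1" "0 < q" "q < 1" for p q
    using AY Z by (intro chebyshev(2) that) simp
  define S where "S = (\<Sum>i\<in>(Basis :: 'a set). \<Sum>j\<in>Basis - {i}. f j)"
  define C where "C = (\<Sum>b\<in>(Basis :: 'a set). (\<integral>x. hn_quantile x \<partial>unit_measure) * f b)"
  have mean_ge: "f j \<le> shape_mean i j p" if "i \<in> Basis" "j \<in> Basis - {i}" and p: "p \<in> space unit_measure" for i j p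
  proof -
    have "(\<integral>v. f j \<partial>cube (Basis :: 'a set)) \<le> shape_mean i j p"
      unfolding shape_mean_def
    proof (intro integral_mono_AE shape_integrable p AE_I2)
      fix v :: "'a \<Rightarrow> real" assume v: "v \<in> space (cube Basis)"
      have "f j = g (\<lambda>k. if k = j then 1 else 0)" using that by (intro f_Basis) auto
      also have "\<dots> \<le> g (shape i j p v)"
      proof (rule g_mono)
        fix b :: 'a assume "b \<in> Basis"
        then show "(if b = j then 1 else 0) \<le> shape i j p v b"
          using shape_bounds[OF p v, of b i j] that by (auto simp: shape_def)
      qed simp
      finally show "f j \<le> g (shape i j p v)" .
    qed simp
    then show ?thesis by (simp add: C.prob_space)
  qed
  \<comment> \<open>Since the quantile of p v is below that of v, the shape is at most the basis
    vector \<open>j\<close> plus the quantile vector divided by the quantile of \<open>p\<close>.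
    Subadditivity separates \<open>f j\<close> from an error that vanishes as \<open>p\<close> tends
    to 1.\<close>
  have mean_le: "shape_mean i j p \<le> f j + C / hn_quantile p"
    if "i \<in> Basis" "j \<in> Basis - {i}" and p: "p \<in> space unit_measure" for i j p
  proof -
    have q: "0 < hn_quantile p" using p by (auto intro: hn_quantile_pos)
    have "shape_mean i j p \<le> (\<integral>v. f j + (\<Sum>b\<in>Basis. hn_quantile (v b) / hn_quantile p * f b) \<partial>cube (Basis :: 'a set))"
      unfolding shape_mean_def
    proof (intro integral_mono_AE shape_integrable p AE_I2)
      show "integrable (cube Basis) (\<lambda>v. f j + (\<Sum>b\<in>Basis. hn_quantile (v b) / hn_quantile p * f b))"
        using quantile_coord_integral(1)
        by (intro Bochner_Integration.integrable_add Bochner_Integration.integrable_sum integrable_mult_left integrable_divide) auto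
      fix v :: "'a \<Rightarrow> real" assume v: "v \<in> space (cube Basis)"
      have "g (shape i j p v) \<le> f (of_coords (\<lambda>k. if k = j then 1 else 0) + of_coords (\<lambda>b. hn_quantile (v b) / hn_quantile p))"
      proof (rule f_mono)
        fix b :: 'a assume b: "b \<in> Basis"
        show "0 \<le> of_coords (shape i j p v) \<bullet> b" using shape_bounds(1)[OF p v b] b by simp
        have "hn_quantile (p * v b) < hn_quantile (v b)"
          using pv_unit[OF p v b] v b p by (intro hn_quantile_strict_mono) (auto simp: space_cube_iff)
        then have "hn_quantile (p * v b) / hn_quantile p \<le> hn_quantile (v b) / hn_quantile p"
          using q by (intro divide_right_mono) auto
        then show "of_coords (shape i j p v) \<bullet> b
            \<le> (of_coords (\<lambda>k. if k = j then 1 else 0) + of_coords (\<lambda>b. hn_quantile (v b) / hn_quantile p)) \<bullet> b"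
          using b q quantile_vec_pos[OF v b] by (auto simp: shape_def inner_add_left)
      qed
      also have "\<dots> \<le> g (\<lambda>k. if k = j then 1 else 0) + g (\<lambda>b. hn_quantile (v b) / hn_quantile p)"
        by (rule f_add)
      also have "g (\<lambda>k. if k = j then 1 else 0) = f j" using that by (intro f_Basis[symmetric]) auto
      also have "g (\<lambda>b. hn_quantile (v b) / hn_quantile p) \<le> (\<Sum>b\<in>Basis. hn_quantile (v b) / hn_quantile p * f b)"
        using q quantile_vec_pos[OF v] by (intro g_le_sum) (auto intro: less_imp_le)
      finally show "g (shape i j p v) \<le> f j + (\<Sum>b\<in>Basis. hn_quantile (v b) / hn_quantile p * f b)" by simp
    qed
    also have "\<dots> = f j + C / hn_quantile p"
    proof -
      have i: "integrable (cube Basis) (\<lambda>v. hn_quantile (v b) / hn_quantile p * f b)" if "b \<in> Basis" for b :: 'a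
        by (intro integrable_mult_left integrable_divide quantile_coord_integral(1) that)
      have "(\<integral>v. f j + (\<Sum>b\<in>Basis. hn_quantile (v b) / hn_quantile p * f b) \<partial>cube (Basis :: 'a set))
          = (\<integral>v. f j \<partial>cube (Basis :: 'a set)) + (\<integral>v. (\<Sum>b\<in>Basis. hn_quantile (v b) / hn_quantile p * f b) \<partial>cube (Basis :: 'a set))"
        by (intro Bochner_Integration.integral_add Bochner_Integration.integrable_sum i) auto
      also have "(\<integral>v. (\<Sum>b\<in>Basis. hn_quantile (v b) / hn_quantile p * f b) \<partial>cube (Basis :: 'a set))
          = (\<Sum>b\<in>(Basis :: 'a set). \<integral>v. hn_quantile (v b) / hn_quantile p * f b \<partial>cube Basis)"
        by (intro Bochner_Integration.integral_sum i)
      also have "\<dots> = C / hn_quantile p"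
        unfolding C_def sum_divide_distrib
        by (intro sum.cong refl) (simp add: quantile_coord_integral(2))
      finally show ?thesis by (simp add: C.prob_space)
    qed
    finally show ?thesis .
  qed
  have half: "1/2 \<in> space unit_measure" by simp
  have S: "shape_sum (1/2) \<le> S"
  proof (rule field_le_epsilon)
    fix e :: real assume e: "e > 0"
    \<comment> \<open>With the quantile of \<open>p\<close> equal to D / e, the total error is at
      most ?c |C| e / D <= e; the added 1 keeps \<open>D\<close> positive.\<close>
    define D where "D = ?c * \<bar>C\<bar> + 1"
    have D: "D > 0" unfolding D_def by (intro add_nonneg_pos mult_nonneg_nonneg) auto
    define p where "p = hn_cdf (D / e)"
    have p: "0 < p" "p < 1" "hn_quantile p = D / e"
      unfolding p_def using hn_quantile_cdf[of "D / e"] D e by auto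
    have "shape_sum (1/2) = shape_sum p" by (rule const) (use p in auto)
    also have "\<dots> \<le> (\<Sum>i\<in>(Basis :: 'a set). \<Sum>j\<in>Basis - {i}. f j + C / hn_quantile p)"
      unfolding shape_sum_def by (intro sum_mono mean_le) (use p in auto)
    also have "\<dots> = S + ?c * (C / hn_quantile p)" by (simp add: S_def sum.distrib)
    also have "?c * (C / hn_quantile p) \<le> ?c * (\<bar>C\<bar> / (D / e))"
      unfolding p(3) using D e by (intro mult_left_mono divide_right_mono) auto
    also have "\<dots> = (?c * \<bar>C\<bar>) * e / D" by simp
    also have "\<dots> \<le> D * e / D"
      using D e by (intro divide_right_mono mult_right_mono) (auto simp: D_def)
    also have "\<dots> = e" using D by simp
    finally show "shape_sum (1/2) \<le> S + e" by simp
  qed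
  have mean_eq: "shape_mean i j (1/2) = f j" if ij: "i \<in> Basis" "j \<in> Basis - {i}" for i j
  proof -
    have ge: "0 \<le> shape_mean i j (1/2) - f j" if "i \<in> Basis" "j \<in> Basis - {i}" for i j
      using mean_ge[OF that half] by simp
    have "(\<Sum>i\<in>(Basis :: 'a set). \<Sum>j\<in>Basis - {i}. shape_mean i j (1/2) - f j) = shape_sum (1/2) - S"
      by (simp add: shape_sum_def S_def sum_subtractf)
    also have "\<dots> \<le> 0" using S by simp
    finally have le: "(\<Sum>i\<in>(Basis :: 'a set). \<Sum>j\<in>Basis - {i}. shape_mean i j (1/2) - f j) \<le> 0" .
    have inner: "0 \<le> (\<Sum>j\<in>Basis - {i}. shape_mean i j (1/2) - f j)" if "i \<in> Basis" for i
      by (rule sum_nonneg) (rule ge[OF that])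
    have "0 \<le> (\<Sum>i\<in>(Basis :: 'a set). \<Sum>j\<in>Basis - {i}. shape_mean i j (1/2) - f j)"
      by (rule sum_nonneg) (rule inner)
    with le have "(\<Sum>i\<in>(Basis :: 'a set). \<Sum>j\<in>Basis - {i}. shape_mean i j (1/2) - f j) = 0" by (rule antisym)
    then have "\<forall>i\<in>(Basis :: 'a set). (\<Sum>j\<in>Basis - {i}. shape_mean i j (1/2) - f j) = 0"
      by (subst (asm) sum_nonneg_eq_0_iff[OF finite_Basis inner])
    then have "(\<Sum>j\<in>Basis - {i}. shape_mean i j (1/2) - f j) = 0" using ij(1) by blast
    then have "\<forall>j\<in>Basis - {i}. shape_mean i j (1/2) - f j = 0"
      by (subst (asm) sum_nonneg_eq_0_iff[OF _ ge[OF ij(1)]]) simp_all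
    then have "shape_mean i j (1/2) - f j = 0" using ij(2) by (rule bspec)
    then show ?thesis by simp
  qed
  have off: "g (\<lambda>b. if b = i then 0 else 1) \<le> f j" if ij: "i \<in> Basis" "j \<in> Basis - {i}" for i j
  proof (rule field_le_mult_one_interval)
    fix d :: real assume d: "0 < d" "d < 1"
    have q: "0 < hn_quantile (1/2)" by (rule hn_quantile_pos) auto
    let ?h = "\<lambda>v. g (shape i j (1/2) v) - f j"
    have nn: "AE v in cube Basis. 0 \<le> ?h v"
    proof (rule AE_I2)
      fix v :: "'a \<Rightarrow> real" assume v: "v \<in> space (cube Basis)"
      have "f j = g (\<lambda>k. if k = j then 1 else 0)" using ij by (intro f_Basis) auto
      also have "\<dots> \<le> g (shape i j (1/2) v)"
      proof (rule g_mono)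
        fix b :: 'a assume "b \<in> Basis"
        then show "(if b = j then 1 else 0) \<le> shape i j (1/2) v b"
          using shape_bounds[OF half v, of b i j] ij by (auto simp: shape_def)
      qed simp
      finally show "0 \<le> ?h v" by simp
    qed
    have ih: "integrable (cube Basis) ?h" using shape_integrable[OF half] by simp
    have "(\<integral>v. ?h v \<partial>cube Basis) = 0"
      using shape_integrable[OF half, of i j] mean_eq[OF ij] by (simp add: C.prob_space shape_mean_def)
    then have "AE v in cube Basis. ?h v = 0"
      using integral_nonneg_eq_0_iff_AE[OF ih nn] by simp
    \<comment> \<open>If all coordinates of \<open>v\<close> exceed \<open>w\<close>, then the
      quantile of v/2 exceeds \<open>d\<close> times the quantile of 1/2, so every entry of the
      shape except the one at \<open>i\<close> is at least \<open>d\<close>. Letting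
      \<open>d\<close> tend to 1 gives the vector of ones with entry \<open>i\<close>
      removed.\<close>
    moreover define w where "w = hn_cdf (d * hn_quantile (1/2)) / (1/2)"
    have x: "0 < d * hn_quantile (1/2)" using d q by simp
    have "hn_cdf (d * hn_quantile (1/2)) < hn_cdf (hn_quantile (1/2))"
      using d q by (intro hn_cdf_strict_mono) auto
    then have w: "0 < w" "w < 1" using hn_quantile_cdf(2)[OF x] by (auto simp: w_def hn_cdf_quantile)
    ultimately obtain v where v: "v \<in> space (cube Basis)" "?h v = 0" "\<And>k. k \<in> Basis \<Longrightarrow> w < v k"
      using AE_cube_box_witness[of "Basis :: 'a set" "\<lambda>v. ?h v = 0" w 1] by auto
    have "d * g (\<lambda>b. if b = i then 0 else 1) = g (\<lambda>b. d * (if b = i then 0 else 1))"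
      using d by (simp only: g_scale less_imp_le)
    also have "\<dots> \<le> g (shape i j (1/2) v)"
    proof (rule g_mono)
      fix b :: 'a assume b: "b \<in> Basis"
      show "0 \<le> d * (if b = i then 0 else 1)" using d by simp
      have "hn_cdf (d * hn_quantile (1/2)) < 1/2 * v b" using v(3)[OF b] by (simp add: w_def)
      then have "hn_quantile (hn_cdf (d * hn_quantile (1/2))) < hn_quantile (1/2 * v b)"
        using hn_quantile_cdf[OF x] pv_unit[OF half v(1) b] by (intro hn_quantile_strict_mono) auto
      then have "d * hn_quantile (1/2) < hn_quantile (1/2 * v b)" using hn_quantile_cdf[OF x] by simp
      then have "d \<le> hn_quantile (1/2 * v b) / hn_quantile (1/2)" using q by (simp add: field_simps)
      then show "d * (if b = i then 0 else 1) \<le> shape i j (1/2) v b" using d by (auto simp: shape_def)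
    qed
    also have "\<dots> = f j" using v(2) by simp
    finally show "d * g (\<lambda>b. if b = i then 0 else 1) \<le> f j" .
  qed
  have off_ge: "f k \<le> g (\<lambda>b. if b = i then 0 else 1)" if "i \<in> Basis" "k \<in> Basis - {i}" for i k
  proof -
    have "f k = g (\<lambda>b. if b = k then 1 else 0)" using that by (intro f_Basis) auto
    also have "\<dots> \<le> g (\<lambda>b. if b = i then 0 else 1)" using that by (intro g_mono) auto
    finally show ?thesis .
  qed
  \<comment> \<open>A third coordinate \<open>i\<close> makes the comparison: the vector of ones
    without entry \<open>i\<close> has both values \<open>f j\<close> and
    \<open>f b\<close>.\<close>
  have fc: "f j = f b" if j: "j \<in> Basis" for j
  proof -
    have "card {j, b} \<le> 2" by (simp add: card_insert_if)
    then have "\<not> Basis \<subseteq> {j, b}"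
      using dim3 card_mono[of "{j, b}" "Basis :: 'a set"] by auto
    then obtain i where i: "i \<in> Basis" "i \<noteq> j" "i \<noteq> b" by auto
    show ?thesis
      using off[of i j] off[of i b] off_ge[of i j] off_ge[of i b] i j b by fastforce
  qed
  have fb0: "0 \<le> f b" using b by (rule f_Basis_nonneg)
  \<comment> \<open>On vectors with a vanishing coordinate \<open>f\<close> is at most
    \<open>f b\<close> times the maximum norm, which bounds \<open>num\<close>, equal to
    \<open>num_min\<close>, from above. Monotonicity gives the reverse estimate pointwise for full
    vectors, so the integrands agree almost everywhere.\<close>
  have M_le: "f b * M.slice i v \<ge> slice i v" if i: "i \<in> Basis" and v: "v \<in> space (cube Basis)" for i v
  proof -
    let ?u = "\<lambda>b. if b = i then 0 else hn_quantile (v b)"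
    let ?m = "M.slice i v"
    have u: "0 \<le> ?u k" "?u k \<le> ?m" if "k \<in> Basis" for k
      using quantile_vec_pos[OF v that] Basis_le_infnorm[OF that, of "of_coords ?u"] that
      by (auto simp: M.slice_def)
    have m: "0 \<le> ?m" unfolding M.slice_def by (rule infnorm_pos_le)
    have "card (Basis - {i}) \<noteq> 0" using dim i by simp
    then have "Basis - {i} \<noteq> {}" by (metis card.empty)
    then obtain j where j: "j \<in> Basis - {i}" by blast
    have "slice i v \<le> g (\<lambda>b. ?m * (if b = i then 0 else 1))"
      unfolding slice_def
    proof (rule g_mono)
      fix k :: 'a assume k: "k \<in> Basis"
      show "0 \<le> ?u k" by (rule u(1)[OF k])
      show "?u k \<le> ?m * (if k = i then 0 else 1)" using u(2)[OF k] by (cases "k = i") auto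
    qed
    also have "\<dots> = ?m * g (\<lambda>b. if b = i then 0 else 1)" using m by (simp only: g_scale)
    also have "\<dots> \<le> ?m * f b" using off[OF i j] fc[of j] j m by (intro mult_left_mono) auto
    finally show ?thesis by (simp add: mult.commute)
  qed
  have "num_min \<le> ennreal (f b) * M.num_min"
  proof -
    have "num_min \<le> (\<Sum>i\<in>Basis. \<integral>\<^sup>+v. ennreal (f b) * (if \<forall>k\<in>Basis - {i}. v i < v k then ennreal (M.slice i v) else 0) \<partial>cube Basis)"
      unfolding num_min_def using M_le fb0 M.slice_le(2)
      by (intro sum_mono nn_integral_mono) (auto simp: ennreal_mult[symmetric] intro!: ennreal_leI)
    also have "\<dots> = ennreal (f b) * M.num_min"
      unfolding M.num_min_def sum_distrib_left
    proof (intro sum.cong refl nn_integral_cmult)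
      fix i :: 'a assume "i \<in> Basis"
      then show "(\<lambda>v. if \<forall>k\<in>Basis - {i}. v i < v k then ennreal (M.slice i v) else 0) \<in> borel_measurable (cube Basis)"
        using M.slice_meas[of i] by (intro measurable_If measurable_min_event) auto
    qed
    finally show ?thesis .
  qed
  then have "enn2real num_min \<le> f b * enn2real M.num"
    using enn2real_mono[of num_min "ennreal (f b) * M.num"] M.num_finite fb0
    by (simp add: M.num_eq_num_min[symmetric] enn2real_mult ennreal_mult_less_top)
  then have num_le: "enn2real num \<le> f b * enn2real M.num" using Z by simp
  let ?G = "\<lambda>v. g (\<lambda>b. hn_quantile (v b))"
  let ?I = "\<lambda>v. infnorm (of_coords (\<lambda>b. hn_quantile (v b)) :: 'a)"
  have Gnn: "0 \<le> ?G v" if "v \<in> space (cube Basis)" for v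
    using quantile_vec_pos[OF that] by (intro g_nonneg) (auto intro: less_imp_le)
  have iG: "integrable (cube Basis) ?G" and iI: "integrable (cube Basis) ?I"
    using num_finite M.num_finite Gnn infnorm_pos_le g_quantile_meas M.g_quantile_meas
    unfolding num_def M.num_def by (auto intro!: integrableI_nonneg AE_I2)
  have num_int: "enn2real num = (\<integral>v. ?G v \<partial>cube Basis)"
    unfolding num_def using iG Gnn by (subst nn_integral_eq_integral) (auto intro!: AE_I2 Bochner_Integration.integral_nonneg_AE)
  have M_int: "enn2real M.num = (\<integral>v. ?I v \<partial>cube Basis)"
    unfolding M.num_def using iI infnorm_pos_le by (subst nn_integral_eq_integral) (auto intro!: AE_I2 Bochner_Integration.integral_nonneg_AE)
  have G_ge: "0 \<le> ?G v - f b * ?I v" if v: "v \<in> space (cube Basis)" for v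
  proof -
    have fin: "finite ((\<lambda>k. hn_quantile (v k)) ` (Basis :: 'a set))" by simp
    have "Max ((\<lambda>k. hn_quantile (v k)) ` (Basis :: 'a set)) \<in> (\<lambda>k. hn_quantile (v k)) ` Basis"
      by (intro Max_in fin) auto
    then obtain m where m: "m \<in> Basis" "Max ((\<lambda>k. hn_quantile (v k)) ` (Basis :: 'a set)) = hn_quantile (v m)" by blast
    have le: "hn_quantile (v k) \<le> hn_quantile (v m)" if "k \<in> Basis" for k
      unfolding m(2)[symmetric] using that by (intro Max_ge fin) auto
    have I: "?I v = hn_quantile (v m)"
      using m(1) le quantile_vec_pos[OF v] by (intro M.is_max) (auto intro: less_imp_le)
    have "hn_quantile (v m) * f m = g (\<lambda>k. hn_quantile (v m) * (if k = m then 1 else 0))"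
      unfolding f_Basis[OF m(1)] using quantile_vec_pos[OF v m(1)] by (simp only: g_scale less_imp_le)
    also have "\<dots> \<le> ?G v"
      using quantile_vec_pos[OF v] m(1) by (intro g_mono) (auto intro: less_imp_le)
    finally show ?thesis using fc[OF m(1)] by (simp add: I mult.commute)
  qed
  have ih: "integrable (cube Basis) (\<lambda>v. ?G v - f b * ?I v)" using iG iI by simp
  have "(\<integral>v. ?G v - f b * ?I v \<partial>cube Basis) = enn2real num - f b * enn2real M.num"
    using iG iI by (simp add: num_int M_int)
  then have "(\<integral>v. ?G v - f b * ?I v \<partial>cube Basis) \<le> 0" using num_le by simp
  moreover have "0 \<le> (\<integral>v. ?G v - f b * ?I v \<partial>cube Basis)"
    by (intro Bochner_Integration.integral_nonneg_AE AE_I2 G_ge)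
  ultimately have "(\<integral>v. ?G v - f b * ?I v \<partial>cube Basis) = 0" by (rule antisym)
  then have ae: "AE v in cube Basis. ?G v - f b * ?I v = 0"
    using integral_nonneg_eq_0_iff_AE[OF ih AE_I2[OF G_ge]] by simp
  have "g (\<lambda>_. 1) \<le> f b"
  proof (rule field_le_mult_one_interval)
    fix d :: real assume d: "0 < d" "d < 1"
    \<comment> \<open>A point with levels between those of \<open>d\<close> and 1 has all its
      quantiles in [d,1]: it dominates the vector with all entries \<open>d\<close>, and its maximum
      norm is at most 1.\<close>
    have "hn_cdf d < hn_cdf 1" using d by (intro hn_cdf_strict_mono) auto
    then obtain v where v: "v \<in> space (cube Basis)" "?G v - f b * ?I v = 0"
      "\<And>k. k \<in> Basis \<Longrightarrow> hn_cdf d < v k \<and> v k < hn_cdf 1"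
      using AE_cube_box_witness[OF finite_Basis ae, of "hn_cdf d" "hn_cdf 1"] hn_quantile_cdf[of d] hn_quantile_cdf[of 1] d
      by auto
    have q: "d \<le> hn_quantile (v k)" "hn_quantile (v k) \<le> 1" if k: "k \<in> Basis" for k
    proof -
      have vk: "0 < v k" "v k < 1" using v(1) k by (auto simp: space_cube_iff)
      note Q = hn_quantile_cdf[OF d(1)] hn_quantile_cdf[of 1, OF zero_less_one]
      have "hn_quantile (hn_cdf d) < hn_quantile (v k)" "hn_quantile (v k) < hn_quantile (hn_cdf 1)"
        using v(3)[OF k] Q vk by (blast intro: hn_quantile_strict_mono)+
      then show "d \<le> hn_quantile (v k)" "hn_quantile (v k) \<le> 1" unfolding Q by auto
    qed
    have "d * g (\<lambda>_. 1) = g (\<lambda>_. d * 1)" using d by (simp only: g_scale less_imp_le)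
    also have "\<dots> \<le> ?G v" using q d by (intro g_mono) auto
    also have "\<dots> = f b * ?I v" using v(2) by simp
    also have "\<dots> \<le> f b * 1"
      using q quantile_vec_pos[OF v(1)] fb0 by (intro mult_left_mono) (auto simp: infnorm_le_iff less_imp_le abs_of_pos)
    finally show "d * g (\<lambda>_. 1) \<le> f b" by simp
  qed
  moreover have "f b \<le> g (\<lambda>_. 1)" unfolding f_Basis[OF b] by (intro g_mono) auto
  ultimately show ?thesis by simp
qed

end

subsection \<open>Symmetrization\<close>

definition drop_coord :: "'a::euclidean_space \<Rightarrow> 'a \<Rightarrow> 'a" where
  "drop_coord b x = x - (x \<bullet> b) *\<^sub>R b"

text \<open>Extensional functions, so that the set is finite and multiplication, restricted to
  \<open>Basis\<close>, is a group operation on it.\<close>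

definition signs :: "('a::euclidean_space \<Rightarrow> real) set" where
  "signs = Basis \<rightarrow>\<^sub>E {-1, 1}"

definition flip :: "('a::euclidean_space \<Rightarrow> real) \<Rightarrow> 'a \<Rightarrow> 'a" where
  "flip s x = (\<Sum>b\<in>Basis. (s b * (x \<bullet> b)) *\<^sub>R b)"

lemma drop_coord_inner: "b \<in> Basis \<Longrightarrow> k \<in> Basis \<Longrightarrow> drop_coord b x \<bullet> k = (if k = b then 0 else x \<bullet> k)"
  by (auto simp: drop_coord_def inner_diff_left inner_Basis)

lemma flip_inner [simp]: "b \<in> Basis \<Longrightarrow> flip s x \<bullet> b = s b * (x \<bullet> b)"
  by (simp add: flip_def)

lemma finite_signs [simp]: "finite signs"
  unfolding signs_def by (intro finite_PiE) auto

lemma signs_cases: "s \<in> signs \<Longrightarrow> b \<in> Basis \<Longrightarrow> s b = 1 \<or> s b = -1"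
  by (auto simp: signs_def PiE_iff)

lemma one_in_signs: "(\<lambda>b\<in>Basis. 1) \<in> signs"
  by (auto simp: signs_def)

lemma flip_one: "flip (\<lambda>b\<in>Basis. 1) x = x"
  by (rule euclidean_eqI) simp

lemma linear_flip: "linear (flip s)"
proof (rule linearI)
  show "flip s (x + y) = flip s x + flip s y" for x y
    by (rule euclidean_eqI) (simp add: inner_add_left algebra_simps)
  show "flip s (c *\<^sub>R x) = c *\<^sub>R flip s x" for c x
    by (rule euclidean_eqI) simp
qed

lemma norm_flip: "s \<in> signs \<Longrightarrow> norm (flip s x) = norm x"
proof -
  assume s: "s \<in> signs"
  have "(\<Sum>b\<in>Basis. (flip s x \<bullet> b) * (flip s x \<bullet> b)) = (\<Sum>b\<in>Basis. (x \<bullet> b) * (x \<bullet> b))"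
    by (rule sum.cong) (use signs_cases[OF s] in force)+
  then show ?thesis
    unfolding norm_eq_sqrt_inner euclidean_inner[of "flip s x" "flip s x"] euclidean_inner[of x x] by simp
qed

lemma flip_drop_coord: "b \<in> Basis \<Longrightarrow> flip s (drop_coord b x) = drop_coord b (flip s x)"
  by (rule euclidean_eqI) (simp add: drop_coord_inner)

lemma continuous_flip: "continuous_on UNIV (flip s)"
  using linear_flip linear_continuous_on linear_conv_bounded_linear by blast

lemma continuous_drop_coord: "continuous_on UNIV (drop_coord b)"
  unfolding drop_coord_def[abs_def] by (intro continuous_intros)

lemma integral_flip:
  fixes F :: "'a::euclidean_space \<Rightarrow> real"
  assumes s: "s \<in> signs" and [measurable]: "F \<in> borel_measurable borel"
  shows "(\<integral>x. F (flip s x) \<partial>lborel) = (\<integral>x. F x \<partial>lborel)"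
proof -
  have [measurable]: "flip s \<in> borel_measurable borel"
    by (intro borel_measurable_continuous_onI continuous_flip)
  have "lborel = density (distr lborel borel (\<lambda>x. 0 + (\<Sum>j\<in>Basis. (s j * (x \<bullet> j)) *\<^sub>R j))) (\<lambda>_. (\<Prod>j\<in>Basis. \<bar>s j\<bar>))"
    using signs_cases[OF s] by (intro lborel_affine_euclidean) force
  also have "(\<lambda>x. 0 + (\<Sum>j\<in>Basis. (s j * (x \<bullet> j)) *\<^sub>R j)) = flip s"
    by (simp add: flip_def[abs_def])
  also have "(\<Prod>j\<in>(Basis :: 'a set). \<bar>s j\<bar>) = 1"
    using signs_cases[OF s] by (intro prod.neutral) force
  finally have *: "lborel = distr lborel borel (flip s)" by (simp add: density_1)
  have "(\<integral>x. F x \<partial>lborel) = (\<integral>x. F x \<partial>distr lborel borel (flip s))"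
    by (subst *) (rule refl)
  then show ?thesis by (simp add: integral_distr)
qed

lemma gauss_mean_flip:
  fixes h :: "'a::euclidean_space \<Rightarrow> real"
  assumes "s \<in> signs" "h \<in> borel_measurable borel"
  shows "gauss_mean (\<lambda>x. h (flip s x)) = gauss_mean h"
  unfolding gauss_mean_def
  using integral_flip[OF assms(1), of "\<lambda>x. h x * exp (- (norm x)\<^sup>2 / 2)"] assms
  by (simp add: norm_flip)

text \<open>These are the support functions of compact sets containing the origin.\<close>
locale sublinear =
  fixes h :: "'a::euclidean_space \<Rightarrow> real"
  assumes nonneg: "\<And>x. 0 \<le> h x"
    and add: "\<And>x y. h (x + y) \<le> h x + h y"
    and scale: "\<And>c x. c \<ge> 0 \<Longrightarrow> h (c *\<^sub>R x) = c * h x"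
    and bound: "\<exists>R. \<forall>x. h x \<le> R * norm x"
begin

lemma zero: "h 0 = 0"
  using scale[of 0 0] by simp

lemma continuous: "continuous_on UNIV h"
proof (rule convex_on_continuous)
  show "convex_on UNIV h"
  proof (rule convex_onI)
    fix t :: real and x y :: 'a assume t: "0 < t" "t < 1"
    have "h ((1 - t) *\<^sub>R x + t *\<^sub>R y) \<le> h ((1 - t) *\<^sub>R x) + h (t *\<^sub>R y)" by (rule add)
    then show "h ((1 - t) *\<^sub>R x + t *\<^sub>R y) \<le> (1 - t) * h x + t * h y" using t by (simp add: scale)
  qed simp
qed simp

lemma measurable [measurable]: "h \<in> borel_measurable borel"
  by (intro borel_measurable_continuous_onI continuous)

lemma gauss_integrable: "integrable lborel (\<lambda>x. h x * exp (- (norm x)\<^sup>2 / 2))"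
proof -
  obtain R where "\<And>x. h x \<le> R * norm x" using bound by blast
  then show ?thesis using nonneg by (intro integrable_gauss_linear_growth[where R = R] measurable) simp
qed

lemma sublinear_comp:
  assumes T: "linear T" "\<And>x. norm (T x) \<le> norm x"
  shows "sublinear (\<lambda>x. h (T x))"
proof
  obtain R where R: "\<And>x. h x \<le> R * norm x" using bound by blast
  have "h (T x) \<le> \<bar>R\<bar> * norm x" for x
  proof -
    have "h (T x) \<le> R * norm (T x)" by (rule R)
    also have "\<dots> \<le> \<bar>R\<bar> * norm (T x)" by (intro mult_right_mono) auto
    also have "\<dots> \<le> \<bar>R\<bar> * norm x" by (intro mult_left_mono T) auto
    finally show ?thesis .
  qed
  then show "\<exists>R. \<forall>x. h (T x) \<le> R * norm x" by blast
qed (auto simp: nonneg add linear_add[OF T(1)] linear_cmul[OF T(1)] scale)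

end

lemma norm_drop_coord_le: "b \<in> Basis \<Longrightarrow> norm (drop_coord b x) \<le> norm x"
proof -
  assume b: "b \<in> Basis"
  have "(drop_coord b x) \<bullet> (drop_coord b x) = x \<bullet> x - (x \<bullet> b)\<^sup>2"
    using b by (simp add: drop_coord_def inner_diff_left inner_diff_right inner_commute power2_eq_square)
  then show ?thesis by (simp add: norm_le)
qed

lemma linear_drop_coord: "linear (drop_coord b)"
  unfolding drop_coord_def[abs_def] by (rule linearI) (simp_all add: algebra_simps inner_add_left)

lemma gauss_mean_nonneg: "(\<And>x. 0 \<le> f x) \<Longrightarrow> 0 \<le> gauss_mean f"
  unfolding gauss_mean_def by (intro Bochner_Integration.integral_nonneg) simp

lemma gauss_mean_sum:
  assumes "\<And>s. s \<in> S \<Longrightarrow> sublinear (F s)"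
  shows "gauss_mean (\<lambda>x. \<Sum>s\<in>S. F s x) = (\<Sum>s\<in>S. gauss_mean (F s))"
  unfolding gauss_mean_def sum_distrib_right
  by (intro Bochner_Integration.integral_sum sublinear.gauss_integrable assms)

lemma flip_eq_reflect:
  assumes "b \<in> Basis"
  shows "x - (2 * (x \<bullet> b)) *\<^sub>R b = flip (\<lambda>k\<in>Basis. if k = b then -1 else 1) x"
    "(\<lambda>k\<in>Basis. if k = b then -1 else 1) \<in> signs"
proof -
  show "x - (2 * (x \<bullet> b)) *\<^sub>R b = flip (\<lambda>k\<in>Basis. if k = b then -1 else 1) x"
  proof (rule euclidean_eqI)
    fix k :: 'a assume "k \<in> Basis"
    then show "(x - (2 * (x \<bullet> b)) *\<^sub>R b) \<bullet> k = flip (\<lambda>k\<in>Basis. if k = b then -1 else 1) x \<bullet> k"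
      using assms by (simp add: inner_diff_left inner_Basis)
  qed
  show "(\<lambda>k\<in>Basis. if k = b then -1 else 1) \<in> signs" by (auto simp: signs_def)
qed

text \<open>The factor (2 pi)^(n/2) is the same for numerator and denominator and cancels, so
  \<open>gauss_mean\<close> can stay unnormalized.\<close>

lemma gauss_mean_eq_num:
  fixes f :: "'a::euclidean_space \<Rightarrow> real"
  assumes f: "sublinear f" and even: "\<And>s x. s \<in> signs \<Longrightarrow> f (flip s x) = f x"
    and g: "coordinate_gauge f"
  shows "gauss_mean f = sqrt (2 * pi) ^ DIM('a) * enn2real (coordinate_gauge.num f)"
    and "(\<Sum>b\<in>Basis. gauss_mean (\<lambda>x. f (drop_coord b x)))
      = sqrt (2 * pi) ^ DIM('a) * enn2real (coordinate_gauge.den f)"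
proof -
  interpret f: sublinear f by (rule f)
  interpret g: coordinate_gauge f by (rule g)
  have c: "0 \<le> sqrt (2 * pi) ^ DIM('a)" by simp
  have real: "gauss_mean k = sqrt (2 * pi) ^ DIM('a) *
      enn2real (\<integral>\<^sup>+v. ennreal (k (of_coords (\<lambda>b. hn_quantile (v b)))) \<partial>cube Basis)"
    if k: "sublinear k" and e: "\<And>s x. s \<in> signs \<Longrightarrow> k (flip s x) = k x" for k :: "'a \<Rightarrow> real"
  proof -
    interpret k: sublinear k by (rule k)
    have "gauss_mean k = enn2real (\<integral>\<^sup>+x. ennreal (k x * exp (- (norm x)\<^sup>2 / 2)) \<partial>lborel)"
      unfolding gauss_mean_def using k.nonneg by (intro integral_eq_nn_integral) auto
    also have "(\<integral>\<^sup>+x. ennreal (k x * exp (- (norm x)\<^sup>2 / 2)) \<partial>lborel) = ennreal (sqrt (2 * pi) ^ DIM('a)) *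
        (\<integral>\<^sup>+v. ennreal (k (of_coords (\<lambda>b. hn_quantile (v b)))) \<partial>cube Basis)"
    proof (rule nn_integral_gauss_cube)
      fix x b :: 'a assume b: "b \<in> Basis"
      show "k (x - (2 * (x \<bullet> b)) *\<^sub>R b) = k x"
        unfolding flip_eq_reflect(1)[OF b] by (rule e[OF flip_eq_reflect(2)[OF b]])
    qed (simp_all add: k.nonneg)
    finally show ?thesis by (simp add: enn2real_mult)
  qed
  show "gauss_mean f = sqrt (2 * pi) ^ DIM('a) * enn2real (coordinate_gauge.num f)"
    unfolding g.num_def using f even by (rule real)
  have drop: "drop_coord i (of_coords u) = of_coords (\<lambda>b. if b = i then 0 else u b)" if "i \<in> Basis" for i u
    by (rule euclidean_eqI) (simp add: drop_coord_inner that)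
  have "gauss_mean (\<lambda>x. f (drop_coord b x)) = sqrt (2 * pi) ^ DIM('a) *
      enn2real (\<integral>\<^sup>+v. ennreal (g.slice b v) \<partial>cube Basis)" if b: "b \<in> Basis" for b
    unfolding g.slice_def drop[OF b, symmetric]
  proof (rule real)
    show "sublinear (\<lambda>x. f (drop_coord b x))"
      by (intro f.sublinear_comp linear_drop_coord norm_drop_coord_le b)
    show "f (drop_coord b (flip s x)) = f (drop_coord b x)" if "s \<in> signs" for s x
      using even[OF that, of "drop_coord b x"] by (simp add: flip_drop_coord b)
  qed
  moreover have "(\<integral>\<^sup>+v. ennreal (g.slice b v) \<partial>cube Basis) < \<infinity>" if b: "b \<in> Basis" for b
    using g.num_finite unfolding g.num_def
    by (rule le_less_trans[rotated]) (intro nn_integral_mono ennreal_leI g.slice_le)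
  ultimately show "(\<Sum>b\<in>Basis. gauss_mean (\<lambda>x. f (drop_coord b x)))
      = sqrt (2 * pi) ^ DIM('a) * enn2real (coordinate_gauge.den f)"
    unfolding g.den_def by (simp add: enn2real_sum sum_distrib_left)
qed

context sublinear
begin

text \<open>A sum in place of the average: the factor \<open>card signs\<close> multiplies numerator
  and denominator alike.\<close>

definition sym :: "'a \<Rightarrow> real" where
  "sym x = (\<Sum>s\<in>signs. h (flip s x))"

lemma sublinear_flip: "s \<in> signs \<Longrightarrow> sublinear (\<lambda>x. h (flip s x))"
  by (intro sublinear_comp linear_flip) (simp add: norm_flip)

lemma sublinear_sym: "sublinear sym"
proof
  show "0 \<le> sym x" for x unfolding sym_def by (intro sum_nonneg nonneg)
  show "sym (x + y) \<le> sym x + sym y" for x y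
    unfolding sym_def sum.distrib[symmetric] linear_add[OF linear_flip] by (intro sum_mono add)
  show "sym (c *\<^sub>R x) = c * sym x" if "c \<ge> 0" for c x
    unfolding sym_def using that by (simp add: linear_cmul[OF linear_flip] scale sum_distrib_left)
  obtain R where R: "\<And>x. h x \<le> R * norm x" using bound by blast
  have "sym x \<le> (\<Sum>s\<in>(signs :: ('a \<Rightarrow> real) set). R * norm x)" for x
    unfolding sym_def
  proof (rule sum_mono)
    fix s :: "'a \<Rightarrow> real" assume "s \<in> signs"
    then show "h (flip s x) \<le> R * norm x" using R[of "flip s x"] by (simp add: norm_flip)
  qed
  then show "\<exists>R. \<forall>x. sym x \<le> R * norm x"
    by (intro exI[of _ "real (card (signs :: ('a \<Rightarrow> real) set)) * R"]) (simp add: mult.assoc)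
qed

text \<open>Multiplication by \<open>s\<close> is an involution of \<open>signs\<close>, so it only
  permutes the summands.\<close>

lemma sym_flip:
  assumes s: "s \<in> signs"
  shows "sym (flip s x) = sym x"
proof -
  let ?m = "\<lambda>t. \<lambda>b\<in>Basis. t b * s b :: real"
  have m: "?m t \<in> signs" "?m (?m t) = t" if "t \<in> signs" for t
  proof -
    show "?m t \<in> signs" using signs_cases[OF that] signs_cases[OF s] by (auto simp: signs_def) force
    show "?m (?m t) = t"
    proof
      fix b show "?m (?m t) b = t b"
        using signs_cases[OF s, of b] that by (cases "b \<in> Basis") (auto simp: signs_def PiE_iff extensional_def)
    qed
  qed
  have "flip t (flip s x) = flip (?m t) x" for t
    by (rule euclidean_eqI) simp
  then have "sym (flip s x) = (\<Sum>t\<in>signs. h (flip (?m t) x))" by (simp add: sym_def)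
  also have "\<dots> = sym x"
    unfolding sym_def using m by (intro sum.reindex_bij_witness[of _ ?m ?m]) auto
  finally show ?thesis .
qed

text \<open>Along a line in direction \<open>b\<close>, \<open>sym\<close> is convex and even about
  the coordinate hyperplane, hence it does not decrease with the distance from that
  hyperplane.\<close>

lemma sym_convex_step:
  assumes b: "b \<in> Basis" and z: "z \<bullet> b = 0" and a: "\<bar>a\<bar> \<le> c"
  shows "sym (z + a *\<^sub>R b) \<le> sym (z + c *\<^sub>R b)"
proof (cases "c = 0")
  case False
  then have c: "c > 0" using a by simp
  interpret S: sublinear sym by (rule sublinear_sym)
  have refl: "sym (z - c *\<^sub>R b) = sym (z + c *\<^sub>R b)"
  proof -
    have "(z + c *\<^sub>R b) - (2 * ((z + c *\<^sub>R b) \<bullet> b)) *\<^sub>R b = z - c *\<^sub>R b"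
      using b z by (simp add: inner_add_left algebra_simps flip: scaleR_add_left)
    then show ?thesis using sym_flip[OF flip_eq_reflect(2)[OF b], of "z + c *\<^sub>R b"] flip_eq_reflect(1)[OF b, of "z + c *\<^sub>R b"]
      by simp
  qed
  \<comment> \<open>The weight for which \<open>a\<close> is the convex combination of
    \<open>c\<close> and \<open>- c\<close>.\<close>
  define l where "l = (1 + a / c) / 2"
  have l: "0 \<le> l" "0 \<le> 1 - l" using a c by (auto simp: l_def field_simps abs_le_iff)
  have "l * c - (1 - l) * c = a" using c by (simp add: l_def field_simps)
  moreover have "l *\<^sub>R (z + c *\<^sub>R b) + (1 - l) *\<^sub>R (z - c *\<^sub>R b) = z + (l * c - (1 - l) * c) *\<^sub>R b"
    by (rule euclidean_eqI) (simp add: inner_add_left inner_diff_left algebra_simps)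
  ultimately have "z + a *\<^sub>R b = l *\<^sub>R (z + c *\<^sub>R b) + (1 - l) *\<^sub>R (z - c *\<^sub>R b)" by simp
  then have "sym (z + a *\<^sub>R b) \<le> sym (l *\<^sub>R (z + c *\<^sub>R b)) + sym ((1 - l) *\<^sub>R (z - c *\<^sub>R b))"
    using S.add by simp
  also have "\<dots> = l * sym (z + c *\<^sub>R b) + (1 - l) * sym (z - c *\<^sub>R b)"
    using l by (simp only: S.scale)
  also have "\<dots> = sym (z + c *\<^sub>R b)" unfolding refl by (simp add: algebra_simps)
  finally show ?thesis .
qed (use a in simp)

text \<open>The coordinates of \<open>x\<close> are raised to those of \<open>y\<close> one at a
  time, each by \<open>sym_convex_step\<close>.\<close>

lemma sym_mono:
  assumes "\<And>b. b \<in> Basis \<Longrightarrow> 0 \<le> x \<bullet> b" "\<And>b. b \<in> Basis \<Longrightarrow> x \<bullet> b \<le> y \<bullet> b"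
  shows "sym x \<le> sym y"
proof -
  let ?w = "\<lambda>A. of_coords (\<lambda>b. if b \<in> A then y \<bullet> b else x \<bullet> b) :: 'a"
  have "finite A \<Longrightarrow> A \<subseteq> Basis \<Longrightarrow> sym x \<le> sym (?w A)" for A
  proof (induction A rule: finite_induct)
    case empty
    then show ?case by (simp add: euclidean_representation)
  next
    case (insert b A)
    then have b: "b \<in> Basis" by simp
    let ?z = "of_coords (\<lambda>k. if k = b then 0 else if k \<in> A then y \<bullet> k else x \<bullet> k) :: 'a"
    have "?w A = ?z + (x \<bullet> b) *\<^sub>R b"
      by (rule euclidean_eqI) (use b insert.hyps in \<open>simp add: inner_add_left inner_Basis\<close>)
    moreover have "?w (insert b A) = ?z + (y \<bullet> b) *\<^sub>R b"
      by (rule euclidean_eqI) (use b insert.hyps in \<open>simp add: inner_add_left inner_Basis\<close>)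
    moreover have "sym (?z + (x \<bullet> b) *\<^sub>R b) \<le> sym (?z + (y \<bullet> b) *\<^sub>R b)"
      using b assms[OF b] by (intro sym_convex_step) auto
    ultimately show ?case using insert by simp
  qed
  from this[OF finite_Basis order_refl] show ?thesis by (simp add: euclidean_representation)
qed

lemma coordinate_gauge_sym:
  assumes "DIM('a) \<ge> 2"
  shows "coordinate_gauge sym"
proof -
  interpret S: sublinear sym by (rule sublinear_sym)
  show ?thesis
    by standard (auto intro: S.measurable S.scale S.add sym_mono assms)
qed

lemma gauss_mean_sym:
  "gauss_mean sym = real (card (signs :: ('a \<Rightarrow> real) set)) * gauss_mean h"
  "(\<Sum>b\<in>Basis. gauss_mean (\<lambda>x. sym (drop_coord b x)))
    = real (card (signs :: ('a \<Rightarrow> real) set)) * (\<Sum>b\<in>Basis. gauss_mean (\<lambda>x. h (drop_coord b x)))"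
proof -
  have "gauss_mean sym = (\<Sum>s\<in>(signs :: ('a \<Rightarrow> real) set). gauss_mean (\<lambda>x. h (flip s x)))"
    unfolding sym_def[abs_def] by (rule gauss_mean_sum) (rule sublinear_flip)
  then show "gauss_mean sym = real (card (signs :: ('a \<Rightarrow> real) set)) * gauss_mean h"
    by (simp add: gauss_mean_flip)
  have "gauss_mean (\<lambda>x. sym (drop_coord b x)) = real (card (signs :: ('a \<Rightarrow> real) set)) * gauss_mean (\<lambda>x. h (drop_coord b x))"
    if b: "b \<in> Basis" for b
  proof -
    interpret D: sublinear "\<lambda>x. h (drop_coord b x)"
      by (intro sublinear_comp linear_drop_coord norm_drop_coord_le b)
    have "gauss_mean (\<lambda>x. sym (drop_coord b x)) = gauss_mean (\<lambda>x. \<Sum>s\<in>signs. h (drop_coord b (flip s x)))"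
      unfolding sym_def by (simp add: flip_drop_coord b)
    also have "\<dots> = (\<Sum>s\<in>(signs :: ('a \<Rightarrow> real) set). gauss_mean (\<lambda>x. h (drop_coord b (flip s x))))"
      by (rule gauss_mean_sum) (rule D.sublinear_flip)
    finally show ?thesis using gauss_mean_flip[OF _ D.measurable] by simp
  qed
  then show "(\<Sum>b\<in>Basis. gauss_mean (\<lambda>x. sym (drop_coord b x)))
    = real (card (signs :: ('a \<Rightarrow> real) set)) * (\<Sum>b\<in>Basis. gauss_mean (\<lambda>x. h (drop_coord b x)))"
    by (simp add: sum_distrib_left)
qed

end

lemma infnorm_flip: "s \<in> signs \<Longrightarrow> infnorm (flip s x) = infnorm x"
  unfolding infnorm_Max by (intro arg_cong[where f = Max] image_cong) (auto simp: abs_mult dest: signs_cases)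

lemma sublinear_infnorm: "sublinear (infnorm :: 'a::euclidean_space \<Rightarrow> real)"
proof
  show "\<exists>R. \<forall>x :: 'a. infnorm x \<le> R * norm x" by (intro exI[of _ 1]) (simp add: infnorm_le_norm)
qed (auto simp: infnorm_pos_le infnorm_triangle infnorm_mul)

context sublinear
begin

text \<open>Stated with products, since positivity of the denominators is established for concrete
  support functions later.\<close>

theorem gauss_mean_ineq:
  assumes dim: "DIM('a) \<ge> 2"
  shows "gauss_mean (infnorm :: 'a \<Rightarrow> real) * (\<Sum>b\<in>Basis. gauss_mean (\<lambda>x. h (drop_coord b x)))
    \<le> gauss_mean h * (\<Sum>b\<in>Basis. gauss_mean (\<lambda>x :: 'a. infnorm (drop_coord b x)))"
    and "gauss_mean (infnorm :: 'a \<Rightarrow> real) * (\<Sum>b\<in>Basis. gauss_mean (\<lambda>x. h (drop_coord b x)))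
    = gauss_mean h * (\<Sum>b\<in>Basis. gauss_mean (\<lambda>x :: 'a. infnorm (drop_coord b x)))
      \<Longrightarrow> DIM('a) \<ge> 3 \<Longrightarrow> b \<in> Basis \<Longrightarrow> sym One = sym b"
proof -
  interpret G: coordinate_gauge sym by (rule coordinate_gauge_sym[OF dim])
  interpret M: maximum_gauge "infnorm :: 'a \<Rightarrow> real" by (rule maximum_gauge_infnorm[OF dim])
  let ?k = "real (card (signs :: ('a \<Rightarrow> real) set))" and ?c = "sqrt (2 * pi) ^ DIM('a)"
  have c: "?c > 0" by simp
  have k: "?k > 0" using one_in_signs by (auto simp: card_gt_0_iff)
  note S = gauss_mean_eq_num[OF sublinear_sym sym_flip coordinate_gauge_sym[OF dim]]
  note I = gauss_mean_eq_num[OF sublinear_infnorm infnorm_flip M.coordinate_gauge_axioms]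
  have L: "?k * (gauss_mean (infnorm :: 'a \<Rightarrow> real) * (\<Sum>b\<in>Basis. gauss_mean (\<lambda>x. h (drop_coord b x))))
      = ?c * ?c * (enn2real M.num * enn2real G.den)"
    using gauss_mean_sym(2) S(2) I(1) by (simp add: mult_ac)
  have R: "?k * (gauss_mean h * (\<Sum>b\<in>Basis. gauss_mean (\<lambda>x :: 'a. infnorm (drop_coord b x))))
      = ?c * ?c * (enn2real G.num * enn2real M.den)"
    using gauss_mean_sym(1) S(1) I(2) by (simp add: mult_ac)
  have "?c * ?c * (enn2real M.num * enn2real G.den) \<le> ?c * ?c * (enn2real G.num * enn2real M.den)"
    using c G.num_den_ineq by (intro mult_left_mono) auto
  then show "gauss_mean (infnorm :: 'a \<Rightarrow> real) * (\<Sum>b\<in>Basis. gauss_mean (\<lambda>x. h (drop_coord b x)))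
    \<le> gauss_mean h * (\<Sum>b\<in>Basis. gauss_mean (\<lambda>x :: 'a. infnorm (drop_coord b x)))"
    unfolding L[symmetric] R[symmetric] using k by (rule mult_left_le_imp_le)
  assume eq: "gauss_mean (infnorm :: 'a \<Rightarrow> real) * (\<Sum>b\<in>Basis. gauss_mean (\<lambda>x. h (drop_coord b x)))
    = gauss_mean h * (\<Sum>b\<in>Basis. gauss_mean (\<lambda>x :: 'a. infnorm (drop_coord b x)))"
    and dim3: "DIM('a) \<ge> 3" and b: "b \<in> Basis"
  have "?c * ?c * (enn2real M.num * enn2real G.den) = ?c * ?c * (enn2real G.num * enn2real M.den)"
    unfolding L[symmetric] R[symmetric] using eq by simp
  then have "enn2real M.num * enn2real G.den = enn2real G.num * enn2real M.den" using c by simp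
  then show "sym One = sym b" using dim3 b by (rule G.num_den_eq)
qed

end

subsection \<open>Rigidity in the equality case\<close>

lemma infnorm_attained:
  fixes x :: "'a::euclidean_space"
  obtains b where "b \<in> Basis" "infnorm x = \<bar>x \<bullet> b\<bar>"
proof -
  have "Max ((\<lambda>i. \<bar>x \<bullet> i\<bar>) ` Basis) \<in> (\<lambda>i. \<bar>x \<bullet> i\<bar>) ` Basis"
    by (intro Max_in) auto
  then obtain b where "b \<in> Basis" "Max ((\<lambda>i. \<bar>x \<bullet> i\<bar>) ` Basis) = \<bar>x \<bullet> b\<bar>" by blast
  then show thesis using that by (simp add: infnorm_Max)
qed

lemma infnorm_eqI:
  fixes x :: "'a::euclidean_space"
  assumes "b \<in> Basis" "\<bar>\<sigma>\<bar> = 1" "\<And>j. j \<in> Basis \<Longrightarrow> \<bar>x \<bullet> j\<bar> \<le> \<sigma> * (x \<bullet> b)"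
  shows "infnorm x = \<sigma> * (x \<bullet> b)"
proof (rule antisym)
  have "0 \<le> \<sigma> * (x \<bullet> b)" using assms(3)[OF assms(1)] by linarith
  then show "infnorm x \<le> \<sigma> * (x \<bullet> b)" using assms(3) by (simp add: infnorm_le_iff)
  have "\<sigma> * (x \<bullet> b) \<le> \<bar>\<sigma>\<bar> * \<bar>x \<bullet> b\<bar>" by (metis abs_ge_self abs_mult)
  also have "\<dots> \<le> infnorm x" using assms(1,2) Basis_le_infnorm by simp
  finally show "\<sigma> * (x \<bullet> b) \<le> infnorm x" .
qed

context sublinear
begin

text \<open>After a flip, \<open>x\<close> lies coordinatewise between \<open>infnorm x\<close>
  times a basis vector and \<open>infnorm x\<close> times \<open>One\<close>, and \<open>sym\<close>
  takes the same value at both ends.\<close>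

lemma sym_eq_infnorm:
  assumes "\<And>b. b \<in> Basis \<Longrightarrow> sym One = sym b"
  shows "sym x = sym One * infnorm x"
proof -
  interpret S: sublinear sym by (rule sublinear_sym)
  define s where "s = (\<lambda>b\<in>Basis. if x \<bullet> b < 0 then -1 else 1 :: real)"
  have s: "s \<in> signs" by (auto simp: s_def signs_def)
  let ?y = "flip s x" and ?m = "infnorm x"
  have y: "?y \<bullet> b = \<bar>x \<bullet> b\<bar>" if "b \<in> Basis" for b using that by (simp add: s_def)
  have m: "0 \<le> ?m" by (rule infnorm_pos_le)
  have "sym ?y \<le> sym (?m *\<^sub>R One)"
    using y Basis_le_infnorm[of _ x] by (intro sym_mono) (auto simp: inner_Basis inner_sum_left_Basis)
  then have le: "sym ?y \<le> ?m * sym One" by (simp only: S.scale[OF m])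
  obtain b where b: "b \<in> Basis" "?m = \<bar>x \<bullet> b\<bar>" by (rule infnorm_attained)
  have "sym (?m *\<^sub>R b) \<le> sym ?y"
    using y b m by (intro sym_mono) (auto simp: inner_Basis)
  then have "?m * sym One \<le> sym ?y" by (simp only: S.scale[OF m] assms[OF b(1)])
  with le have "sym ?y = ?m * sym One" by (rule antisym)
  then show ?thesis using sym_flip[OF s, of x] by (simp add: mult.commute)
qed

text \<open>The subadditivity defects of the reflected copies of \<open>h\<close> are nonnegative
  and add up to the defect of \<open>sym\<close>, which is 0 here. The trivial sign vector gives the
  defect of \<open>h\<close> itself.\<close>

lemma additive_if_infnorm_additive:
  assumes "\<And>b. b \<in> Basis \<Longrightarrow> sym One = sym b" and eq: "infnorm (x + y) = infnorm x + infnorm y"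
  shows "h (x + y) = h x + h y"
proof -
  let ?d = "\<lambda>s. h (flip s x) + h (flip s y) - h (flip s (x + y))"
  have nn: "0 \<le> ?d s" for s
    using add[of "flip s x" "flip s y"] by (simp add: linear_add[OF linear_flip])
  have sym_v: "sym v = sym One * infnorm v" for v
    by (rule sym_eq_infnorm) (rule assms(1))
  have "sym (x + y) = sym x + sym y"
    using sym_v[of "x + y"] sym_v[of x] sym_v[of y] eq by (simp only: distrib_left)
  then have "(\<Sum>s\<in>signs. ?d s) = 0" by (simp add: sym_def sum.distrib sum_subtractf)
  then have "\<forall>s\<in>signs. ?d s = 0"
    by (subst (asm) sum_nonneg_eq_0_iff) (rule finite_signs nn | assumption)+
  from bspec[OF this one_in_signs] show ?thesis by (simp add: flip_one)
qed

text \<open>The maximum norm is additive on each cone in which one signed coordinate dominates,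
  hence so is \<open>h\<close>. Subtracting the linear function \<open>z\<close> makes the values at
  \<open>b\<close> and \<open>- b\<close> agree. Additivity then determines the values at basis
  vectors, at sums of two signed ones, and by induction everywhere.\<close>

theorem rigidity:
  assumes "\<And>b. b \<in> Basis \<Longrightarrow> sym One = sym b" and dim: "DIM('a) \<ge> 3"
  shows "\<exists>z a. a \<ge> 0 \<and> (\<forall>x. h x = z \<bullet> x + a * infnorm x)"
proof -
  define z where "z = (\<Sum>b\<in>Basis. ((h b - h (- b)) / 2) *\<^sub>R b)"
  define k where "k x = h x - z \<bullet> x" for x
  define \<alpha> where "\<alpha> b = (h b + h (- b)) / 2" for b
  have k_scale: "k (c *\<^sub>R x) = c * k x" if "c \<ge> 0" for c x
    using that by (simp add: k_def scale right_diff_distrib)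
  have k_basis: "k (\<sigma> *\<^sub>R b) = \<alpha> b" if "b \<in> Basis" "\<sigma> = 1 \<or> \<sigma> = -1" for b \<sigma>
    using that by (auto simp: k_def z_def \<alpha>_def field_simps)
  have k_add: "k (x + y) = k x + k y"
    if "b \<in> Basis" "\<sigma> = 1 \<or> \<sigma> = -1" "\<And>j. j \<in> Basis \<Longrightarrow> \<bar>x \<bullet> j\<bar> \<le> \<sigma> * (x \<bullet> b)"
      "\<And>j. j \<in> Basis \<Longrightarrow> \<bar>y \<bullet> j\<bar> \<le> \<sigma> * (y \<bullet> b)" for x y b \<sigma>
  proof -
    have \<sigma>: "\<bar>\<sigma>\<bar> = 1" using that(2) by auto
    have "\<bar>(x + y) \<bullet> j\<bar> \<le> \<sigma> * ((x + y) \<bullet> b)" if "j \<in> Basis" for j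
    proof -
      have "\<bar>(x + y) \<bullet> j\<bar> \<le> \<bar>x \<bullet> j\<bar> + \<bar>y \<bullet> j\<bar>" by (simp add: inner_add_left)
      also have "\<dots> \<le> \<sigma> * (x \<bullet> b) + \<sigma> * (y \<bullet> b)"
        using \<open>\<And>j. j \<in> Basis \<Longrightarrow> \<bar>x \<bullet> j\<bar> \<le> \<sigma> * (x \<bullet> b)\<close>[OF that]
          \<open>\<And>j. j \<in> Basis \<Longrightarrow> \<bar>y \<bullet> j\<bar> \<le> \<sigma> * (y \<bullet> b)\<close>[OF that] by linarith
      finally show ?thesis by (simp add: inner_add_left distrib_left)
    qed
    then have "infnorm (x + y) = \<sigma> * ((x + y) \<bullet> b)" by (rule infnorm_eqI[OF that(1) \<sigma>])
    also have "\<dots> = \<sigma> * (x \<bullet> b) + \<sigma> * (y \<bullet> b)"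
      by (simp add: inner_add_left distrib_left)
    also have "\<dots> = infnorm x + infnorm y"
      using infnorm_eqI[OF that(1) \<sigma>, of x] infnorm_eqI[OF that(1) \<sigma>, of y] that(3,4)
      by simp
    finally have "h (x + y) = h x + h y" by (rule additive_if_infnorm_additive[rotated]) (rule assms(1))
    then show ?thesis by (simp add: k_def inner_add_right)
  qed
  have edge: "k (\<sigma> *\<^sub>R b + \<tau> *\<^sub>R c) + k (\<sigma> *\<^sub>R b - \<tau> *\<^sub>R c) = 2 * \<alpha> b"
    if "b \<in> Basis" "c \<in> Basis" "b \<noteq> c" "\<sigma> = 1 \<or> \<sigma> = -1" "\<tau> = 1 \<or> \<tau> = -1" for b c \<sigma> \<tau>
  proof -
    have "k ((\<sigma> *\<^sub>R b + \<tau> *\<^sub>R c) + (\<sigma> *\<^sub>R b - \<tau> *\<^sub>R c)) = k (\<sigma> *\<^sub>R b + \<tau> *\<^sub>R c) + k (\<sigma> *\<^sub>R b - \<tau> *\<^sub>R c)"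
      using that by (intro k_add[of b \<sigma>]) (auto simp: inner_add_left inner_diff_left inner_Basis)
    moreover have "(\<sigma> *\<^sub>R b + \<tau> *\<^sub>R c) + (\<sigma> *\<^sub>R b - \<tau> *\<^sub>R c) = 2 *\<^sub>R (\<sigma> *\<^sub>R b)"
      unfolding scaleR_2 by simp
    ultimately show ?thesis using k_scale[of 2 "\<sigma> *\<^sub>R b"] k_basis that by simp
  qed
  \<comment> \<open>The four sums of a signed \<open>b\<close> and a signed \<open>c\<close> form
    two edges around \<open>b\<close> directions and also two around \<open>c\<close> directions.
    The total is 4 times \<open>\<alpha> b\<close> by the first count and 4 times
    \<open>\<alpha> c\<close> by the second.\<close>
  have \<alpha>_eq: "\<alpha> b = \<alpha> c" if "b \<in> Basis" "c \<in> Basis" for b c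
  proof (cases "b = c")
    case False
    show ?thesis
      using edge[of b c 1 1] edge[of b c "-1" 1] edge[of c b 1 1] edge[of c b "-1" 1] that False
      by (simp add: add.commute[of c b] add.commute[of "- c" b] add.commute[of c "- b"] minus_diff_commute[of c b])
  qed simp
  obtain b0 :: 'a where b0: "b0 \<in> Basis" using nonempty_Basis by blast
  define a where "a = \<alpha> b0"
  have \<alpha>: "\<alpha> b = a" if "b \<in> Basis" for b unfolding a_def using \<alpha>_eq that b0 by blast
  \<comment> \<open>Two decompositions of one vector, with 2 \<sigma> at \<open>b\<close>, \<tau> at
    \<open>c\<close> and \<rho> at \<open>d\<close>, inside the cone in which \<sigma> b
    dominates.\<close>
  have triple: "k (\<sigma> *\<^sub>R b + \<tau> *\<^sub>R c) + k (\<sigma> *\<^sub>R b + \<rho> *\<^sub>R d) = a + k (\<sigma> *\<^sub>R b + \<tau> *\<^sub>R c + \<rho> *\<^sub>R d)"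
    if "b \<in> Basis" "c \<in> Basis" "d \<in> Basis" "b \<noteq> c" "b \<noteq> d" "c \<noteq> d"
      "\<sigma> = 1 \<or> \<sigma> = -1" "\<tau> = 1 \<or> \<tau> = -1" "\<rho> = 1 \<or> \<rho> = -1" for b c d \<sigma> \<tau> \<rho>
  proof -
    have "k ((\<sigma> *\<^sub>R b + \<tau> *\<^sub>R c) + (\<sigma> *\<^sub>R b + \<rho> *\<^sub>R d)) = k (\<sigma> *\<^sub>R b + \<tau> *\<^sub>R c) + k (\<sigma> *\<^sub>R b + \<rho> *\<^sub>R d)"
      using that by (intro k_add[of b \<sigma>]) (auto simp: inner_add_left inner_Basis)
    moreover have "k (\<sigma> *\<^sub>R b + (\<sigma> *\<^sub>R b + \<tau> *\<^sub>R c + \<rho> *\<^sub>R d)) = k (\<sigma> *\<^sub>R b) + k (\<sigma> *\<^sub>R b + \<tau> *\<^sub>R c + \<rho> *\<^sub>R d)"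
      using that by (intro k_add[of b \<sigma>]) (auto simp: inner_add_left inner_Basis)
    moreover have "(\<sigma> *\<^sub>R b + \<tau> *\<^sub>R c) + (\<sigma> *\<^sub>R b + \<rho> *\<^sub>R d) = \<sigma> *\<^sub>R b + (\<sigma> *\<^sub>R b + \<tau> *\<^sub>R c + \<rho> *\<^sub>R d)"
      by (simp add: add_ac)
    ultimately show ?thesis using k_basis[of b \<sigma>] \<alpha>[of b] that by simp
  qed
  \<comment> \<open>\<open>triple\<close> is used around \<open>c\<close> and around
    \<open>d\<close>; the sum of all three signed vectors and the sum of those at \<open>c\<close>
    and \<open>d\<close> occur in both and cancel.\<close>
  have swap: "k (\<sigma> *\<^sub>R b + \<tau> *\<^sub>R c) = k (\<sigma> *\<^sub>R b + \<rho> *\<^sub>R d)"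
    if *: "b \<in> Basis" "c \<in> Basis" "d \<in> Basis" "b \<noteq> c" "b \<noteq> d" "c \<noteq> d"
      "\<sigma> = 1 \<or> \<sigma> = -1" "\<tau> = 1 \<or> \<tau> = -1" "\<rho> = 1 \<or> \<rho> = -1" for b c d \<sigma> \<tau> \<rho>
  proof -
    have "k (\<tau> *\<^sub>R c + \<sigma> *\<^sub>R b) + k (\<tau> *\<^sub>R c + \<rho> *\<^sub>R d) = a + k (\<tau> *\<^sub>R c + \<sigma> *\<^sub>R b + \<rho> *\<^sub>R d)"
      using * by (intro triple) auto
    moreover have "k (\<rho> *\<^sub>R d + \<sigma> *\<^sub>R b) + k (\<rho> *\<^sub>R d + \<tau> *\<^sub>R c) = a + k (\<rho> *\<^sub>R d + \<sigma> *\<^sub>R b + \<tau> *\<^sub>R c)"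
      using * by (intro triple) auto
    moreover have "\<tau> *\<^sub>R c + \<sigma> *\<^sub>R b = \<sigma> *\<^sub>R b + \<tau> *\<^sub>R c" "\<rho> *\<^sub>R d + \<sigma> *\<^sub>R b = \<sigma> *\<^sub>R b + \<rho> *\<^sub>R d"
      "\<rho> *\<^sub>R d + \<tau> *\<^sub>R c = \<tau> *\<^sub>R c + \<rho> *\<^sub>R d"
      "\<sigma> *\<^sub>R b + \<rho> *\<^sub>R d + \<tau> *\<^sub>R c = \<sigma> *\<^sub>R b + \<tau> *\<^sub>R c + \<rho> *\<^sub>R d"
      by (simp_all only: add_ac)
    ultimately show ?thesis by simp
  qed
  \<comment> \<open>Through a third basis vector \<open>d\<close> the values for both signs at
    \<open>c\<close> coincide, and by \<open>edge\<close> they add up to 2 a.\<close>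
  have pair: "k (\<sigma> *\<^sub>R b + \<tau> *\<^sub>R c) = a"
    if *: "b \<in> Basis" "c \<in> Basis" "b \<noteq> c" "\<sigma> = 1 \<or> \<sigma> = -1" "\<tau> = 1 \<or> \<tau> = -1" for b c \<sigma> \<tau>
  proof -
    have "card {b, c} \<le> 2" by (simp add: card_insert_if)
    then have "\<not> Basis \<subseteq> {b, c}" using dim card_mono[of "{b, c}" "Basis :: 'a set"] by auto
    then obtain d where d: "d \<in> Basis" "d \<noteq> b" "d \<noteq> c" by auto
    have "k (\<sigma> *\<^sub>R b + \<tau> *\<^sub>R c) = k (\<sigma> *\<^sub>R b + 1 *\<^sub>R d)"
      using * d by (intro swap) auto
    moreover have "k (\<sigma> *\<^sub>R b + (- \<tau>) *\<^sub>R c) = k (\<sigma> *\<^sub>R b + 1 *\<^sub>R d)"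
      using * d by (intro swap) auto
    moreover have "k (\<sigma> *\<^sub>R b + \<tau> *\<^sub>R c) + k (\<sigma> *\<^sub>R b - \<tau> *\<^sub>R c) = 2 * a"
      using edge[OF *] \<alpha>[OF *(1)] by simp
    ultimately show ?thesis by simp
  qed
  have main: "k x = a * infnorm x" for x
  proof -
    obtain b where b: "b \<in> Basis" "infnorm x = \<bar>x \<bullet> b\<bar>" by (rule infnorm_attained)
    define m where "m = infnorm x"
    define \<sigma> :: real where "\<sigma> = (if x \<bullet> b < 0 then -1 else 1)"
    have \<sigma>: "\<sigma> = 1 \<or> \<sigma> = -1" "x \<bullet> b = m * \<sigma>" "\<sigma> * \<sigma> = 1" by (auto simp: \<sigma>_def m_def b(2))
    have m: "0 \<le> m" "\<And>j. j \<in> Basis \<Longrightarrow> \<bar>x \<bullet> j\<bar> \<le> m"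
      unfolding m_def using infnorm_pos_le Basis_le_infnorm by auto
    define w where "w A = (of_coords (\<lambda>j. if j = b \<or> j \<in> A then x \<bullet> j else 0) :: 'a)" for A
    have w: "w A \<bullet> j = (if j = b \<or> j \<in> A then x \<bullet> j else 0)" if "j \<in> Basis" for A j
      using that by (simp add: w_def)
    have "finite A \<Longrightarrow> A \<subseteq> Basis - {b} \<Longrightarrow> k (w A) = a * m" for A
    proof (induction A rule: finite_induct)
      case empty
      have "w {} = m *\<^sub>R (\<sigma> *\<^sub>R b)"
        by (rule euclidean_eqI) (use b \<sigma> w in \<open>auto simp: inner_Basis\<close>)
      then have "k (w {}) = m * k (\<sigma> *\<^sub>R b)" by (simp only: k_scale[OF m(1)])
      then show ?case using k_basis[OF b(1) \<sigma>(1)] \<alpha>[OF b(1)] by simp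
    next
      case (insert c A)
      then have c: "c \<in> Basis" "c \<noteq> b" and IH: "k (w A) = a * m" by auto
      define t where "t = \<bar>x \<bullet> c\<bar>"
      define \<tau> :: real where "\<tau> = (if x \<bullet> c < 0 then -1 else 1)"
      have \<tau>: "\<tau> = 1 \<or> \<tau> = -1" "x \<bullet> c = t * \<tau>" by (auto simp: \<tau>_def t_def)
      have t: "0 \<le> t" "t \<le> m" unfolding t_def using m(2)[OF c(1)] by auto
      have wb: "\<sigma> * (w B \<bullet> b) = m" for B using w[OF b(1)] \<sigma> by simp
      have wj: "\<bar>w B \<bullet> j\<bar> \<le> \<sigma> * (w B \<bullet> b)" if "j \<in> Basis" for B j
        unfolding wb using w[OF that, of B] m that by auto
      \<comment> \<open>All four summands lie in the cone of \<sigma> b, so \<open>k\<close> is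
        additive on both sides. The two terms with factor \<open>t\<close> have the same value t a,
        so inserting coordinate \<open>c\<close> leaves the value of \<open>k\<close>
        unchanged.\<close>
      have e: "w (insert c A) + t *\<^sub>R (\<sigma> *\<^sub>R b) = w A + t *\<^sub>R (\<sigma> *\<^sub>R b + \<tau> *\<^sub>R c)"
        by (rule euclidean_eqI)
          (use w b c insert.hyps \<tau> in \<open>auto simp: inner_add_left inner_Basis\<close>)
      have "k (w (insert c A) + t *\<^sub>R (\<sigma> *\<^sub>R b)) = k (w (insert c A)) + k (t *\<^sub>R (\<sigma> *\<^sub>R b))"
      proof (rule k_add[OF b(1) \<sigma>(1) wj])
        fix j :: 'a assume "j \<in> Basis"
        then show "\<bar>(t *\<^sub>R (\<sigma> *\<^sub>R b)) \<bullet> j\<bar> \<le> \<sigma> * ((t *\<^sub>R (\<sigma> *\<^sub>R b)) \<bullet> b)"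
          using t b \<sigma>(1) by (auto simp: inner_Basis)
      qed
      moreover have "k (w A + t *\<^sub>R (\<sigma> *\<^sub>R b + \<tau> *\<^sub>R c)) = k (w A) + k (t *\<^sub>R (\<sigma> *\<^sub>R b + \<tau> *\<^sub>R c))"
      proof (rule k_add[OF b(1) \<sigma>(1) wj])
        fix j :: 'a assume "j \<in> Basis"
        then show "\<bar>(t *\<^sub>R (\<sigma> *\<^sub>R b + \<tau> *\<^sub>R c)) \<bullet> j\<bar> \<le> \<sigma> * ((t *\<^sub>R (\<sigma> *\<^sub>R b + \<tau> *\<^sub>R c)) \<bullet> b)"
          using t b c \<sigma>(1) \<tau>(1) by (auto simp: inner_Basis inner_add_left)
      qed
      moreover have "k (t *\<^sub>R (\<sigma> *\<^sub>R b)) = t * a"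
        by (simp only: k_scale[OF t(1)] k_basis[OF b(1) \<sigma>(1)] \<alpha>[OF b(1)])
      moreover have "k (t *\<^sub>R (\<sigma> *\<^sub>R b + \<tau> *\<^sub>R c)) = t * a"
        by (simp only: k_scale[OF t(1)] pair[OF b(1) c(1) c(2)[symmetric] \<sigma>(1) \<tau>(1)])
      ultimately show ?case using e IH by simp
    qed
    from this[of "Basis - {b}"] have "k (w (Basis - {b})) = a * m" by simp
    moreover have "w (Basis - {b}) = x"
      by (rule euclidean_eqI) (use w in auto)
    ultimately show ?thesis by (simp add: m_def)
  qed
  have "a \<ge> 0" unfolding a_def \<alpha>_def using nonneg by simp
  moreover have "h x = z \<bullet> x + a * infnorm x" for x using main[of x] by (simp add: k_def)
  ultimately show ?thesis by blast
qed

end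

section \<open>Positivity of Gaussian means; support functions determine convex bodies\<close>

lemma gauss_mean_pos:
  assumes f: "sublinear f" and x: "f x > 0"
  shows "gauss_mean f > 0"
proof -
  interpret sublinear f by (rule f)
  let ?g = "\<lambda>x. f x * exp (- (norm x)\<^sup>2 / 2)"
  have "gauss_mean f \<noteq> 0"
  proof
    assume "gauss_mean f = 0"
    then have "AE x in lborel. ?g x = 0"
      unfolding gauss_mean_def using integral_nonneg_eq_0_iff_AE[OF gauss_integrable] nonneg by simp
    then have "AE x in lborel. \<not> 0 < f x" by eventually_elim auto
    then have "AE x in lebesgue. x \<notin> {x. 0 < f x}" by (auto simp: AE_completion)
    then have "negligible {x. 0 < f x}"
      by (simp add: negligible_iff_null_sets AE_iff_null_sets open_Collect_less continuous borel_open)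
    moreover have "open {x. 0 < f x}"
      by (intro open_Collect_less continuous continuous_intros)
    ultimately show False using x open_not_negligible by blast
  qed
  then show ?thesis using gauss_mean_nonneg[OF nonneg] by (simp add: order_less_le)
qed

lemma sublinear_support_fun:
  fixes K :: "'a::euclidean_space set"
  assumes "compact K" "0 \<in> K"
  shows "sublinear (support_fun K)"
proof
  have ne: "K \<noteq> {}" using assms(2) by auto
  obtain R where R: "\<And>y. y \<in> K \<Longrightarrow> norm y \<le> R"
    using compact_imp_bounded[OF assms(1)] by (auto simp: bounded_iff)
  show "0 \<le> support_fun K x" for x using support_fun_bound(1)[OF assms R] .
  show "\<exists>R. \<forall>x. support_fun K x \<le> R * norm x" using support_fun_bound(2)[OF assms R] by blast
  show "support_fun K (x + y) \<le> support_fun K x + support_fun K y" for x y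
    by (rule support_fun_add_le[OF assms(1) ne])
  show "support_fun K (c *\<^sub>R x) = c * support_fun K x" if "c \<ge> 0" for c x
    by (rule support_fun_scale[OF assms(1) ne that])
qed

text \<open>\<open>drop_coord b\<close> is an orthogonal projection and therefore
  self-adjoint.\<close>

lemma support_fun_drop_coord:
  fixes K :: "'a::euclidean_space set"
  assumes "b \<in> Basis"
  shows "support_fun (drop_coord b ` K) x = support_fun K (drop_coord b x)"
proof -
  have "x \<bullet> drop_coord b y = drop_coord b x \<bullet> y" for y
    by (simp add: drop_coord_def inner_diff_left inner_diff_right inner_commute)
  then show ?thesis by (simp add: support_fun_def image_image)
qed

text \<open>A point of \<open>K\<close> outside \<open>L\<close> is separated from \<open>L\<close>
  by a hyperplane, and in its normal direction the support function of \<open>K\<close> is the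
  larger one.\<close>

lemma support_fun_subset:
  fixes K L :: "'a::euclidean_space set"
  assumes "compact K" "K \<noteq> {}" "compact L" "convex L" "L \<noteq> {}" "\<And>x. support_fun K x \<le> support_fun L x"
  shows "K \<subseteq> L"
proof
  fix y assume y: "y \<in> K"
  show "y \<in> L"
  proof (rule ccontr)
    assume "y \<notin> L"
    then obtain u c where u: "u \<bullet> y < c" "\<forall>x\<in>L. c < u \<bullet> x"
      using separating_hyperplane_closed_point[OF assms(4) compact_imp_closed[OF assms(3)]] by blast
    obtain w where w: "w \<in> L" "support_fun L (- u) = (- u) \<bullet> w"
      by (rule support_fun_attained[OF assms(3,5), of "- u"])
    have "(- u) \<bullet> y \<le> support_fun K (- u)" by (rule support_fun_upper[OF assms(1) y])
    also have "\<dots> \<le> - (u \<bullet> w)" using assms(6)[of "- u"] w(2) by simp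
    also have "\<dots> < - c" using u(2) w(1) by simp
    finally show False using u(1) by simp
  qed
qed

lemma support_fun_inject:
  fixes K L :: "'a::euclidean_space set"
  assumes "compact K" "convex K" "K \<noteq> {}" "compact L" "convex L" "L \<noteq> {}"
    "\<And>x. support_fun K x = support_fun L x"
  shows "K = L"
  using support_fun_subset[of K L] support_fun_subset[of L K] assms by auto

lemma support_fun_affine_image:
  fixes K :: "'a::euclidean_space set"
  assumes "compact K" "K \<noteq> {}" "r \<ge> 0"
  shows "support_fun ((\<lambda>y. z + r *\<^sub>R y) ` K) x = z \<bullet> x + r * support_fun K x"
proof -
  obtain y where y: "y \<in> K" "support_fun K x = x \<bullet> y" "\<And>w. w \<in> K \<Longrightarrow> x \<bullet> w \<le> x \<bullet> y"
    by (rule support_fun_attained[OF assms(1,2), of x]) (rule that)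
  have "support_fun ((\<lambda>y. z + r *\<^sub>R y) ` K) x = x \<bullet> (z + r *\<^sub>R y)"
    unfolding support_fun_def
  proof (rule cSup_eq_maximum)
    show "x \<bullet> (z + r *\<^sub>R y) \<in> (\<bullet>) x ` (\<lambda>y. z + r *\<^sub>R y) ` K" using y(1) by blast
    fix t assume "t \<in> (\<bullet>) x ` (\<lambda>y. z + r *\<^sub>R y) ` K"
    then show "t \<le> x \<bullet> (z + r *\<^sub>R y)"
      using y(3) assms(3) by (auto simp: inner_add_right intro!: mult_left_mono)
  qed
  then show ?thesis by (simp add: y(2) inner_add_right inner_commute)
qed

subsection \<open>Projections and cross-polytopes\<close>

lemma intrinsic_volume_translation:
  "intrinsic_volume m ((+) x ` K) = intrinsic_volume m K"
proof -
  have "((+) x ` K) + T = (+) x ` (K + T)" for T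
    by (force simp: set_plus_def add.assoc)
  then show ?thesis
    unfolding intrinsic_volume_def by (simp add: measure_translation)
qed

lemma aff_dim_ge_1_iff:
  fixes K :: "'a::euclidean_space set"
  shows "aff_dim K \<ge> 1 \<longleftrightarrow> (\<exists>x\<in>K. \<exists>y\<in>K. x \<noteq> y)"
proof
  assume K: "aff_dim K \<ge> 1"
  then have "K \<noteq> {}" by auto
  then obtain x where x: "x \<in> K" by blast
  have "K \<noteq> {x}" using K by auto
  with x show "\<exists>x\<in>K. \<exists>y\<in>K. x \<noteq> y" by blast
next
  assume *: "\<exists>x\<in>K. \<exists>y\<in>K. x \<noteq> y"
  then have "aff_dim K \<noteq> -1" by (auto simp: aff_dim_empty[symmetric])
  moreover have "aff_dim K \<noteq> 0" using * by (auto simp: aff_dim_eq_0)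
  ultimately show "aff_dim K \<ge> 1" using aff_dim_geq[of K] by linarith
qed

lemma bij_betw_axis: "bij_betw (\<lambda>i. axis i 1) UNIV (Basis :: (real ^ 'n::finite) set)"
  by (auto simp: bij_betw_def inj_on_def axis_eq_axis Basis_vec_def)

lemma coord_projection_eq: "coord_projection i K = drop_coord (axis i 1) ` K"
  by (simp add: coord_projection_def drop_coord_def)

definition gauss_ratio :: "('a::euclidean_space \<Rightarrow> real) \<Rightarrow> real" where
  "gauss_ratio h = gauss_mean h / (\<Sum>b\<in>Basis. gauss_mean (\<lambda>x. h (drop_coord b x)))"

text \<open>Moving a point of \<open>K\<close> to the origin makes the support function nonnegative
  and changes no intrinsic volume. The projections are sets in the same space, so the constant
  \<open>c\<close> is the same for them and cancels.\<close>

lemma width_ratio_eq_gauss_ratio: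
  fixes K :: "(real ^ 'n::finite) set"
  assumes K: "compact K" "convex K" "x \<in> K"
  shows "width_ratio K = gauss_ratio (support_fun ((+) (- x) ` K))"
proof -
  let ?L = "(+) (- x) ` K"
  obtain c where c: "c > 0" and V: "\<And>K :: (real ^ 'n) set. compact K \<Longrightarrow> convex K \<Longrightarrow> 0 \<in> K \<Longrightarrow>
      intrinsic_volume 1 K = c * gauss_mean (support_fun K)"
    using intrinsic_volume_1_gauss_mean by blast
  have L: "compact ?L" "convex ?L" "0 \<in> ?L"
    using K by (auto simp: compact_translation_subtract convex_translation image_iff intro!: compact_translation bexI[of _ x])
  have num: "intrinsic_volume 1 K = c * gauss_mean (support_fun ?L)"
    using V[OF L] by (simp only: intrinsic_volume_translation)
  have den: "intrinsic_volume 1 (coord_projection i K)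
      = c * gauss_mean (\<lambda>y. support_fun ?L (drop_coord (axis i 1) y))" for i
  proof -
    let ?d = "drop_coord (axis i 1) :: real ^ 'n \<Rightarrow> real ^ 'n"
    have "(+) (?d (- x)) ` ?d ` K = ?d ` ?L"
      unfolding image_image by (rule image_cong) (simp_all only: linear_add[OF linear_drop_coord])
    then have "intrinsic_volume 1 (coord_projection i K) = intrinsic_volume 1 (?d ` ?L)"
      by (metis coord_projection_eq intrinsic_volume_translation)
    also have "\<dots> = c * gauss_mean (support_fun (?d ` ?L))"
    proof (rule V)
      show "compact (?d ` ?L)"
        by (intro compact_continuous_image L continuous_on_subset[OF continuous_drop_coord]) simp
      show "convex (?d ` ?L)" by (intro convex_linear_image linear_drop_coord L)
      show "0 \<in> ?d ` ?L" using L(3) linear_0[OF linear_drop_coord, of "axis i 1"] by (metis imageI)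
    qed
    also have "support_fun (?d ` ?L) = (\<lambda>y. support_fun ?L (?d y))"
      by (rule ext, rule support_fun_drop_coord) simp
    finally show ?thesis .
  qed
  have "(\<Sum>i\<in>UNIV. intrinsic_volume 1 (coord_projection i K))
      = c * (\<Sum>i\<in>UNIV. gauss_mean (\<lambda>y. support_fun ?L (drop_coord (axis i 1) y)))"
    unfolding den by (rule sum_distrib_left[symmetric])
  also have "(\<Sum>i\<in>UNIV. gauss_mean (\<lambda>y. support_fun ?L (drop_coord (axis i 1) y)))
      = (\<Sum>b\<in>Basis. gauss_mean (\<lambda>y. support_fun ?L (drop_coord b y)))"
    by (rule sum.reindex_bij_betw[OF bij_betw_axis])
  finally show ?thesis using c num by (simp add: width_ratio_def gauss_ratio_def)
qed

text \<open>Some coordinate \<open>b\<close> of \<open>y\<close> is nonzero and survives when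
  another coordinate \<open>c\<close> is dropped. At \<open>drop_coord c y\<close> the support
  function is then at least the squared length of that vector.\<close>

lemma gauss_denominator_pos:
  fixes K :: "'a::euclidean_space set"
  assumes K: "compact K" "0 \<in> K" "y \<in> K" "y \<noteq> 0" and dim: "DIM('a) \<ge> 2"
  shows "(\<Sum>b\<in>Basis. gauss_mean (\<lambda>x. support_fun K (drop_coord b x))) > 0"
proof -
  interpret sublinear "support_fun K" by (rule sublinear_support_fun[OF K(1,2)])
  obtain b where b: "b \<in> Basis" "y \<bullet> b \<noteq> 0" using K(4) by (auto simp: euclidean_eq_iff[of y 0])
  have "\<not> Basis \<subseteq> {b}" using dim card_mono[of "{b}" "Basis :: 'a set"] by auto
  then obtain c where c: "c \<in> Basis" "c \<noteq> b" by auto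
  have "drop_coord c y \<bullet> y = drop_coord c y \<bullet> drop_coord c y"
    using c(1) by (simp add: drop_coord_def inner_diff_left inner_diff_right inner_commute)
  moreover have "drop_coord c y \<noteq> 0"
    using drop_coord_inner[OF c(1) b(1), of y] b(2) c(2) by (metis inner_zero_left)
  ultimately have "drop_coord c y \<bullet> y > 0" by simp
  then have "support_fun K (drop_coord c y) > 0"
    using support_fun_upper[OF K(1,3), of "drop_coord c y"] by linarith
  then have "gauss_mean (\<lambda>x. support_fun K (drop_coord c x)) > 0"
    by (rule gauss_mean_pos[OF sublinear_comp[OF linear_drop_coord norm_drop_coord_le[OF c(1)]]])
  then show ?thesis
    using c(1) by (intro sum_pos2[of _ c]) (auto intro: gauss_mean_nonneg nonneg)
qed

lemma standard_cross_polytope_eq: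
  "standard_cross_polytope = convex hull (Basis \<union> uminus ` (Basis :: (real ^ 'n::finite) set))"
  unfolding standard_cross_polytope_def bij_betw_imp_surj_on[OF bij_betw_axis, symmetric]
  by (rule arg_cong[where f = "(hull) convex"]) auto

lemma
  shows compact_standard_cross_polytope: "compact (standard_cross_polytope :: (real ^ 'n::finite) set)"
    and convex_standard_cross_polytope: "convex (standard_cross_polytope :: (real ^ 'n) set)"
    and Basis_in_standard_cross_polytope: "(b :: real ^ 'n) \<in> Basis \<Longrightarrow> b \<in> standard_cross_polytope"
    and uminus_Basis_in_standard_cross_polytope: "(b :: real ^ 'n) \<in> Basis \<Longrightarrow> - b \<in> standard_cross_polytope"
  unfolding standard_cross_polytope_eq
  by (auto intro!: finite_imp_compact_convex_hull intro: hull_inc)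

lemma zero_in_standard_cross_polytope: "0 \<in> (standard_cross_polytope :: (real ^ 'n::finite) set)"
proof -
  obtain b :: "real ^ 'n" where b: "b \<in> Basis" using nonempty_Basis by blast
  have "(1/2) *\<^sub>R b + (1/2) *\<^sub>R (- b) \<in> standard_cross_polytope"
    by (intro convexD convex_standard_cross_polytope Basis_in_standard_cross_polytope
        uminus_Basis_in_standard_cross_polytope b) auto
  then show ?thesis by simp
qed

lemma support_fun_standard_cross_polytope:
  "support_fun standard_cross_polytope = (infnorm :: real ^ 'n::finite \<Rightarrow> real)"
proof (rule ext, rule antisym)
  fix x :: "real ^ 'n"
  let ?C = "standard_cross_polytope :: (real ^ 'n) set"
  have ne: "?C \<noteq> {}" using zero_in_standard_cross_polytope by auto
  obtain y where y: "y \<in> ?C" "support_fun ?C x = x \<bullet> y"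
    by (rule support_fun_attained[OF compact_standard_cross_polytope ne, of x])
  have "?C \<subseteq> {y. x \<bullet> y \<le> infnorm x}"
    unfolding standard_cross_polytope_eq
  proof (rule hull_minimal)
    show "Basis \<union> uminus ` Basis \<subseteq> {y. x \<bullet> y \<le> infnorm x}"
      using Basis_le_infnorm[of _ x] by (force simp: abs_le_iff)
  qed (rule convex_halfspace_le)
  with y show "support_fun ?C x \<le> infnorm x" by auto
  obtain b where b: "b \<in> Basis" "infnorm x = \<bar>x \<bullet> b\<bar>" by (rule infnorm_attained)
  show "infnorm x \<le> support_fun ?C x"
    using support_fun_upper[OF compact_standard_cross_polytope Basis_in_standard_cross_polytope[OF b(1)], of x]
      support_fun_upper[OF compact_standard_cross_polytope uminus_Basis_in_standard_cross_polytope[OF b(1)], of x]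
    by (simp add: b(2) abs_le_iff)
qed

lemma width_ratio_regular:
  fixes K :: "(real ^ 'n::finite) set"
  assumes "regular_coordinate_cross_polytope K"
  shows "width_ratio K = gauss_ratio (infnorm :: real ^ 'n \<Rightarrow> real)"
proof -
  let ?C = "standard_cross_polytope :: (real ^ 'n) set"
  note C = compact_standard_cross_polytope convex_standard_cross_polytope zero_in_standard_cross_polytope
  obtain x r where r: "r > 0" and K: "K = (\<lambda>y. x + r *\<^sub>R y) ` ?C"
    using assms unfolding regular_coordinate_cross_polytope_def by blast
  have "compact K" "convex K"
    unfolding K using compact_affinity[OF C(1)] convex_affinity[OF C(2)] by auto
  moreover have "x \<in> K" unfolding K using C(3) by (intro image_eqI[of _ _ 0]) auto
  moreover have "(+) (- x) ` K = (\<lambda>y. 0 + r *\<^sub>R y) ` ?C" by (simp add: K image_image)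
  moreover have ne: "?C \<noteq> {}" using C(3) by auto
  moreover have "support_fun ((\<lambda>y. 0 + r *\<^sub>R y) ` ?C) = (\<lambda>u. r * infnorm u)"
    by (rule ext) (use support_fun_affine_image[OF C(1) ne, of r 0] r in
        \<open>simp add: support_fun_standard_cross_polytope\<close>)
  ultimately have "width_ratio K = gauss_ratio (\<lambda>u :: real ^ 'n. r * infnorm u)"
    by (metis width_ratio_eq_gauss_ratio)
  also have "\<dots> = gauss_ratio (infnorm :: real ^ 'n \<Rightarrow> real)"
    using r by (simp add: gauss_ratio_def gauss_mean_def mult.assoc flip: sum_distrib_left)
  finally show ?thesis .
qed

lemma width_ratio_lower_bound:
  fixes K :: "(real ^ 'n::finite) set"
  assumes n: "CARD('n) \<ge> 3" and K: "compact K" "convex K" "aff_dim K \<ge> 1"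
  shows "gauss_ratio (infnorm :: real ^ 'n \<Rightarrow> real) \<le> width_ratio K"
    and "width_ratio K = gauss_ratio (infnorm :: real ^ 'n \<Rightarrow> real) \<Longrightarrow> regular_coordinate_cross_polytope K"
proof -
  let ?C = "standard_cross_polytope :: (real ^ 'n) set"
  note C = compact_standard_cross_polytope convex_standard_cross_polytope zero_in_standard_cross_polytope
  have dim: "DIM(real ^ 'n) \<ge> 2" "DIM(real ^ 'n) \<ge> 3" using n by auto
  obtain x y where xy: "x \<in> K" "y \<in> K" "x \<noteq> y" using K(3) by (auto simp: aff_dim_ge_1_iff)
  define L where "L = (+) (- x) ` K"
  have L: "compact L" "convex L" "0 \<in> L" "y - x \<in> L" "y - x \<noteq> 0"
    unfolding L_def using K xy
    by (simp_all add: compact_translation convex_translation del: uminus_add_conv_diff)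
      (force simp: image_iff intro: bexI[of _ x] bexI[of _ y])+
  have KL: "K = (+) x ` L" by (simp add: L_def image_image)
  interpret sublinear "support_fun L" by (rule sublinear_support_fun[OF L(1,3)])
  have wr: "width_ratio K = gauss_ratio (support_fun L)"
    unfolding L_def by (rule width_ratio_eq_gauss_ratio[OF K(1,2) xy(1)])
  have D: "(\<Sum>b\<in>Basis. gauss_mean (\<lambda>x. support_fun L (drop_coord b x))) > 0"
    by (rule gauss_denominator_pos[OF L(1,3,4,5) dim(1)])
  obtain b :: "real ^ 'n" where b: "b \<in> Basis" using nonempty_Basis by blast
  have E: "(\<Sum>b\<in>Basis. gauss_mean (\<lambda>x :: real ^ 'n. infnorm (drop_coord b x))) > 0"
    using gauss_denominator_pos[OF C(1,3) Basis_in_standard_cross_polytope[OF b] nonzero_Basis[OF b] dim(1)]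
    by (simp add: support_fun_standard_cross_polytope)
  show "gauss_ratio (infnorm :: real ^ 'n \<Rightarrow> real) \<le> width_ratio K"
    using gauss_mean_ineq(1)[OF dim(1)] D E by (simp add: wr gauss_ratio_def divide_simps mult.commute)
  assume "width_ratio K = gauss_ratio (infnorm :: real ^ 'n \<Rightarrow> real)"
  then have "gauss_mean (infnorm :: real ^ 'n \<Rightarrow> real) * (\<Sum>b\<in>Basis. gauss_mean (\<lambda>x. support_fun L (drop_coord b x)))
    = gauss_mean (support_fun L) * (\<Sum>b\<in>Basis. gauss_mean (\<lambda>x :: real ^ 'n. infnorm (drop_coord b x)))"
    using D E unfolding wr gauss_ratio_def by (subst (asm) frac_eq_eq) (auto simp: mult_ac)
  note eq = gauss_mean_ineq(2)[OF dim(1) this dim(2)]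
  obtain z a where a: "a \<ge> 0" and h: "\<And>u. support_fun L u = z \<bullet> u + a * infnorm u"
    using rigidity[OF eq dim(2)] by blast
  have Cne: "?C \<noteq> {}" using C(3) by auto
  have La: "L = (\<lambda>y. z + a *\<^sub>R y) ` ?C"
  proof (rule support_fun_inject)
    show "support_fun L u = support_fun ((\<lambda>y. z + a *\<^sub>R y) ` ?C) u" for u
      by (simp add: h support_fun_affine_image[OF C(1) Cne a] support_fun_standard_cross_polytope)
  qed (use L Cne compact_affinity[OF C(1), of z a] convex_affinity[OF C(2), of z a] in auto)
  \<comment> \<open>For a = 0 the set \<open>L\<close> would be a single point, but it contains 0
    and the nonzero vector \<open>y - x\<close>.\<close>
  have "a \<noteq> 0" using La L(3-5) by auto
  with a have "a > 0" by simp
  moreover have "K = (\<lambda>y. (x + z) + a *\<^sub>R y) ` ?C"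
    by (simp add: KL La image_image add.assoc)
  ultimately show "regular_coordinate_cross_polytope K"
    unfolding regular_coordinate_cross_polytope_def by blast
qed

theorem theorem4p1:
  fixes K :: "(real ^ 'n::finite) set"
  assumes "CARD('n) \<ge> 3"
    and "compact K" and "convex K" and "aff_dim K \<ge> 1"
  shows "(\<forall>L :: (real ^ 'n) set. compact L \<and> convex L \<and> aff_dim L \<ge> 1
            \<longrightarrow> width_ratio K \<le> width_ratio L)
         \<longleftrightarrow> regular_coordinate_cross_polytope K"
proof
  let ?C = "standard_cross_polytope :: (real ^ 'n) set"
  obtain b :: "real ^ 'n" where b: "b \<in> Basis" using nonempty_Basis by blast
  have C: "compact ?C" "convex ?C" "aff_dim ?C \<ge> 1"
    using compact_standard_cross_polytope convex_standard_cross_polytope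
      zero_in_standard_cross_polytope Basis_in_standard_cross_polytope[OF b] nonzero_Basis[OF b]
    by (auto simp: aff_dim_ge_1_iff)
  have "regular_coordinate_cross_polytope ?C"
    unfolding regular_coordinate_cross_polytope_def by (intro exI[of _ 0] exI[of _ 1]) simp
  note C_ratio = width_ratio_regular[OF this]
  assume "\<forall>L :: (real ^ 'n) set. compact L \<and> convex L \<and> aff_dim L \<ge> 1
            \<longrightarrow> width_ratio K \<le> width_ratio L"
  then have "width_ratio K \<le> gauss_ratio (infnorm :: real ^ 'n \<Rightarrow> real)"
    using C C_ratio by metis
  then show "regular_coordinate_cross_polytope K"
    using width_ratio_lower_bound[OF assms] by simp
next
  assume "regular_coordinate_cross_polytope K"
  then show "\<forall>L :: (real ^ 'n) set. compact L \<and> convex L \<and> aff_dim L \<ge> 1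
            \<longrightarrow> width_ratio K \<le> width_ratio L"
    using width_ratio_regular width_ratio_lower_bound(1)[OF assms(1)] by metis
qed

end
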